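(* Let $\mathcal{Y}$ be a nonempty measurable space and let $\mathcal{H}$ be a nonempty set of measurable functions $\mathbb{R}\to\mathcal{Y}$ satisfying the zero-measure crossings property and having graph dimension $d$ with $0<d<\infty$. Let $k\in\mathbb{N}$. For any $\varepsilon\in(0,1/2)$, there exists an $s$-sample $q$-query $\varepsilon$-tester for $\mathcal{F}_k(\mathcal{H})$ under the distribution $\mathrm{Uniform}(0,1)$ with $$s=O\!\left(\frac{d k}{\varepsilon^{6}}\ln\!\left(\frac{1}{\varepsilon}\right)\right)\quad\text{and}\quad q=O\!\left(\frac{d}{\varepsilon^{8}}\ln\!\left(\frac{1}{\varepsilon}\right)\right),$$ where the $O(\cdot)$ hide numerical constants independent of $k$, $d$, $\varepsilon$, and $\mathcal{H}$.
   Context: Zero-measure crossings: for all $h,h'\in\mathcal{H}$ with $h\neq h'$, the set $\{x: h(x)=h'(x)\}$ has Lebesgue measure $0$. Graph dimension $d$ of $\mathcal{H}$: the VC dimension of the collection of subsets $\{\{(x,h(x)):x\in\mathbb{R}\}: h\in\mathcal{H}\}$ of $\mathbb{R}\times\mathcal{Y}$. Piecewise class: with $t_0=-\infty$, $t_k=\infty$, for $t_1\le\cdots\le t_{k-1}$ in $\mathbb{R}$ and $h_1,\dots,h_k\in\mathcal{H}$, let $f(x;\{h_i\},\{t_i\})=h_i(x)$ for the $i$ with $t_{i-1}<x\le t_i$; $\mathcal{F}_k(\mathcal{H})$ is the set of all such functions. For measurable $f,g:\mathbb{R}\to\mathcal{Y}$ and $P=\mathrm{Uniform}(0,1)$, $\mathrm{dist}(f,g)=P(x:f(x)\neq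 g(x))$ and $\mathrm{dist}(f,\mathcal{F})=\inf_{g\in\mathcal{F}}\mathrm{dist}(f,g)$. An $s$-sample $q$-query $\varepsilon$-tester for $\mathcal{F}$ under $P$ is a randomized algorithm that draws a sample $S$ of at most $s$ points i.i.d. from $P$, sequentially (adaptively) queries the value of the unknown target function $f^*$ on at most $q$ points of $S$, and outputs accept or reject such that, for every measurable $f^*$: if $f^*\in\mathcal{F}$ it accepts with probability at least $2/3$, and if $\mathrm{dist}(f^*,\mathcal{F})\ge\varepsilon$ it rejects with probability at least $2/3$.
   Formalization: Adds a measurability proviso: for measurable f, the event that some h in H agrees with f on exactly a given subset of the sample points is Lebesgue measurable. Without it the claim fails, e.g. for the constants into the reals with the trivial sigma-algebra. *)

theory Defs
  imports "HOL-Probability.Probability"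
begin

definition shatters :: "'a set set \<Rightarrow> 'a set \<Rightarrow> bool" where
  "shatters \<C> A \<longleftrightarrow> (\<forall>B. B \<subseteq> A \<longrightarrow> (\<exists>S\<in>\<C>. S \<inter> A = B))"

definition vc_dim :: "'a set set \<Rightarrow> enat" where
  "vc_dim \<C> = (SUP A\<in>{A. finite A \<and> shatters \<C> A}. enat (card A))"

definition graph_dim :: "(real \<Rightarrow> 'y) set \<Rightarrow> enat" where
  "graph_dim H = vc_dim {{(x, h x) | x. True} | h. h \<in> H}"

definition zero_measure_crossings :: "(real \<Rightarrow> 'y) set \<Rightarrow> bool" where
  "zero_measure_crossings H \<longleftrightarrow>
     (\<forall>h\<in>H. \<forall>h'\<in>H. h \<noteq> h' \<longrightarrow> {x. h x = h' x} \<in> null_sets lebesgue)"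

definition piecewise :: "nat \<Rightarrow> (real \<Rightarrow> 'y) set \<Rightarrow> (real \<Rightarrow> 'y) set" where
  "piecewise k H = {f. \<exists>(h :: nat \<Rightarrow> real \<Rightarrow> 'y) (t :: nat \<Rightarrow> ereal).
     (\<forall>i\<in>{1..k}. h i \<in> H) \<and>
     t 0 = -\<infinity> \<and> t k = \<infinity> \<and>
     (\<forall>i\<in>{1..<k}. \<bar>t i\<bar> \<noteq> \<infinity>) \<and>
     (\<forall>i\<in>{1..<k}. \<forall>j\<in>{1..<k}. i \<le> j \<longrightarrow> t i \<le> t j) \<and>
     (\<forall>x. \<forall>i\<in>{1..k}. t (i - 1) < ereal x \<and> ereal x \<le> t i \<longrightarrow> f x = h i x)}"

definition unif01 :: "real measure" where
  "unif01 = uniform_measure lborel {0<..<1}"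

text \<open>
  Probabilities are taken in the completed measure, because for a general measurable
  space \<open>Y\<close> the set where two measurable functions agree need not be Borel
  (a crossing set is only known to be Lebesgue null).
\<close>

definition fdist :: "real measure \<Rightarrow> (real \<Rightarrow> 'y) \<Rightarrow> (real \<Rightarrow> 'y) \<Rightarrow> real" where
  "fdist P f g = measure (completion P) {x \<in> space P. f x \<noteq> g x}"

definition fdist_class :: "real measure \<Rightarrow> (real \<Rightarrow> 'y) \<Rightarrow> (real \<Rightarrow> 'y) set \<Rightarrow> real" where
  "fdist_class P f \<F> = (INF g\<in>\<F>. fdist P f g)"

text \<open>
  The measurability convention under which the probabilities of the events
  ``some member of \<open>H\<close> agrees with \<open>f\<close> on exactly these sample points'' make sense.
  It holds for countable \<open>H\<close> whenever sets of agreement are measurable. It cannot simply be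
  dropped: take \<open>Y\<close> the reals with the trivial sigma-algebra and \<open>H\<close> the constant functions.
  For every deterministic candidate tester of \<open>H\<close>, transfinite recursion yields a target with finite fibres
  (hence at distance 1 from \<open>H\<close>) that is accepted with outer probability at least 2/3.
\<close>

definition trace_measurable :: "'y measure \<Rightarrow> (real \<Rightarrow> 'y) set \<Rightarrow> bool" where
  "trace_measurable Y H \<longleftrightarrow>
     (\<forall>f \<in> borel \<rightarrow>\<^sub>M Y. \<forall>n::nat. \<forall>I \<subseteq> {..<n}.
        {x \<in> space (\<Pi>\<^sub>M i\<in>{..<n}. lborel). \<exists>h\<in>H. {i \<in> {..<n}. h (x i) = f (x i)} = I}
          \<in> sets (completion (\<Pi>\<^sub>M i\<in>{..<n}. lborel)))"

text \<open>
  An adaptive querying strategy for one fixed sample and one fixed outcome of the internal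
  coins: \<open>Query i c\<close> asks for the label of the \<open>i\<close>-th sample point and continues with
  \<open>c y\<close> on answer \<open>y\<close>.
\<close>

datatype 'y strategy = Accept | Reject | Query nat "'y \<Rightarrow> 'y strategy"

primrec accepts :: "'y strategy \<Rightarrow> (nat \<Rightarrow> 'y) \<Rightarrow> bool" where
  "accepts Accept a = True"
| "accepts Reject a = False"
| "accepts (Query i c) a = accepts (c (a i)) a"

primrec queries :: "'y strategy \<Rightarrow> (nat \<Rightarrow> 'y) \<Rightarrow> nat list" where
  "queries Accept a = []"
| "queries Reject a = []"
| "queries (Query i c) a = i # queries (c (a i)) a"

text \<open>
  \<open>R\<close> is the law of the internal coins, \<open>m\<close> the number of sample points drawn, and
  \<open>A \<omega> x\<close> the strategy followed on coins \<open>\<omega>\<close> and sample \<open>x\<close>. Since nonmeasurable sets have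
  measure 0, the two probability bounds include measurability of the event in question.
\<close>

definition is_tester ::
  "'y measure \<Rightarrow> real measure \<Rightarrow> (real \<Rightarrow> 'y) set \<Rightarrow> real \<Rightarrow> nat \<Rightarrow> nat \<Rightarrow>
   real measure \<Rightarrow> nat \<Rightarrow> (real \<Rightarrow> (nat \<Rightarrow> real) \<Rightarrow> 'y strategy) \<Rightarrow> bool" where
  "is_tester Y P \<F> \<epsilon> s q R m A \<longleftrightarrow>
     prob_space R \<and> m \<le> s \<and>
     (\<forall>\<omega> x a. set (queries (A \<omega> x) a) \<subseteq> {..<m} \<and> length (queries (A \<omega> x) a) \<le> q) \<and>
     (let \<Omega> = R \<Otimes>\<^sub>M (\<Pi>\<^sub>M i\<in>{..<m}. P) in
       \<forall>f \<in> borel \<rightarrow>\<^sub>M Y.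
         (f \<in> \<F> \<longrightarrow>
            measure (completion \<Omega>) {(\<omega>, x) \<in> space \<Omega>. accepts (A \<omega> x) (\<lambda>i. f (x i))} \<ge> 2/3) \<and>
         (fdist_class P f \<F> \<ge> \<epsilon> \<longrightarrow>
            measure (completion \<Omega>) {(\<omega>, x) \<in> space \<Omega>. \<not> accepts (A \<omega> x) (\<lambda>i. f (x i))} \<ge> 2/3))"

end

theory Submission
  imports Defs
begin

text \<open>
  A window of half-width \<open>r\<close> of order \<open>\<epsilon>/k\<close> around a uniform centre meets a breakpoint of a member of the
  piecewise class with probability at most \<open>2r(k-1)\<close>. Conversely, call a centre good if some
  \<open>h\<close> in \<open>H\<close> disagrees with \<open>f\<close> on measure less than \<open>\<rho>\<close>, a small multiple of \<open>\<epsilon>r\<close>, in its window. Two good centres at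
  distance less than \<open>2r - 2\<rho>\<close> share the same \<open>h\<close>, since different members of \<open>H\<close> agree only on a null set. Hence each change of \<open>h\<close> along the line costs
  a gap of length \<open>2r - 2\<rho>\<close> without good centres, and if the bad centres had measure below
  \<open>2r(k-1)\<close> plus a constant times \<open>\<epsilon>\<^sup>2\<close>, then \<open>f\<close> would be close to a piecewise function with about
  \<open>(1 + \<epsilon>/2)k\<close> pieces; dropping the shortest ones leaves \<open>k\<close> pieces at distance less than \<open>\<epsilon>\<close>.

  So it suffices to estimate the measure of the bad centres up to order \<open>\<epsilon>\<^sup>2\<close>, which takes order
  \<open>1/\<epsilon>\<^sup>4\<close> windows by Hoeffding's inequality. A window is rejected if no \<open>h\<close> agrees with \<open>f\<close> on all its
  sample points. By the double sample argument for classes of finite VC dimension, a bad window is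
  rejected with high probability once it contains order \<open>d/\<epsilon> ln(1/\<epsilon>)\<close> points.
\<close>

text \<open>Origin of the \<epsilon>^2: a surplus of \<epsilon>k/2 pieces can be merged away at cost
  \<epsilon>/2, and each surplus piece must be paid for by a gap of length almost 2r. With r =
  \<epsilon>/(32k) the bad centres then exceed 2r(k-1) by about \<epsilon>^2/32, and \<rho> =
  \<epsilon>r/8 keeps at least half of this. As rk is free of k, so is the number of windows.

  A window has length of order \<epsilon>/k, so a block needs a number of sample points proportional
  to k. Only the points inside the window are queried, which removes k from q. To avoid a factor ln
  k, traces are counted on the points inside the window: the number of small subsets of a random
  index set has an expectation governed by Mp, where p is the measure of the window.

  The obstacle throughout is measurability. \<open>H\<close> may be uncountable and agreement sets
  need not be Borel, so bad centres are handled through openness of the good ones, traces through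
  Borel sets \<open>T Z\<close> that are correct almost surely, and nonmeasurable disagreement sets
  through the convention that their measure is 0.\<close>

section \<open>Shattered sets and exchanges\<close>

text \<open>Pajor's form of the Sauer-Shelah lemma. Deleting \<open>a\<close> merges members of
  \<open>F\<close> in pairs, and \<open>G'\<close> records exactly these pairs. A set shattered by
  \<open>G'\<close> can be enlarged by \<open>a\<close> and is then shattered by \<open>F\<close>,
  so the two induction hypotheses count disjoint families of shattered sets, those without and those
  with \<open>a\<close>.\<close>

lemma card_le_card_shattered:
  fixes X :: "'a set"
  assumes "finite X" "F \<subseteq> Pow X"
  shows "card F \<le> card {S. S \<subseteq> X \<and> shatters F S}"
  using assms
proof (induction X arbitrary: F rule: finite_induct)
  case empty
  show ?case
  proof (cases "F = {}")
    case False
    then have "F = {{}}" using empty by auto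
    moreover have "{S. S \<subseteq> {} \<and> shatters {{}} S} = {{}::'a set}"
      by (auto simp: shatters_def)
    ultimately show ?thesis by simp
  qed simp
next
  case (insert a X)
  define G where "G = (\<lambda>S. S - {a}) ` F"
  define G' where "G' = {S. a \<notin> S \<and> S \<in> F \<and> insert a S \<in> F}"
  have fin: "finite F" using insert.prems insert.hyps(1) finite_subset by blast
  have "G \<subseteq> Pow X" "G' \<subseteq> Pow X" using insert.prems by (auto simp: G_def G'_def)
  then have IH: "card G \<le> card {S. S \<subseteq> X \<and> shatters G S}"
    "card G' \<le> card {S. S \<subseteq> X \<and> shatters G' S}"
    using insert.IH by auto
  have "card F = card {S\<in>F. a \<notin> S} + card {S\<in>F. a \<in> S}"
    using fin by (subst card_Un_disjoint[symmetric]) (auto intro: arg_cong[where f = card])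
  also have "card {S\<in>F. a \<in> S} = card ((\<lambda>S. S - {a}) ` {S\<in>F. a \<in> S})"
    by (rule card_image[symmetric]) (auto simp: inj_on_def)
  also have "card {S\<in>F. a \<notin> S} + card ((\<lambda>S. S - {a}) ` {S\<in>F. a \<in> S})
      = card ({S\<in>F. a \<notin> S} \<union> (\<lambda>S. S - {a}) ` {S\<in>F. a \<in> S})
        + card ({S\<in>F. a \<notin> S} \<inter> (\<lambda>S. S - {a}) ` {S\<in>F. a \<in> S})"
    using fin by (intro card_Un_Int) auto
  also have "{S\<in>F. a \<notin> S} \<union> (\<lambda>S. S - {a}) ` {S\<in>F. a \<in> S} = G"
  proof -
    have "F = {S\<in>F. a \<notin> S} \<union> {S\<in>F. a \<in> S}" by blast
    then have "G = (\<lambda>S. S - {a}) ` {S\<in>F. a \<notin> S} \<union> (\<lambda>S. S - {a}) ` {S\<in>F. a \<in> S}"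
      unfolding G_def by (metis image_Un)
    moreover have "(\<lambda>S. S - {a}) ` {S\<in>F. a \<notin> S} = (\<lambda>S. S) ` {S\<in>F. a \<notin> S}"
      by (rule image_cong) auto
    ultimately show ?thesis by simp
  qed
  also have "{S\<in>F. a \<notin> S} \<inter> (\<lambda>S. S - {a}) ` {S\<in>F. a \<in> S} = G'"
  proof (intro set_eqI iffI)
    fix S assume "S \<in> {S\<in>F. a \<notin> S} \<inter> (\<lambda>S. S - {a}) ` {S\<in>F. a \<in> S}"
    then obtain Q where "S \<in> F" "a \<notin> S" "Q \<in> F" "a \<in> Q" "S = Q - {a}" by auto
    then show "S \<in> G'" by (auto simp: G'_def insert_absorb)
  next
    fix S assume "S \<in> G'"
    then have "S \<in> F" "a \<notin> S" "insert a S \<in> F" "S = insert a S - {a}" by (auto simp: G'_def)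
    then show "S \<in> {S\<in>F. a \<notin> S} \<inter> (\<lambda>S. S - {a}) ` {S\<in>F. a \<in> S}" by blast
  qed
  finally have *: "card F = card G + card G'" .
  let ?S = "{S. S \<subseteq> X \<and> shatters G S}" and ?S' = "insert a ` {S. S \<subseteq> X \<and> shatters G' S}"
  have "card {S. S \<subseteq> X \<and> shatters G' S} = card ?S'"
    using insert.hyps(2) by (intro card_image[symmetric]) (auto simp: inj_on_def)
  then have "card F \<le> card ?S + card ?S'" using * IH by simp
  also have "\<dots> = card (?S \<union> ?S')"
    using insert.hyps by (intro card_Un_disjoint[symmetric]) auto
  also have "\<dots> \<le> card {S. S \<subseteq> insert a X \<and> shatters F S}"
  proof (rule card_mono)
    have 1: "shatters F S" if S: "S \<subseteq> X" and sh: "shatters G S" for S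
      unfolding shatters_def
    proof (intro allI impI)
      fix B assume "B \<subseteq> S"
      then obtain Q' where "Q' \<in> G" "Q' \<inter> S = B" using sh unfolding shatters_def by blast
      then obtain Q where "Q \<in> F" "(Q - {a}) \<inter> S = B" unfolding G_def by blast
      then show "\<exists>Q\<in>F. Q \<inter> S = B" using S insert.hyps(2) by (intro bexI[of _ Q]) auto
    qed
    have 2: "shatters F (insert a S)" if S: "S \<subseteq> X" and sh: "shatters G' S" for S
      unfolding shatters_def
    proof (intro allI impI)
      fix B assume B: "B \<subseteq> insert a S"
      then have "B - {a} \<subseteq> S" by auto
      then obtain Q where Q: "Q \<in> G'" "Q \<inter> S = B - {a}"
        using sh unfolding shatters_def by blast
      have "a \<notin> S" using S insert.hyps(2) by auto
      show "\<exists>Q\<in>F. Q \<inter> insert a S = B"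
      proof (cases "a \<in> B")
        case True
        then show ?thesis using Q B by (intro bexI[of _ "insert a Q"]) (auto simp: G'_def)
      next
        case False
        then show ?thesis using Q B by (intro bexI[of _ Q]) (auto simp: G'_def)
      qed
    qed
    show "?S \<union> ?S' \<subseteq> {S. S \<subseteq> insert a X \<and> shatters F S}" using 1 2 by auto
    show "finite {S. S \<subseteq> insert a X \<and> shatters F S}" using insert.hyps by simp
  qed
  finally show ?case .
qed

text \<open>Being the identity from \<open>2 * M\<close> on makes this an involution of all natural
  numbers, without side conditions on \<sigma> or \<open>i\<close>.\<close>

definition swap_halves :: "nat \<Rightarrow> nat set \<Rightarrow> nat \<Rightarrow> nat" where
  "swap_halves M \<sigma> i =
    (if i < M \<and> i \<in> \<sigma> then i + M else if M \<le> i \<and> i < 2 * M \<and> i - M \<in> \<sigma> then i - M else i)"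

lemma swap_halves_involution: "swap_halves M \<sigma> (swap_halves M \<sigma> i) = i"
proof (cases "i < M")
  case False
  show ?thesis
  proof (cases "i < 2 * M \<and> i - M \<in> \<sigma>")
    case True
    then have "i - M < M" "swap_halves M \<sigma> i = i - M" using False by (auto simp: swap_halves_def)
    then show ?thesis using True False by (simp add: swap_halves_def)
  next
    case False
    then have "swap_halves M \<sigma> i = i" using \<open>\<not> i < M\<close> by (auto simp: swap_halves_def)
    then show ?thesis by simp
  qed
qed (simp add: swap_halves_def)

lemma swap_halves_less: "i < 2 * M \<Longrightarrow> swap_halves M \<sigma> i < 2 * M"
  unfolding swap_halves_def by (simp add: less_imp_diff_less)

lemma swap_halves_first: "i < M \<Longrightarrow> swap_halves M \<sigma> i = (if i \<in> \<sigma> then i + M else i)"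
  by (simp add: swap_halves_def)

lemma inj_swap_halves: "inj_on (swap_halves M \<sigma>) A"
  by (rule inj_on_inverseI[where g = "swap_halves M \<sigma>"]) (simp add: swap_halves_involution)

text \<open>If both partners of some pair lie in \<open>D\<close>, one of them always ends up in the
  first half and no exchange qualifies. Otherwise each element of \<open>D\<close> dictates whether
  its pair is exchanged, which leaves \<open>M - card D\<close> free choices.\<close>

lemma card_swaps_clearing_first_half:
  assumes D: "D \<subseteq> {..<2*M}" "b \<le> card D"
  shows "card {\<sigma>. \<sigma> \<subseteq> {..<M} \<and> (\<forall>i<M. swap_halves M \<sigma> i \<notin> D)} * 2 ^ b \<le> 2 ^ M"
proof (cases "\<exists>i<M. i \<in> D \<and> i + M \<in> D")
  case True
  then obtain i where i: "i < M" "i \<in> D" "i + M \<in> D" by blast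
  then have "swap_halves M \<sigma> i \<in> D" for \<sigma> by (simp add: swap_halves_first)
  then have empty: "{\<sigma>. \<sigma> \<subseteq> {..<M} \<and> (\<forall>i<M. swap_halves M \<sigma> i \<notin> D)} = {}"
    using i(1) by blast
  show ?thesis unfolding empty by simp
next
  case False
  define D1 where "D1 = {i. i < M \<and> i \<in> D}"
  define D2 where "D2 = {i. i < M \<and> i + M \<in> D}"
  let ?S = "{\<sigma>. \<sigma> \<subseteq> {..<M} \<and> (\<forall>i<M. swap_halves M \<sigma> i \<notin> D)}"
  have fin: "finite D1" "finite D2" by (auto simp: D1_def D2_def)
  have disj: "D1 \<inter> D2 = {}" using False by (auto simp: D1_def D2_def)
  have sub: "D1 \<union> D2 \<subseteq> {..<M}" by (auto simp: D1_def D2_def)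
  have "D = D1 \<union> (\<lambda>i. i + M) ` D2"
  proof (intro set_eqI iffI)
    fix i assume i: "i \<in> D"
    show "i \<in> D1 \<union> (\<lambda>i. i + M) ` D2"
    proof (cases "i < M")
      case False
      then have "i = (i - M) + M" "i - M \<in> D2" using i D(1) by (auto simp: D2_def)
      then show ?thesis by blast
    qed (use i in \<open>auto simp: D1_def\<close>)
  qed (auto simp: D1_def D2_def)
  moreover have "card (D1 \<union> (\<lambda>i. i + M) ` D2) = card D1 + card ((\<lambda>i. i + M) ` D2)"
    using fin by (intro card_Un_disjoint) (auto simp: D1_def)
  ultimately have "card D = card D1 + card ((\<lambda>i. i + M) ` D2)" by simp
  also have "card ((\<lambda>i. i + M) ` D2) = card D2" by (rule card_image) (auto simp: inj_on_def)
  finally have cD: "card D = card (D1 \<union> D2)" using fin disj by (simp add: card_Un_disjoint)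
  have mem: "(\<forall>i\<in>D1. i \<in> \<sigma>) \<and> (\<forall>i\<in>D2. i \<notin> \<sigma>)" if "\<sigma> \<in> ?S" for \<sigma>
    using that unfolding D1_def D2_def by (auto simp: swap_halves_first split: if_splits)
  have "card ?S \<le> card (Pow ({..<M} - (D1 \<union> D2)))"
  proof (rule card_inj_on_le)
    show "inj_on (\<lambda>\<sigma>. \<sigma> - (D1 \<union> D2)) ?S"
    proof (rule inj_onI)
      fix s t assume st: "s \<in> ?S" "t \<in> ?S" "s - (D1 \<union> D2) = t - (D1 \<union> D2)"
      show "s = t" using mem[OF st(1)] mem[OF st(2)] st(3) by blast
    qed
  qed auto
  also have "\<dots> = 2 ^ (M - card D)"
    using sub fin by (simp add: card_Pow card_Diff_subset cD)
  finally have "card ?S * 2 ^ b \<le> 2 ^ (M - card D) * 2 ^ card D"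
    using D(2) by (intro mult_mono power_increasing) auto
  also have "\<dots> = 2 ^ M"
    using cD card_mono[OF _ sub] by (simp add: power_add[symmetric])
  finally show ?thesis .
qed

text \<open>As z/d is at least 1, each z^i is at most (z/d)^d d^i, and what remains is a partial sum
  of the exponential series at \<open>d\<close>. This plays the part of the usual bound (em/d)^d,
  with a real \<open>z\<close> because it will be an expected number of points.\<close>

lemma sum_power_div_fact_le:
  fixes z :: real
  assumes "real d \<le> z" "0 < d"
  shows "(\<Sum>i\<le>d. z ^ i / fact i) \<le> (exp 1 * z / d) ^ d"
proof -
  have "(\<Sum>i\<le>d. z ^ i / fact i) \<le> (\<Sum>i\<le>d. (z / d) ^ d * (real d ^ i / fact i))"
  proof (rule sum_mono)
    fix i assume "i \<in> {..d}"
    then have "(z / d) ^ i \<le> (z / d) ^ d"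
      using assms by (intro power_increasing) auto
    then have "(z / d) ^ i * (real d ^ i / fact i) \<le> (z / d) ^ d * (real d ^ i / fact i)"
      by (intro mult_right_mono) auto
    then show "z ^ i / fact i \<le> (z / d) ^ d * (real d ^ i / fact i)"
      using assms by (simp add: power_divide)
  qed
  also have "\<dots> = (z / d) ^ d * (\<Sum>i\<le>d. real d ^ i / fact i)" by (simp add: sum_distrib_left)
  also have "(\<Sum>i\<le>d. real d ^ i / fact i) \<le> exp (real d)"
    unfolding exp_def
    using summable_exp_generic[of "real d"]
    by (simp add: divide_inverse mult.commute)
       (rule sum_le_suminf, auto simp: scaleR_conv_of_real divide_inverse mult.commute)
  also have "exp (real d) = exp 1 ^ d" by (simp add: exp_of_nat_mult[symmetric])
  finally show ?thesis
    using assms by (simp add: power_mult_distrib[symmetric] mult.commute mult_left_mono)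
qed

section \<open>The uniform distribution on the unit interval\<close>

lemma space_unif01 [simp]: "space unif01 = UNIV"
  by (simp add: unif01_def)

lemma sets_unif01 [simp, measurable_cong]: "sets unif01 = sets borel"
  by (simp add: unif01_def)

lemma emeasure_unif01: "A \<in> sets borel \<Longrightarrow> emeasure unif01 A = emeasure lborel ({0<..<1} \<inter> A)"
  by (simp add: unif01_def divide_ennreal_def)

interpretation unif01: prob_space unif01
  unfolding unif01_def by (rule prob_space_uniform_measure) auto

interpretation unif01c: prob_space "completion unif01"
  by (rule unif01.prob_space_completion)

lemma measure_unif01_eq: "0 \<le> a \<Longrightarrow> a \<le> b \<Longrightarrow> b \<le> 1 \<Longrightarrow> measure unif01 {a<..<b} = b - a"
proof -
  assume ab: "0 \<le> a" "a \<le> b" "b \<le> 1"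
  then have "{0<..<1} \<inter> {a<..<b} = {a<..<b}" by auto
  then show ?thesis using ab by (simp add: measure_def emeasure_unif01)
qed

lemma measure_unif01_le:
  assumes A: "A \<in> sets borel" and "A \<inter> {0<..<1} \<subseteq> {a..b}" "a \<le> b"
  shows "measure unif01 A \<le> b - a"
proof -
  have "emeasure unif01 A \<le> emeasure lborel {a..b}"
    unfolding emeasure_unif01[OF A] using assms by (intro emeasure_mono) auto
  then have "ennreal (measure unif01 A) \<le> ennreal (b - a)"
    using assms by (simp add: unif01.emeasure_eq_measure)
  then show ?thesis using assms by (simp add: ennreal_le_iff)
qed

lemma null_sets_unif01I:
  assumes "N \<in> null_sets lebesgue"
  shows "N \<in> null_sets (completion unif01)"
proof -
  obtain N' where N': "N' \<in> null_sets lborel" "N \<subseteq> N'"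
    using assms unfolding null_sets_completion_iff2 by auto
  then have "emeasure unif01 N' = 0"
    by (simp add: emeasure_unif01 null_sets_def) (metis Int_lower2 emeasure_mono le_zero_eq sets_lborel)
  then have "N' \<in> null_sets unif01" using N' by (auto simp: null_sets_def)
  then show ?thesis using N' unfolding null_sets_completion_iff2 by blast
qed

lemma fdist_le:
  assumes D: "D \<in> sets (completion unif01)" and sub: "{x. f x \<noteq> g x} \<subseteq> D"
  shows "fdist unif01 f g \<le> measure (completion unif01) D"
  unfolding fdist_def using assms
  \<comment> \<open>Outside the sigma-algebra \<open>measure\<close> is 0, so a nonmeasurable
    disagreement set satisfies the bound trivially.\<close>
  by (cases "{x. f x \<noteq> g x} \<in> sets (completion unif01)")
     (auto intro!: unif01c.finite_measure_mono simp: measure_notin_sets)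

section \<open>Piecewise functions\<close>

lemma piecewiseI:
  fixes t :: "nat \<Rightarrow> ereal"
  assumes "\<And>i. i \<in> {1..k} \<Longrightarrow> h i \<in> H" "t 0 = -\<infinity>" "t k = \<infinity>"
    and "\<And>i. i \<in> {1..<k} \<Longrightarrow> \<bar>t i\<bar> \<noteq> \<infinity>"
    and "\<And>i j. i \<in> {1..<k} \<Longrightarrow> j \<in> {1..<k} \<Longrightarrow> i \<le> j \<Longrightarrow> t i \<le> t j"
    and "\<And>x i. i \<in> {1..k} \<Longrightarrow> t (i - 1) < ereal x \<Longrightarrow> ereal x \<le> t i \<Longrightarrow> f x = h i x"
  shows "f \<in> piecewise k H"
  unfolding piecewise_def
  using assms by (intro CollectI exI[of _ h] exI[of _ t] conjI ballI allI impI) simp_all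

lemma subset_piecewise: "0 < k \<Longrightarrow> H \<subseteq> piecewise k H"
proof
  fix h assume k: "0 < k" and h: "h \<in> H"
  show "h \<in> piecewise k H"
    unfolding piecewise_def
    using k h
    by (intro CollectI exI[of _ "\<lambda>_. h"] exI[of _ "\<lambda>i. if i = 0 then -\<infinity> else if i = k then \<infinity> else 0"])
       auto
qed

text \<open>The old breakpoints are raised to at least \<open>c\<close>. Pieces of \<open>g\<close>
  left of \<open>c\<close> become empty, which the non-strict order of the breakpoints permits, so
  the number of pieces grows by exactly one.\<close>

lemma piecewise_cons:
  assumes n: "0 < n" and g: "g \<in> piecewise n H" and h: "h \<in> H"
  shows "(\<lambda>x. if x \<le> c then h x else g x) \<in> piecewise (Suc n) H"
proof -
  from g obtain u t where u: "\<forall>i\<in>{1..n}. u i \<in> H"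
    and t: "t 0 = -\<infinity>" "t n = \<infinity>" "\<forall>i\<in>{1..<n}. \<bar>t i\<bar> \<noteq> \<infinity>"
      "\<forall>i\<in>{1..<n}. \<forall>j\<in>{1..<n}. i \<le> j \<longrightarrow> t i \<le> t j"
    and eq: "\<forall>x. \<forall>i\<in>{1..n}. t (i - 1) < ereal x \<and> ereal x \<le> t i \<longrightarrow> g x = u i x"
    unfolding piecewise_def by blast
  define u' where "u' i = (if i = 1 then h else u (i - 1))" for i
  define t' where "t' i = (if i = 0 then -\<infinity> else if i = Suc n then \<infinity> else max (ereal c) (t (i - 1)))" for i
  have fin: "\<bar>t' i\<bar> \<noteq> \<infinity>" if "i \<in> {1..<Suc n}" for i
  proof (cases "i = 1")
    case True
    then show ?thesis using t(1) n by (simp add: t'_def)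
  next
    case False
    then have "i - 1 \<in> {1..<n}" using that by auto
    then have "\<bar>t (i - 1)\<bar> \<noteq> \<infinity>" by (rule bspec[OF t(3)])
    then show ?thesis using that by (cases "t (i - 1)") (auto simp: t'_def max_def)
  qed
  have mono: "t' i \<le> t' j" if ij: "i \<in> {1..<Suc n}" "j \<in> {1..<Suc n}" "i \<le> j" for i j
  proof (cases "i = 1")
    case True
    then show ?thesis using ij t(1) n by (auto simp: t'_def)
  next
    case False
    then have "i - 1 \<in> {1..<n}" "j - 1 \<in> {1..<n}" "i - 1 \<le> j - 1" using ij by auto
    then have "t (i - 1) \<le> t (j - 1)" using t(4) by blast
    then show ?thesis using ij by (auto simp: t'_def max_def)
  qed
  have val: "(if x \<le> c then h x else g x) = u' i x"
    if i: "i \<in> {1..Suc n}" and x: "t' (i - 1) < ereal x" "ereal x \<le> t' i" for x i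
  proof (cases "i = 1")
    case True
    then show ?thesis using x t(1) n by (auto simp: t'_def u'_def)
  next
    case False
    then have i2: "i - 1 \<in> {1..n}" "i - 1 \<noteq> 0" "i - 1 \<noteq> Suc n" using i by auto
    have 1: "c < x" "t (i - 1 - 1) < ereal x" using x(1) i2 by (auto simp: t'_def)
    have "ereal x \<le> t (i - 1)"
      using x(2) i False 1(1) t(2) by (cases "i = Suc n") (auto simp: t'_def max_def split: if_splits)
    then show ?thesis using eq 1 i2 False by (auto simp: u'_def)
  qed
  have "u' i \<in> H" if "i \<in> {1..Suc n}" for i
  proof (cases "i = 1")
    case False
    then have "i - 1 \<in> {1..n}" using that by auto
    then show ?thesis using u False by (simp add: u'_def)
  qed (simp add: u'_def h)
  moreover have "t' 0 = -\<infinity>" "t' (Suc n) = \<infinity>" by (simp_all add: t'_def)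
  ultimately show ?thesis
    using fin mono val by (rule piecewiseI)
qed

text \<open>Piece \<open>p\<close> is absorbed by its left neighbour, or by its right one if it is
  the first. In the new numbering \<open>c\<close> is the absorbing piece, and \<open>t c\<close> is
  the breakpoint that disappears.\<close>

lemma piecewise_merge_at:
  fixes h :: "nat \<Rightarrow> real \<Rightarrow> 'y" and t :: "nat \<Rightarrow> ereal"
  assumes n: "0 < n" and h: "\<forall>i\<in>{1..Suc n}. h i \<in> H"
    and t: "t 0 = -\<infinity>" "t (Suc n) = \<infinity>" "\<forall>i\<in>{1..<Suc n}. \<bar>t i\<bar> \<noteq> \<infinity>"
      "\<forall>i\<in>{1..<Suc n}. \<forall>j\<in>{1..<Suc n}. i \<le> j \<longrightarrow> t i \<le> t j"
    and eq: "\<forall>x. \<forall>i\<in>{1..Suc n}. t (i - 1) < ereal x \<and> ereal x \<le> t i \<longrightarrow> g x = h i x"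
    and p: "p \<in> {1..Suc n}"
  shows "\<exists>g'\<in>piecewise n H. \<forall>x. \<not> (t (p - 1) < ereal x \<and> ereal x \<le> t p) \<longrightarrow> g x = g' x"
proof -
  have tmono: "t i \<le> t j" if "i \<le> j" "j \<le> Suc n" for i j
  proof (cases "i = 0 \<or> j = Suc n")
    case False
    then show ?thesis using that t(4) by auto
  qed (use t in auto)
  define c where "c = (if p = 1 then 1 else p - 1)"
  define h' where "h' j = (if j < c then h j else if j = c then (if p = 1 then h 2 else h c) else h (Suc j))" for j
  define t' where "t' j = (if j < c then t j else t (Suc j))" for j
  define g' where "g' x = (if t (p - 1) < ereal x \<and> ereal x \<le> t p then h' c x else g x)" for x
  have c: "c \<in> {1..n}" and pc: "p = c \<or> p = Suc c" "p = c \<longleftrightarrow> p = 1"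
    using p n by (auto simp: c_def)
  have "h' j \<in> H" if "j \<in> {1..n}" for j
    using h that n c by (auto simp: h'_def)
  moreover have "t' 0 = -\<infinity>" "t' n = \<infinity>"
    using c t by (auto simp: t'_def)
  moreover have "\<bar>t' i\<bar> \<noteq> \<infinity>" if "i \<in> {1..<n}" for i
    using t(3) that by (auto simp: t'_def)
  moreover have "t' i \<le> t' j" if "i \<in> {1..<n}" "j \<in> {1..<n}" "i \<le> j" for i j
    using that by (auto simp: t'_def intro!: tmono)
  moreover have "g' x = h' j x"
    if j: "j \<in> {1..n}" and x: "t' (j - 1) < ereal x" "ereal x \<le> t' j" for x j
  proof -
    have notp: "\<not> (t (p - 1) < ereal x \<and> ereal x \<le> t p)"
      if "i \<le> Suc n" "t (i - 1) < ereal x" "ereal x \<le> t i" "i \<noteq> p" "1 \<le> i" for i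
    proof (cases "i < p")
      case True
      then have "t i \<le> t (p - 1)" using p by (intro tmono) auto
      then show ?thesis using that by auto
    next
      case False
      then have "t p \<le> t (i - 1)" using that by (intro tmono) auto
      then show ?thesis using that by auto
    qed
    consider "j < c" | "j = c" | "c < j" by linarith
    then show ?thesis
    proof cases
      case 1
      then have x': "t (j - 1) < ereal x" "ereal x \<le> t j" using x less_imp_diff_less[OF 1, of 1] by (simp_all add: t'_def)
      have "\<not> (t (p - 1) < ereal x \<and> ereal x \<le> t p)"
        using 1 j pc x' by (intro notp[of j]) auto
      then show ?thesis using 1 j x' eq by (auto simp: g'_def h'_def)
    next
      case 2
      show ?thesis
      proof (cases "t (p - 1) < ereal x \<and> ereal x \<le> t p")
        case True
        then show ?thesis using 2 by (simp add: g'_def)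
      next
        case False
        have x': "t (c - 1) < ereal x" "ereal x \<le> t (Suc c)" using x 2 c by (auto simp: t'_def)
        show ?thesis
        proof (cases "p = 1")
          case True
          then have "c = 1" by (simp add: c_def)
          then have "g x = h 2 x" using False x' True n eq[rule_format, of 2 x] by (auto simp: not_less numeral_2_eq_2)
          then show ?thesis using False 2 True \<open>c = 1\<close> by (auto simp: g'_def h'_def)
        next
          case p1: False
          then have "p = Suc c" using pc by auto
          then have "ereal x \<le> t c" using False x' by auto
          then have "g x = h c x" using x' c eq[rule_format, of c x] by auto
          then show ?thesis using False 2 p1 by (auto simp: g'_def h'_def)
        qed
      qed
    next
      case 3
      then have x': "t (Suc j - 1) < ereal x" "ereal x \<le> t (Suc j)" using x by (auto simp: t'_def split: if_splits)
      have "\<not> (t (p - 1) < ereal x \<and> ereal x \<le> t p)"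
        using 3 j pc x' by (intro notp[of "Suc j"]) auto
      moreover have "g x = h (Suc j) x" using x' j eq[rule_format, of "Suc j" x] by auto
      ultimately show ?thesis using 3 by (auto simp: g'_def h'_def)
    qed
  qed
  ultimately have "g' \<in> piecewise n H" by (rule piecewiseI)
  then show ?thesis by (intro bexI[of _ g']) (auto simp: g'_def)
qed

text \<open>The n + 1 pieces are disjoint, so the lightest has mass at most 1/(n+1); it is the one
  merged away.\<close>

lemma piecewise_Suc_approx:
  assumes n: "0 < n" and g: "g \<in> piecewise (Suc n) H"
  shows "\<exists>g'\<in>piecewise n H. \<exists>D\<in>sets borel. {x. g x \<noteq> g' x} \<subseteq> D \<and> measure unif01 D \<le> 1 / Suc n"
proof -
  from g obtain h t where h: "\<forall>i\<in>{1..Suc n}. h i \<in> H"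
    and t: "t 0 = -\<infinity>" "t (Suc n) = \<infinity>" "\<forall>i\<in>{1..<Suc n}. \<bar>t i\<bar> \<noteq> \<infinity>"
      "\<forall>i\<in>{1..<Suc n}. \<forall>j\<in>{1..<Suc n}. i \<le> j \<longrightarrow> t i \<le> t j"
    and eq: "\<forall>x. \<forall>i\<in>{1..Suc n}. t (i - 1) < ereal x \<and> ereal x \<le> t i \<longrightarrow> g x = h i x"
    unfolding piecewise_def by blast
  have tmono: "t i \<le> t j" if "i \<le> j" "j \<le> Suc n" for i j
  proof (cases "i = 0 \<or> j = Suc n")
    case False
    then show ?thesis using that t(4) by auto
  qed (use t in auto)
  define D where "D i = {x. t (i - 1) < ereal x \<and> ereal x \<le> t i}" for i
  have D[measurable]: "D i \<in> sets borel" for i unfolding D_def by measurable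
  have disj: "disjoint_family_on D {1..Suc n}"
  proof -
    have "D i \<inter> D j = {}" if "i < j" "j \<le> Suc n" for i j
    proof -
      have "t i \<le> t (j - 1)" using that by (intro tmono) auto
      then show ?thesis by (auto simp: D_def)
    qed
    then show ?thesis unfolding disjoint_family_on_def
      by (metis Int_commute atLeastAtMost_iff nat_neq_iff)
  qed
  have "(\<Sum>i\<in>{1..Suc n}. measure unif01 (D i)) = measure unif01 (\<Union>i\<in>{1..Suc n}. D i)"
    using disj by (intro unif01.finite_measure_finite_Union[symmetric]) auto
  also have "\<dots> \<le> 1" by simp
  finally have le1: "(\<Sum>i\<in>{1..Suc n}. measure unif01 (D i)) \<le> 1" .
  have "\<exists>p\<in>{1..Suc n}. measure unif01 (D p) \<le> 1 / Suc n"
  proof (rule ccontr)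
    assume "\<not> ?thesis"
    then have "(\<Sum>i\<in>{1..Suc n}. 1 / Suc n) < (\<Sum>i\<in>{1..Suc n}. measure unif01 (D i))"
      by (intro sum_strict_mono) (auto simp: not_le)
    then show False using le1 by simp
  qed
  then obtain p where p: "p \<in> {1..Suc n}" "measure unif01 (D p) \<le> 1 / Suc n" by blast
  obtain g' where g': "g' \<in> piecewise n H" "\<forall>x. \<not> (t (p - 1) < ereal x \<and> ereal x \<le> t p) \<longrightarrow> g x = g' x"
    using piecewise_merge_at[OF n h t eq p(1)] by blast
  then have "{x. g x \<noteq> g' x} \<subseteq> D p" by (auto simp: D_def)
  then show ?thesis using g' p by (intro bexI[of _ g'] bexI[of _ "D p"]) auto
qed

lemma piecewise_approx:
  assumes k: "0 < k" and "k \<le> n" "g \<in> piecewise n H"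
  shows "\<exists>g'\<in>piecewise k H. \<exists>D\<in>sets borel. {x. g x \<noteq> g' x} \<subseteq> D \<and> measure unif01 D \<le> (real n - real k) / real k"
  using assms(2,3)
proof (induction n arbitrary: g rule: dec_induct)
  case base
  then show ?case by (intro bexI[of _ g] bexI[of _ "{}"]) auto
next
  case (step n)
  have "0 < n" using k step by simp
  then obtain g1 D1 where 1: "g1 \<in> piecewise n H" "D1 \<in> sets borel" "{x. g x \<noteq> g1 x} \<subseteq> D1"
      "measure unif01 D1 \<le> 1 / Suc n"
    using piecewise_Suc_approx step.prems by blast
  obtain g2 D2 where 2: "g2 \<in> piecewise k H" "D2 \<in> sets borel" "{x. g1 x \<noteq> g2 x} \<subseteq> D2"
      "measure unif01 D2 \<le> (real n - real k) / real k"
    using step.IH[OF 1(1)] by blast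
  have "measure unif01 (D1 \<union> D2) \<le> measure unif01 D1 + measure unif01 D2"
    using 1 2 by (intro measure_Un_le) auto
  also have "\<dots> \<le> 1 / Suc n + (real n - real k) / real k" using 1 2 by simp
  \<comment> \<open>Each merge starts from more than \<open>k\<close> pieces, so it can be charged
    1/k.\<close>
  also have "1 / Suc n \<le> 1 / real k" using k step by (intro divide_left_mono) auto
  finally have "measure unif01 (D1 \<union> D2) \<le> (real (Suc n) - real k) / real k"
    by (simp add: diff_divide_distrib add_divide_distrib)
  moreover have "{x. g x \<noteq> g2 x} \<subseteq> D1 \<union> D2" using 1(3) 2(3) by fastforce
  ultimately show ?case using 1 2 by (intro bexI[of _ g2] bexI[of _ "D1 \<union> D2"]) auto
qed

text \<open>
  Scan from the left: \<open>c\<close> is the largest point such that \<open>u\<close> is constant on \<open>G\<close> between \<open>a\<close> and \<open>c\<close>.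
  If \<open>c < L\<close>, then \<open>G\<close> misses the interval of length \<open>w\<close> left of \<open>c\<close>.
\<close>

lemma locally_constant_piecewise:
  fixes u :: "real \<Rightarrow> real \<Rightarrow> 'y"
  assumes G: "open G" and w: "0 < w" and H: "H \<noteq> {}"
    and u: "\<And>x. x \<in> G \<Longrightarrow> u x \<in> H"
    and const: "\<And>x y. x \<in> G \<Longrightarrow> y \<in> G \<Longrightarrow> \<bar>x - y\<bar> < w \<Longrightarrow> u x = u y"
  shows "0 < n \<Longrightarrow> measure lborel ({a<..<L} - G) < real n * w \<Longrightarrow>
    \<exists>g\<in>piecewise n H. \<forall>x\<in>G \<inter> {a<..<L}. g x = u x x"
proof (induction n arbitrary: a)
  case (Suc n)
  obtain h0 where h0: "h0 \<in> H" using H by blast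
  have Gm[measurable]: "G \<in> sets borel" using G by simp
  have one: ?case if all: "\<forall>x\<in>G\<inter>{a<..<L}. \<forall>y\<in>G\<inter>{a<..<L}. u x = u y"
  proof (cases "G \<inter> {a<..<L} = {}")
    case True
    then show ?thesis using h0 subset_piecewise[of "Suc n" H] by (intro bexI[of _ h0]) auto
  next
    case False
    then obtain z where z: "z \<in> G \<inter> {a<..<L}" by blast
    have "u z x = u x x" if "x \<in> G \<inter> {a<..<L}" for x
      using all[rule_format, OF z that] by simp
    moreover have "u z \<in> piecewise (Suc n) H" using u[of z] z subset_piecewise[of "Suc n" H] by auto
    ultimately show ?thesis by blast
  qed
  show ?case
  proof (cases "a < L")
    case False
    then show ?thesis by (intro one) auto
  next
    case True
    define S where "S = {c. a < c \<and> c \<le> L \<and> (\<forall>x\<in>G\<inter>{a<..<c}. \<forall>y\<in>G\<inter>{a<..<c}. u x = u y)}"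
    \<comment> \<open>Two points of an open interval of length \<open>w\<close> are closer than
      \<open>w\<close>, so the scan does move beyond \<open>a\<close>.\<close>
    have "min L (a + w) \<in> S" using True w by (auto simp: S_def intro!: const)
    then have ne: "S \<noteq> {}" by blast
    have bdd: "bdd_above S" by (auto simp: S_def bdd_above_def)
    define c where "c = Sup S"
    have ac: "a < c" using ne bdd unfolding c_def
      by (metis (mono_tags, lifting) S_def all_not_in_conv cSup_upper mem_Collect_eq order_less_le_trans)
    have cL: "c \<le> L" using ne unfolding c_def by (rule cSup_least) (auto simp: S_def)
    have cc: "u x = u y" if xy: "x \<in> G \<inter> {a<..<c}" "y \<in> G \<inter> {a<..<c}" for x y
    proof -
      have "max x y < Sup S" using xy by (auto simp: c_def)
      then obtain s where "s \<in> S" "max x y < s" using less_cSup_iff[OF ne bdd] by blast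
      then show ?thesis using xy by (auto simp: S_def)
    qed
    show ?thesis
    proof (cases "c = L")
      case True
      have "\<forall>x\<in>G\<inter>{a<..<L}. \<forall>y\<in>G\<inter>{a<..<L}. u x = u y"
        unfolding True[symmetric] using cc by blast
      then show ?thesis by (rule one)
    next
      case False
      then have cL': "c < L" using cL by simp
      have notS: False if s: "c < s" "s \<le> L" "\<forall>x\<in>G\<inter>{a<..<s}. \<forall>y\<in>G\<inter>{a<..<s}. u x = u y" for s
      proof -
        have "s \<in> S" unfolding S_def mem_Collect_eq
          using s(1) ac by (intro conjI s(2,3)) simp
        then have "s \<le> c" unfolding c_def using bdd by (rule cSup_upper)
        then show False using s by simp
      qed
      \<comment> \<open>A good \<open>y\<close> here would force the common value left of
        \<open>c\<close> onto all good points before \<open>y + w\<close>, which lies beyond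
        \<open>c\<close>, contrary to the maximality of \<open>c\<close>.\<close>
      have gap: "y \<notin> G" if y: "a < y" "c - w < y" "y < c" for y
      proof
        assume yG: "y \<in> G"
        have *: "u x = u y" if x: "x \<in> G \<inter> {a<..<min L (y + w)}" for x
        proof (cases "x < c")
          case True
          then show ?thesis using x y yG by (intro cc) auto
        next
          case False
          then show ?thesis using x y yG by (intro const) auto
        qed
        show False
        proof (rule notS[of "min L (y + w)"])
          show "\<forall>x\<in>G \<inter> {a<..<min L (y + w)}. \<forall>x'\<in>G \<inter> {a<..<min L (y + w)}. u x = u x'"
          proof (intro ballI)
            fix x x' assume "x \<in> G \<inter> {a<..<min L (y + w)}" "x' \<in> G \<inter> {a<..<min L (y + w)}"
            from *[OF this(1)] *[OF this(2)] show "u x = u x'" by (rule trans[OF _ sym])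
          qed
        qed (use y cL' in auto)
      qed
      have aw: "a \<le> c - w"
      proof (rule ccontr)
        assume "\<not> a \<le> c - w"
        then have lt: "c < min L (a + w)" using cL' by auto
        show False
        proof (rule notS[OF lt])
          show "\<forall>x\<in>G \<inter> {a<..<min L (a + w)}. \<forall>y\<in>G \<inter> {a<..<min L (a + w)}. u x = u y"
            by (auto intro!: const)
        qed simp
      qed
      \<comment> \<open>As \<open>G\<close> is open, a neighbourhood of \<open>c\<close> in
        \<open>G\<close> would meet the gap. This matters because \<open>piecewise_cons\<close>
        gives the point \<open>c\<close> to the left piece, whereas \<open>cc\<close> covers only
        points below \<open>c\<close>.\<close>
      have cG: "c \<notin> G"
      proof
        assume "c \<in> G"
        then obtain e where e: "0 < e" "ball c e \<subseteq> G" using G open_contains_ball by blast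
        define y where "y = c - min e w / 2"
        have "y \<in> ball c e" "a < y" "c - w < y" "y < c"
          using e w aw by (auto simp: y_def dist_real_def min_def field_simps)
        then show False using gap[of y] e by blast
      qed
      have fin: "emeasure lborel ({b<..<L} - G) < \<infinity>" if "b < L" for b
      proof -
        have "emeasure lborel ({b<..<L} - G) \<le> emeasure lborel {b<..<L}" by (intro emeasure_mono) auto
        also have "\<dots> < \<infinity>" using that by simp
        finally show ?thesis .
      qed
      \<comment> \<open>The gap left of \<open>c\<close> uses up \<open>w\<close> of the measure,
        exactly what one piece costs in the induction.\<close>
      have "measure lborel ({c<..<L} - G) + w = measure lborel (({c<..<L} - G) \<union> {c - w<..<c})"
        using w fin[OF cL'] by (subst measure_Union) auto
      also have "\<dots> \<le> measure lborel ({a<..<L} - G)"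
        using fin[OF \<open>a < L\<close>] aw cL' ac gap w by (intro measure_mono_fmeasurable) (auto simp: fmeasurable_def)
      also have "\<dots> < real (Suc n) * w" by fact
      finally have lt: "measure lborel ({c<..<L} - G) < real n * w" by (simp add: algebra_simps)
      \<comment> \<open>For n = 0 the measure right of \<open>c\<close> would be negative, so a
        piece is left for that side.\<close>
      then have n: "0 < n"
        by (cases "n = 0") (auto simp: not_less)
      obtain g where g: "g \<in> piecewise n H" "\<forall>x\<in>G \<inter> {c<..<L}. g x = u x x"
        using Suc.IH[OF n lt] by blast
      obtain h where h: "h \<in> H" "\<forall>x\<in>G \<inter> {a<..<c}. h = u x"
      proof (cases "G \<inter> {a<..<c} = {}")
        case True
        then show ?thesis using h0 that by auto
      next
        case False
        then obtain z where z: "z \<in> G \<inter> {a<..<c}" by blast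
        have "u z \<in> H" using z u by auto
        moreover have "\<forall>x\<in>G \<inter> {a<..<c}. u z = u x" using cc[OF z] by blast
        ultimately show ?thesis by (rule that)
      qed
      have "(if x \<le> c then h x else g x) = u x x" if x: "x \<in> G \<inter> {a<..<L}" for x
      proof -
        have "x \<noteq> c" using x cG by auto
        then consider "x \<in> G \<inter> {a<..<c}" | "x \<in> G \<inter> {c<..<L}" using x by fastforce
        then show ?thesis
        proof cases
          case 1
          then have "h = u x" using h(2) by blast
          then show ?thesis using 1 by simp
        qed (use g(2) in auto)
      qed
      then show ?thesis using piecewise_cons[OF n g(1) h(1), of c] by (intro bexI) auto
    qed
  qed
qed simp

section \<open>Bad centres\<close>

text \<open>The restriction of the centre keeps the window inside the unit interval, where its
  measure is exactly 2r.\<close>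

definition bad_centres :: "(real \<Rightarrow> 'y) set \<Rightarrow> (real \<Rightarrow> 'y) \<Rightarrow> real \<Rightarrow> real \<Rightarrow> real set" where
  "bad_centres H f r \<rho> = {c \<in> {r<..<1-r}.
     \<forall>h\<in>H. \<rho> \<le> measure (completion unif01) ({x. f x \<noteq> h x} \<inter> {c-r<..<c+r})}"

text \<open>Moving the centre by s changes the measure of the disagreement inside the window by at
  most s. Openness makes the bad centres Borel even for uncountable \<open>H\<close>, and the
  left-to-right scan relies on it.\<close>

lemma open_good_centres:
  assumes dis: "\<And>h. h \<in> H \<Longrightarrow> {x. f x \<noteq> h x} \<in> sets (completion unif01)"
  shows "open ({r<..<1-r} - bad_centres H f r \<rho>)"
proof -
  let ?U = "completion unif01"
  have ivl: "{a<..<b} \<in> sets ?U" "{a..b} \<in> sets ?U" for a b :: real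
    by (auto intro!: sets_completionI_sets)
  have "\<exists>T. open T \<and> c \<in> T \<and> T \<subseteq> {r<..<1-r} - bad_centres H f r \<rho>"
    if c: "c \<in> {r<..<1-r} - bad_centres H f r \<rho>" for c
  proof -
    obtain h where h: "h \<in> H" "measure ?U ({x. f x \<noteq> h x} \<inter> {c-r<..<c+r}) < \<rho>"
      using c by (auto simp: bad_centres_def not_le)
    define s where "s = (\<rho> - measure ?U ({x. f x \<noteq> h x} \<inter> {c-r<..<c+r})) / 2"
    have s: "0 < s" using h by (simp add: s_def)
    have "c' \<notin> bad_centres H f r \<rho>" if c': "\<bar>c' - c\<bar> < s" for c'
    proof -
      let ?A = "{x. f x \<noteq> h x} \<inter> {c-r<..<c+r}"
      have "measure ?U ({x. f x \<noteq> h x} \<inter> {c'-r<..<c'+r})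
          \<le> measure ?U (?A \<union> ({c' - r..c - r} \<union> {c + r..c' + r}))"
        using dis[OF h(1)] ivl by (intro unif01c.finite_measure_mono sets.Un sets.Int) auto
      also have "\<dots> \<le> measure ?U ?A + measure ?U ({c' - r..c - r} \<union> {c + r..c' + r})"
        using dis[OF h(1)] ivl by (intro measure_Un_le sets.Un sets.Int)
      also have "measure ?U ({c' - r..c - r} \<union> {c + r..c' + r}) \<le> \<bar>c' - c\<bar>"
      proof (cases "c' < c")
        case True
        then have "{c' - r..c - r} \<union> {c + r..c' + r} = {c' - r..c - r}" by auto
        then show ?thesis using True measure_unif01_le[of "{c' - r..c - r}" "c' - r" "c - r"] by auto
      next
        case False
        then have "measure unif01 {c + r..c' + r} \<le> \<bar>c' - c\<bar>"
          using measure_unif01_le[of "{c + r..c' + r}" "c + r" "c' + r"] by auto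
        moreover have "measure unif01 {c' - r..c - r} \<le> (c - r) - (c - r)"
          using False by (intro measure_unif01_le) auto
        ultimately show ?thesis
          using measure_Un_le[of "{c' - r..c - r}" unif01 "{c + r..c' + r}"] by auto
      qed
      also have "measure ?U ?A + \<bar>c' - c\<bar> < \<rho>" using c' h(2) by (simp add: s_def)
      finally show ?thesis using h(1) by (auto simp: bad_centres_def not_le)
    qed
    then have "{c-s<..<c+s} \<inter> {r<..<1-r} \<subseteq> {r<..<1-r} - bad_centres H f r \<rho>" by auto
    then show ?thesis using c s by (intro exI[of _ "{c-s<..<c+s} \<inter> {r<..<1-r}"]) auto
  qed
  then show ?thesis using open_subopen by blast
qed

lemma sets_bad_centres:
  assumes dis: "\<And>h. h \<in> H \<Longrightarrow> {x. f x \<noteq> h x} \<in> sets (completion unif01)"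
  shows "bad_centres H f r \<rho> \<in> sets borel"
proof -
  have "bad_centres H f r \<rho> = {r<..<1-r} - ({r<..<1-r} - bad_centres H f r \<rho>)"
    by (auto simp: bad_centres_def)
  moreover have "{r<..<1-r} - bad_centres H f r \<rho> \<in> sets borel"
    using open_good_centres[OF dis] by auto
  ultimately show ?thesis by (metis borel_open open_greaterThanLessThan sets.Diff)
qed

text \<open>The windows overlap in an interval longer than 2\<rho>. If \<open>h\<close> and
  \<open>h'\<close> differed, almost every point of the overlap would be a disagreement of
  \<open>f\<close> with one of them, but these two disagreements have total measure less than
  2\<rho>.\<close>

lemma close_centres_same_function:
  assumes zc: "zero_measure_crossings H"
    and dis: "\<And>h. h \<in> H \<Longrightarrow> {x. f x \<noteq> h x} \<in> sets (completion unif01)"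
    and h: "h \<in> H" "measure (completion unif01) ({x. f x \<noteq> h x} \<inter> {c-r<..<c+r}) < \<rho>"
    and h': "h' \<in> H" "measure (completion unif01) ({x. f x \<noteq> h' x} \<inter> {c'-r<..<c'+r}) < \<rho>"
    and c: "c \<in> {r<..<1-r}" "c' \<in> {r<..<1-r}" "c \<le> c'" "c' - c < 2 * r - 2 * \<rho>"
    and \<rho>: "0 < \<rho>"
  shows "h = h'"
proof (rule ccontr)
  let ?U = "completion unif01"
  assume "h \<noteq> h'"
  then have null: "{x. h x = h' x} \<in> null_sets ?U"
    using zc h(1) h'(1) by (intro null_sets_unif01I) (auto simp: zero_measure_crossings_def)
  have ivl: "{a<..<b} \<in> sets ?U" for a b :: real by (auto intro!: sets_completionI_sets)
  let ?A = "{x. f x \<noteq> h x} \<inter> {c-r<..<c+r}" and ?B = "{x. f x \<noteq> h' x} \<inter> {c'-r<..<c'+r}"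
  have m: "?A \<in> sets ?U" "?B \<in> sets ?U" "{x. h x = h' x} \<in> sets ?U"
    by (intro sets.Int dis h(1) h'(1) ivl, intro sets.Int dis h(1) h'(1) ivl, rule null_setsD2[OF null])
  have "2 * \<rho> < (c + r) - (c' - r)" using c by simp
  also have "\<dots> = measure unif01 {c'-r<..<c+r}"
    using c \<rho> by (intro measure_unif01_eq[symmetric]) auto
  also have "\<dots> = measure ?U {c'-r<..<c+r}" by simp
  also have "\<dots> \<le> measure ?U ((?A \<union> ?B) \<union> {x. h x = h' x})"
  proof (rule unif01c.finite_measure_mono)
    show "{c'-r<..<c+r} \<subseteq> (?A \<union> ?B) \<union> {x. h x = h' x}" using c(3) by auto
  qed (intro sets.Un m)
  also have "\<dots> \<le> measure ?U (?A \<union> ?B) + measure ?U {x. h x = h' x}"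
    by (intro measure_Un_le sets.Un m)
  also have "measure ?U {x. h x = h' x} = 0" using null by (simp add: measure_eq_0_null_sets)
  also have "measure ?U (?A \<union> ?B) \<le> measure ?U ?A + measure ?U ?B"
    by (intro measure_Un_le m)
  finally show False using h(2) h'(2) by simp
qed

text \<open>The scan yields \<open>g x = u x x\<close> at good centres, where the function
  \<open>u x\<close> varies with the point. To bound the disagreement with \<open>f\<close>, the
  unit interval is cut into \<open>K\<close> cells of length \<open>r\<close>: good centres in one
  cell are closer than r <= 2r - 2\<rho>, hence share the function chosen at \<open>z i\<close>, and
  each cell contributes at most \<rho>.\<close>

lemma piecewise_near:
  assumes H: "H \<noteq> {}" and zc: "zero_measure_crossings H"
    and dis: "\<And>h. h \<in> H \<Longrightarrow> {x. f x \<noteq> h x} \<in> sets (completion unif01)"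
    and K: "0 < K" and r: "r = 1 / real K" and \<rho>: "0 < \<rho>" "2 * \<rho> \<le> r"
    and n: "0 < n" "measure unif01 (bad_centres H f r \<rho>) < real n * (2 * r - 2 * \<rho>)"
  shows "\<exists>g\<in>piecewise n H. \<exists>D\<in>sets (completion unif01). {x. f x \<noteq> g x} \<subseteq> D \<and>
    measure (completion unif01) D \<le> 2 * r + measure unif01 (bad_centres H f r \<rho>) + real K * \<rho>"
proof -
  let ?U = "completion unif01" and ?bad = "bad_centres H f r \<rho>"
  define G where "G = {r<..<1-r} - ?bad"
  have r0: "0 < r" "real K * r = 1" using K r by auto
  have Gopen: "open G" unfolding G_def using dis by (rule open_good_centres)
  have bad[measurable]: "?bad \<in> sets borel" using dis by (rule sets_bad_centres)
  define u where "u c = (SOME h. h \<in> H \<and> measure ?U ({x. f x \<noteq> h x} \<inter> {c-r<..<c+r}) < \<rho>)" for c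
  have u: "u c \<in> H" "measure ?U ({x. f x \<noteq> u c x} \<inter> {c-r<..<c+r}) < \<rho>" if "c \<in> G" for c
  proof -
    have "\<exists>h. h \<in> H \<and> measure ?U ({x. f x \<noteq> h x} \<inter> {c-r<..<c+r}) < \<rho>"
      using that by (auto simp: G_def bad_centres_def not_le)
    from someI_ex[OF this] show "u c \<in> H" "measure ?U ({x. f x \<noteq> u c x} \<inter> {c-r<..<c+r}) < \<rho>"
      by (auto simp: u_def)
  qed
  have Gsub: "c \<in> {r<..<1-r}" if "c \<in> G" for c using that by (simp add: G_def)
  have const: "u x = u y" if xy: "x \<in> G" "y \<in> G" "\<bar>x - y\<bar> < 2 * r - 2 * \<rho>" for x y
  proof (cases "x \<le> y")
    case True
    then show ?thesis
      using close_centres_same_function[OF zc dis u[OF xy(1)] u[OF xy(2)] Gsub[OF xy(1)] Gsub[OF xy(2)] _ _ \<rho>(1)] xy(3)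
      by auto
  next
    case False
    then show ?thesis
      using close_centres_same_function[OF zc dis u[OF xy(2)] u[OF xy(1)] Gsub[OF xy(2)] Gsub[OF xy(1)] _ _ \<rho>(1)] xy(3)
      by auto
  qed
  have badG: "{r<..<1-r} - G = ?bad" by (auto simp: G_def bad_centres_def)
  have "{0<..<1} \<inter> ?bad = ?bad" using r0 by (auto simp: bad_centres_def)
  then have "measure lborel ({r<..<1-r} - G) = measure unif01 ?bad"
    unfolding badG by (simp add: measure_def emeasure_unif01)
  then have "measure lborel ({r<..<1-r} - G) < real n * (2 * r - 2 * \<rho>)" using n(2) by simp
  moreover have "0 < 2 * r - 2 * \<rho>" using \<rho> r0 by simp
  ultimately have "\<exists>g\<in>piecewise n H. \<forall>x\<in>G \<inter> {r<..<1-r}. g x = u x x"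
    by (intro locally_constant_piecewise[OF Gopen _ H u(1) const n(1)])
  moreover have "G \<inter> {r<..<1-r} = G" using Gsub by blast
  ultimately obtain g where g: "g \<in> piecewise n H" "\<And>x. x \<in> G \<Longrightarrow> g x = u x x" by auto
  define Z where "Z i = {real i * r..<(real i + 1) * r}" for i :: nat
  define z where "z i = (SOME z. z \<in> G \<inter> Z i)" for i
  define E where "E i = (if G \<inter> Z i = {} then {} else {x. f x \<noteq> u (z i) x} \<inter> {z i-r<..<z i+r})" for i
  have z: "z i \<in> G \<inter> Z i" if "G \<inter> Z i \<noteq> {}" for i
    unfolding z_def using that by (meson someI_ex ex_in_conv)
  have ivl: "S \<in> sets borel \<Longrightarrow> S \<in> sets ?U" for S by (auto intro!: sets_completionI_sets)
  have Em: "E i \<in> sets ?U" for i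
  proof (cases "G \<inter> Z i = {}")
    case False
    have "{x. f x \<noteq> u (z i) x} \<inter> {z i-r<..<z i+r} \<in> sets ?U"
      by (intro sets.Int dis u(1) ivl) (use z[OF False] in auto)
    then show ?thesis using False by (simp add: E_def)
  qed (simp add: E_def)
  have El: "measure ?U (E i) \<le> \<rho>" for i
  proof (cases "G \<inter> Z i = {}")
    case False
    then show ?thesis using z[OF False] u(2)[of "z i"] by (simp add: E_def)
  qed (use \<rho> in \<open>simp add: E_def\<close>)
  \<comment> \<open>Two margins of width \<open>r\<close> that are treated as lost, and the null
    complement of the unit interval.\<close>
  define D0 where "D0 = - {0<..<1} \<union> {0..r} \<union> {1-r..1}"
  have D0: "D0 \<in> sets borel" by (simp add: D0_def)
  have "measure unif01 D0 \<le> measure unif01 (- {0<..<1}) + measure unif01 {0..r} + measure unif01 {1-r..1}"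
    unfolding D0_def
    by (intro order_trans[OF measure_Un_le] add_mono order_refl) auto
  also have "measure unif01 (- {0<..<1}) \<le> 0" using measure_unif01_le[of "- {0<..<1}" 0 0] by auto
  also have "measure unif01 {0..r} \<le> r" using measure_unif01_le[of "{0..r}" 0 r] r0 by auto
  also have "measure unif01 {1-r..1} \<le> r" using measure_unif01_le[of "{1-r..1}" "1-r" 1] r0 by auto
  finally have D0l: "measure unif01 D0 \<le> 2 * r" by simp
  define D where "D = (D0 \<union> ?bad) \<union> (\<Union>i<K. E i)"
  have "{x. f x \<noteq> g x} \<subseteq> D"
  proof
    fix x assume x: "x \<in> {x. f x \<noteq> g x}"
    show "x \<in> D"
    proof (cases "x \<in> G")
      case False
      then show ?thesis by (auto simp: G_def D_def D0_def)
    next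
      case True
      define i where "i = nat \<lfloor>x * K\<rfloor>"
      have x01: "0 < x" "x < 1" using Gsub[OF True] r0 by auto
      then have i: "real i \<le> x * K" "x * K < real i + 1" by (auto simp: i_def)
      have xZ: "x \<in> Z i" using i K by (auto simp: Z_def r field_simps)
      have "x * real K < 1 * real K" using x01 K by (intro mult_strict_right_mono) auto
      then have iK: "i < K" using i by simp
      have zi: "z i \<in> G" "z i \<in> Z i" using z[of i] True xZ by auto
      have lt: "\<bar>x - z i\<bar> < r" using xZ zi(2) by (auto simp: Z_def algebra_simps)
      then have "u x = u (z i)" using \<rho> by (intro const True zi(1)) auto
      then have "f x \<noteq> u (z i) x" using x g(2)[OF True] by simp
      then have "x \<in> E i" using lt True xZ by (auto simp: E_def)
      then show ?thesis using iK by (auto simp: D_def)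
    qed
  qed
  moreover have "D \<in> sets ?U" unfolding D_def by (intro sets.Un ivl D0 bad sets.finite_UN Em) simp
  moreover have "measure ?U D \<le> 2 * r + measure unif01 ?bad + real K * \<rho>"
  proof -
    have "measure ?U D \<le> measure ?U (D0 \<union> ?bad) + measure ?U (\<Union>i<K. E i)"
      unfolding D_def by (intro measure_Un_le sets.Un ivl D0 bad sets.finite_UN Em) simp
    also have "measure ?U (\<Union>i<K. E i) \<le> (\<Sum>i<K. measure ?U (E i))"
      using Em by (intro measure_UNION_le) auto
    also have "\<dots> \<le> (\<Sum>i<K. \<rho>)" by (intro sum_mono El)
    also have "measure ?U (D0 \<union> ?bad) = measure unif01 (D0 \<union> ?bad)" using D0 bad by simp
    also have "\<dots> \<le> measure unif01 D0 + measure unif01 ?bad" using D0 bad by (intro measure_Un_le) auto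
    also have "\<dots> \<le> 2 * r + measure unif01 ?bad" using D0l by simp
    finally show ?thesis by simp
  qed
  ultimately show ?thesis using g(1) by blast
qed

text \<open>A non-measurable disagreement set has measure 0, which would make the distance 0.\<close>

lemma sets_disagreement_of_far:
  assumes "0 < k" "0 < \<epsilon>" "\<And>g. g \<in> piecewise k H \<Longrightarrow> \<epsilon> \<le> fdist unif01 f g" "h \<in> H"
  shows "{x. f x \<noteq> h x} \<in> sets (completion unif01)"
proof (rule ccontr)
  assume "\<not> ?thesis"
  then have "fdist unif01 f h = 0" by (simp add: fdist_def measure_notin_sets)
  moreover have "\<epsilon> \<le> fdist unif01 f h" using assms subset_piecewise[of k H] by blast
  ultimately show False using assms(2) by simp
qed

text \<open>The budget for a contradiction, with q = 1/e: merging down to \<open>k\<close> pieces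
  costs q/2, the margins q/16, the bad centres q/8 and the cells q/8, in total 13q/16. With fewer
  bad centres than claimed, \<open>f\<close> would therefore be closer than q to the class.\<close>

lemma measure_bad_centres_of_far:
  fixes k e :: nat
  assumes H: "H \<noteq> {}" and zc: "zero_measure_crossings H"
    and k: "0 < k" and e: "0 < e"
    and far: "\<And>g. g \<in> piecewise k H \<Longrightarrow> 1 / real e \<le> fdist unif01 f g"
    and r: "r = 1 / (32 * real k * real e)" and \<rho>: "\<rho> = r / (8 * real e)"
  shows "2 * r * (real k - 1) + 1 / (64 * real e ^ 2) \<le> measure unif01 (bad_centres H f r \<rho>)"
proof (rule ccontr)
  let ?\<mu> = "measure unif01 (bad_centres H f r \<rho>)"
  define w where "w = 2 * r - 2 * \<rho>"
  \<comment> \<open>In units of the gap length \<open>w\<close>, the bad centres may fill k - 1 gaps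
    on account of the k - 1 breakpoints of the class, and k/(2e) further ones whose pieces can be
    merged away.\<close>
  define v where "v = real k - 1 + real k / (2 * real e)"
  assume neg: "\<not> ?thesis"
  have r0: "0 < r" and \<rho>0: "0 < \<rho>" using k e by (auto simp: r \<rho>)
  have e1: "1 \<le> real e" "1 \<le> real k" using e k by auto
  have ie: "1 / real e \<le> 1" "0 < 1 / real e" using e1 by auto
  have \<rho>r: "2 * \<rho> \<le> r" using e1 r0 by (simp add: \<rho> field_simps)
  have w: "0 < w" "w \<le> 2 * r" using \<rho>0 \<rho>r r0 by (auto simp: w_def)
  define q where "q = 1 / real e"
  have q: "0 < q" "q \<le> 1" using ie by (auto simp: q_def)
  have rk: "32 * real k * r = q" using k e by (simp add: r q_def)
  have "v * w = 2 * r * ((real k - 1 + real k * q / 2) * (1 - q / 8))"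
  proof -
    have "v = real k - 1 + real k * q / 2" "w = 2 * r * (1 - q / 8)"
      by (simp_all add: v_def w_def \<rho> q_def algebra_simps)
    then show ?thesis by simp
  qed
  \<comment> \<open>Shortening the gaps by 2\<rho> costs a factor 1 - q/8, which consumes at most
    half of the surplus \<open>real k * q / 2\<close>.\<close>
  also have "\<dots> \<ge> 2 * r * (real k - 1 + real k * q / 4)"
  proof (rule mult_left_mono)
    define y where "y = real k * q"
    have y: "0 \<le> y" "q * y \<le> y" using q by (auto simp: y_def mult_left_le_one_le)
    have "(real k - 1 + y / 2) * (1 - q / 8) = real k - 1 + y / 2 - y / 8 + q / 8 - q * y / 16"
      by (simp add: y_def algebra_simps)
    then show "real k - 1 + real k * q / 4 \<le> (real k - 1 + real k * q / 2) * (1 - q / 8)"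
      using q y unfolding y_def[symmetric] by linarith
  qed (use r0 in simp)
  also have "2 * r * (real k - 1 + real k * q / 4) = 2 * r * (real k - 1) + (32 * real k * r) * q / 64"
    by (simp add: algebra_simps)
  also have "(32 * real k * r) * q / 64 = 1 / (64 * real e ^ 2)"
    unfolding rk by (simp add: q_def power2_eq_square)
  finally have lt: "?\<mu> < v * w" using neg by simp
  \<comment> \<open>The least number of pieces that \<open>piecewise_near\<close> allows, raised to
    \<open>k\<close> because \<open>piecewise_approx\<close> only goes down.\<close>
  define n where "n = max k (nat \<lfloor>?\<mu> / w\<rfloor> + 1)"
  have fl: "?\<mu> / w < real (nat \<lfloor>?\<mu> / w\<rfloor> + 1)" "real (nat \<lfloor>?\<mu> / w\<rfloor>) \<le> ?\<mu> / w"
    using w by (auto simp: of_nat_nat) linarith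
  have "?\<mu> / w < real n" using fl(1) by (simp add: n_def)
  then have nw: "?\<mu> < real n * (2 * r - 2 * \<rho>)" using w(1) unfolding w_def[symmetric] by (simp add: pos_divide_less_eq)
  have "?\<mu> / w < v" using lt w by (simp add: field_simps)
  then have nk: "real n - real k \<le> real k / (2 * real e)"
    using fl(2) e1 by (auto simp: n_def v_def max_def)
  have n: "0 < n" "k \<le> n" using k by (auto simp: n_def)
  have dis: "{x. f x \<noteq> h x} \<in> sets (completion unif01)" if "h \<in> H" for h
    using sets_disagreement_of_far[OF k _ far that] e by simp
  have K: "0 < 32 * k * e" "r = 1 / real (32 * k * e)" using k e by (auto simp: r)
  obtain g D where g: "g \<in> piecewise n H" "D \<in> sets (completion unif01)" "{x. f x \<noteq> g x} \<subseteq> D"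
      "measure (completion unif01) D \<le> 2 * r + ?\<mu> + real (32 * k * e) * \<rho>"
    using piecewise_near[OF H zc dis K \<rho>0 \<rho>r n(1) nw] by blast
  obtain g' D' where g': "g' \<in> piecewise k H" "D' \<in> sets borel" "{x. g x \<noteq> g' x} \<subseteq> D'"
      "measure unif01 D' \<le> (real n - real k) / real k"
    using piecewise_approx[OF k n(2) g(1)] by blast
  have D': "D' \<in> sets (completion unif01)" using g'(2) by (auto intro!: sets_completionI_sets)
  have "1 / real e \<le> fdist unif01 f g'" using far g'(1) by blast
  also have "\<dots> \<le> measure (completion unif01) (D \<union> D')"
    using g(2,3) D' g'(3) by (intro fdist_le) (auto, metis (mono_tags, lifting) mem_Collect_eq subsetD)
  also have "\<dots> \<le> measure (completion unif01) D + measure (completion unif01) D'"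
    using g(2) D' by (intro measure_Un_le) auto
  also have "measure (completion unif01) D' \<le> (real k / (2 * real e)) / real k"
  proof -
    have "measure (completion unif01) D' = measure unif01 D'" using g'(2) by simp
    also have "\<dots> \<le> (real n - real k) / real k" by (rule g'(4))
    also have "\<dots> \<le> (real k / (2 * real e)) / real k" using nk by (intro divide_right_mono) auto
    finally show ?thesis .
  qed
  also have "(real k / (2 * real e)) / real k = q / 2" using k by (simp add: q_def)
  also have "measure (completion unif01) D \<le> q / 16 + q / 8 + q / 8"
  proof -
    have "1 * r \<le> real k * r" using e1(2) r0 by (intro mult_right_mono) auto
    then have "2 * r \<le> q / 16" unfolding rk[symmetric] by (simp add: mult.commute)
    moreover have "?\<mu> \<le> q / 8"
    proof -
      have "v * w \<le> (2 * real k) * (2 * r)"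
      proof (intro mult_mono)
        have "real k / (2 * real e) \<le> real k / 1" using e1 by (intro divide_left_mono) auto
        then show "v \<le> 2 * real k" by (simp add: v_def)
      qed (use w k in auto)
      then show ?thesis using lt rk by simp
    qed
    moreover have "real (32 * k * e) * \<rho> = q / 8"
      using k e by (simp add: \<rho> r q_def)
    ultimately show ?thesis using g(4) by simp
  qed
  finally show False using q by (simp add: q_def[symmetric])
qed

section \<open>The double sample argument\<close>

interpretation unif01P: product_sigma_finite "\<lambda>_::nat. unif01"
  by unfold_locales

interpretation lborelP: product_sigma_finite "\<lambda>_::nat. lborel :: real measure"
  by unfold_locales

lemma prob_space_PiM_unif01: "prob_space (Pi\<^sub>M I (\<lambda>_::nat. unif01))"
  by (rule prob_space_PiM) unfold_locales

lemma sets_PiM_unif01: "sets (Pi\<^sub>M I (\<lambda>_::nat. unif01)) = sets (Pi\<^sub>M I (\<lambda>_. lborel))"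
  by (rule sets_PiM_cong) auto

text \<open>\<open>trace_measurable\<close> speaks of products of Lebesgue measure, while samples
  are drawn from \<open>unif01\<close>. The density transports almost-everywhere statements from the
  former to the latter.\<close>

lemma PiM_unif01_eq_density:
  assumes "finite I"
  shows "Pi\<^sub>M I (\<lambda>_::nat. unif01) = density (Pi\<^sub>M I (\<lambda>_. lborel)) (indicator (I \<rightarrow>\<^sub>E {0<..<1}))"
proof (rule unif01P.PiM_eqI[symmetric])
  have I01: "(I \<rightarrow>\<^sub>E {0<..<1}) \<in> sets (Pi\<^sub>M I (\<lambda>_. lborel :: real measure))"
    using assms by (intro sets_PiM_I_finite) auto
  fix A :: "nat \<Rightarrow> real set" assume "\<And>i. i \<in> I \<Longrightarrow> A i \<in> sets unif01"
  then have A: "\<And>i. i \<in> I \<Longrightarrow> A i \<in> sets borel" by simp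
  have PA: "Pi\<^sub>E I A \<in> sets (Pi\<^sub>M I (\<lambda>_. lborel :: real measure))"
    using assms A by (intro sets_PiM_I_finite) auto
  have "emeasure (density (Pi\<^sub>M I (\<lambda>_. lborel)) (indicator (I \<rightarrow>\<^sub>E {0<..<1}))) (Pi\<^sub>E I A)
      = (\<integral>\<^sup>+x. indicator (I \<rightarrow>\<^sub>E {0<..<1}) x * indicator (Pi\<^sub>E I A) x \<partial>Pi\<^sub>M I (\<lambda>_. lborel))"
    using I01 PA by (intro emeasure_density) auto
  also have "\<dots> = (\<integral>\<^sup>+x. indicator (Pi\<^sub>E I (\<lambda>i. {0<..<1} \<inter> A i)) x \<partial>Pi\<^sub>M I (\<lambda>_. lborel))"
    by (rule nn_integral_cong) (auto simp: indicator_def PiE_iff)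
  also have "\<dots> = emeasure (Pi\<^sub>M I (\<lambda>_. lborel)) (Pi\<^sub>E I (\<lambda>i. {0<..<1} \<inter> A i))"
    using assms A by (intro nn_integral_indicator sets_PiM_I_finite) auto
  also have "\<dots> = (\<Prod>i\<in>I. emeasure lborel ({0<..<1} \<inter> A i))"
    using assms A by (intro lborelP.emeasure_PiM) auto
  also have "\<dots> = (\<Prod>i\<in>I. emeasure unif01 (A i))"
    using A by (intro prod.cong refl) (simp add: emeasure_unif01)
  finally show "emeasure (density (Pi\<^sub>M I (\<lambda>_. lborel)) (indicator (I \<rightarrow>\<^sub>E {0<..<1}))) (Pi\<^sub>E I A)
      = (\<Prod>i\<in>I. emeasure unif01 (A i))" .
qed (use assms in \<open>auto simp: sets_PiM_unif01\<close>)

lemma AE_PiM_unif01I: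
  assumes "finite I" "AE x in Pi\<^sub>M I (\<lambda>_::nat. lborel). Q x"
  shows "AE x in Pi\<^sub>M I (\<lambda>_. unif01). Q x"
proof -
  have "(I \<rightarrow>\<^sub>E {0<..<1}) \<in> sets (Pi\<^sub>M I (\<lambda>_. lborel :: real measure))"
    using assms by (intro sets_PiM_I_finite) auto
  then show ?thesis
    unfolding PiM_unif01_eq_density[OF assms(1)] using assms(2)
    by (subst AE_density) auto
qed

section \<open>Agreement patterns and the graph dimension\<close>

definition trace_sets :: "(real \<Rightarrow> 'y) set \<Rightarrow> (real \<Rightarrow> 'y) \<Rightarrow> nat \<Rightarrow> (nat \<Rightarrow> real) \<Rightarrow> nat set set" where
  "trace_sets H f n x = (\<lambda>h. {i. i < n \<and> h (x i) = f (x i)}) ` H"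

lemma trace_sets_iff: "Z \<in> trace_sets H f n x \<longleftrightarrow> (\<exists>h\<in>H. Z = {i. i < n \<and> h (x i) = f (x i)})"
  by (auto simp: trace_sets_def)

text \<open>
  Trace events are measurable only in the completion; \<open>T Z\<close> is a Borel version of the event that
  \<open>Z\<close> is a trace.
\<close>

lemma ex_measurable_trace:
  assumes tm: "trace_measurable Y H" and f: "f \<in> borel \<rightarrow>\<^sub>M Y"
  obtains T where "\<And>Z. T Z \<in> sets (Pi\<^sub>M {..<n} (\<lambda>_. unif01))"
    "AE x in Pi\<^sub>M {..<n} (\<lambda>_. unif01). \<forall>Z\<in>Pow {..<n}. x \<in> T Z \<longleftrightarrow> Z \<in> trace_sets H f n x"
proof -
  let ?L = "Pi\<^sub>M {..<n} (\<lambda>_. lborel :: real measure)"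
  define S where "S Z = {x \<in> space ?L. \<exists>h\<in>H. {i \<in> {..<n}. h (x i) = f (x i)} = Z}" for Z
  define T where "T Z = (if Z \<subseteq> {..<n} then main_part ?L (S Z) else {})" for Z
  have S: "S Z \<in> sets (completion ?L)" if "Z \<subseteq> {..<n}" for Z
    using tm f that unfolding trace_measurable_def S_def by blast
  have "AE x in ?L. \<forall>Z\<in>Pow {..<n}. x \<in> T Z \<longleftrightarrow> Z \<in> trace_sets H f n x"
  proof (rule AE_finite_allI)
    fix Z assume "Z \<in> Pow {..<n}"
    then have Z: "Z \<subseteq> {..<n}" by simp
    show "AE x in ?L. x \<in> T Z \<longleftrightarrow> Z \<in> trace_sets H f n x"
      using AE_in_main_part[OF S[OF Z]] AE_space
    proof eventually_elim
      case (elim x)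
      have "x \<in> S Z \<longleftrightarrow> Z \<in> trace_sets H f n x"
        using elim(2) by (auto simp: S_def trace_sets_iff)
      then show ?case using elim(1) Z by (simp add: T_def)
    qed
  qed simp
  then have "AE x in Pi\<^sub>M {..<n} (\<lambda>_. unif01). \<forall>Z\<in>Pow {..<n}. x \<in> T Z \<longleftrightarrow> Z \<in> trace_sets H f n x"
    by (intro AE_PiM_unif01I) auto
  moreover have "T Z \<in> sets (Pi\<^sub>M {..<n} (\<lambda>_. unif01))" for Z
    unfolding sets_PiM_unif01 using S by (auto simp: T_def)
  ultimately show ?thesis using that by blast
qed

text \<open>If the disagreement patterns shatter \<open>S\<close>, the graphs shatter the labelled
  points \<open>(y i, f (y i))\<close>, since taking complements of the patterns preserves
  shattering.\<close>

lemma card_le_of_shatters_traces: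
  assumes gd: "graph_dim H = enat d" and W: "W \<subseteq> {..<n}" and S: "S \<subseteq> W"
    and sh: "shatters ((\<lambda>Z. W - Z) ` trace_sets H f n y) S"
  shows "card S \<le> d"
proof -
  let ?g = "\<lambda>i. (y i, f (y i))"
  have fin: "finite S" by (rule finite_subset[OF subset_trans[OF S W]]) simp
  have ex: "\<exists>h\<in>H. \<forall>i\<in>S. h (y i) \<noteq> f (y i) \<longleftrightarrow> i \<in> B" if B: "B \<subseteq> S" for B
  proof -
    obtain D where D: "D \<in> (\<lambda>Z. W - Z) ` trace_sets H f n y" "D \<inter> S = B"
      using sh[unfolded shatters_def, rule_format, OF B] by (rule bexE)
    then obtain h where h: "h \<in> H" "D = W - {i. i < n \<and> h (y i) = f (y i)}"
      by (auto simp: trace_sets_def)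
    have "h (y i) \<noteq> f (y i) \<longleftrightarrow> i \<in> B" if "i \<in> S" for i
      using that D(2) h(2) W S by blast
    then show ?thesis using h(1) by blast
  qed
  \<comment> \<open>Equal labelled points could not be separated by the pattern \<open>{i}\<close>;
    hence repeated sample points do no harm.\<close>
  have inj: "inj_on ?g S"
  proof (rule inj_onI, rule ccontr)
    fix i j assume ij: "i \<in> S" "j \<in> S" "?g i = ?g j" "i \<noteq> j"
    obtain h where "\<forall>l\<in>S. h (y l) \<noteq> f (y l) \<longleftrightarrow> l \<in> {i}" using ex[of "{i}"] ij by auto
    then show False using ij by (metis Pair_inject singleton_iff)
  qed
  let ?\<C> = "{{(x, h x) | x. True} | h. h \<in> H}"
  have "shatters ?\<C> (?g ` S)"
    unfolding shatters_def
  proof (intro allI impI)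
    fix B assume B: "B \<subseteq> ?g ` S"
    obtain h where h: "h \<in> H" "\<forall>i\<in>S. h (y i) \<noteq> f (y i) \<longleftrightarrow> i \<in> {i\<in>S. ?g i \<notin> B}"
      using ex[of "{i\<in>S. ?g i \<notin> B}"] by auto
    have "{(x, h x) | x. True} \<inter> ?g ` S = B"
    proof (intro set_eqI iffI)
      fix z assume "z \<in> {(x, h x) | x. True} \<inter> ?g ` S"
      then obtain i where i: "i \<in> S" "z = ?g i" "h (y i) = f (y i)" by auto
      then show "z \<in> B" using h(2) by blast
    next
      fix z assume z: "z \<in> B"
      then obtain i where i: "i \<in> S" "z = ?g i" using B by blast
      then have "h (y i) = f (y i)" using h(2) z by blast
      then show "z \<in> {(x, h x) | x. True} \<inter> ?g ` S" using i by auto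
    qed
    then show "\<exists>S'\<in>?\<C>. S' \<inter> ?g ` S = B" using h(1) by blast
  qed
  then have "enat (card (?g ` S)) \<le> vc_dim ?\<C>"
    unfolding vc_dim_def using fin by (intro SUP_upper) auto
  then show ?thesis using gd card_image[OF inj] by (simp add: graph_dim_def)
qed

text \<open>The bound stays a count of small subsets of \<open>W\<close>, not a binomial sum in
  \<open>card W\<close>: \<open>W\<close> will be random, and this count has an explicit
  expectation.\<close>

lemma card_trace_diffs_le:
  assumes gd: "graph_dim H = enat d" and W: "W \<subseteq> {..<n}"
  shows "card ((\<lambda>Z. W - Z) ` trace_sets H f n y) \<le> card {S. S \<subseteq> W \<and> card S \<le> d}"
proof -
  have fin: "finite W" using W finite_subset by blast
  have "card ((\<lambda>Z. W - Z) ` trace_sets H f n y)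
      \<le> card {S. S \<subseteq> W \<and> shatters ((\<lambda>Z. W - Z) ` trace_sets H f n y) S}"
    using fin by (intro card_le_card_shattered) auto
  also have "\<dots> \<le> card {S. S \<subseteq> W \<and> card S \<le> d}"
    using fin card_le_of_shatters_traces[OF gd W] by (intro card_mono) auto
  finally show ?thesis .
qed

text \<open>\<open>W y\<close> varies with \<open>y\<close>, so the event is split over the finitely
  many possible values \<open>V\<close> of \<open>W y\<close>.\<close>

lemma measurable_trace_event:
  assumes W: "\<And>i. i < n \<Longrightarrow> Measurable.pred N (\<lambda>y. i \<in> W y)" "\<And>y. W y \<subseteq> {..<n::nat}"
    and T: "\<And>Z. Measurable.pred N (T Z)"
  shows "Measurable.pred N (\<lambda>y. \<exists>Z\<in>Pow {..<n}. T Z y \<and> \<Phi> Z (W y))"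
proof -
  have "(\<exists>Z\<in>Pow {..<n}. T Z y \<and> \<Phi> Z (W y)) \<longleftrightarrow>
      (\<exists>Z\<in>Pow {..<n}. \<exists>V\<in>Pow {..<n}. T Z y \<and> \<Phi> Z V \<and> (\<forall>i\<in>{..<n}. (i \<in> W y) = (i \<in> V)))" for y
  proof -
    have "(\<forall>i\<in>{..<n}. (i \<in> W y) = (i \<in> V)) \<longleftrightarrow> W y = V" if "V \<in> Pow {..<n}" for V
      using W(2)[of y] that by auto
    then show ?thesis using W(2)[of y] by (metis (no_types, lifting) PowI)
  qed
  moreover have "Measurable.pred N (\<lambda>y. \<exists>Z\<in>Pow {..<n}. \<exists>V\<in>Pow {..<n}. T Z y \<and> \<Phi> Z V \<and>
      (\<forall>i\<in>{..<n}. (i \<in> W y) = (i \<in> V)))"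
    using W(1) T by (intro pred_intros_finite pred_intros_logic finite_Pow_iff[THEN iffD2]) auto
  ultimately show ?thesis by simp
qed

text \<open>A fixed index set \<open>S\<close> lands in \<open>J\<close> with probability p^|S|.
  Since (n choose i) p^i <= (np)^i / i!, the result is controlled by the expected number np of
  points in \<open>J\<close>.\<close>

lemma nn_integral_card_subsets:
  assumes J: "J \<in> sets borel" and p: "p = measure unif01 J"
  shows "(\<integral>\<^sup>+y. of_nat (card {S. S \<subseteq> {i. i < n \<and> y i \<in> J} \<and> card S \<le> d}) \<partial>Pi\<^sub>M {..<n} (\<lambda>_. unif01))
    = ennreal (\<Sum>i\<le>d. real (n choose i) * p ^ i)"
proof -
  let ?Q = "Pi\<^sub>M {..<n} (\<lambda>_. unif01)"
  let ?F = "{S. S \<subseteq> {..<n} \<and> card S \<le> d}"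
  define B where "B S = Pi\<^sub>E {..<n} (\<lambda>i. if i \<in> S then J else UNIV)" for S :: "nat set"
  have B: "B S \<in> sets ?Q" for S
    unfolding B_def using J by (intro sets_PiM_I_finite) auto
  have em: "emeasure ?Q (B S) = ennreal (p ^ card S)" if "S \<subseteq> {..<n}" for S
  proof -
    have "emeasure ?Q (B S) = (\<Prod>i<n. emeasure unif01 (if i \<in> S then J else UNIV))"
      unfolding B_def using J by (intro unif01P.emeasure_PiM) auto
    also have "\<dots> = (\<Prod>i<n. if i \<in> S then ennreal p else 1)"
      using p by (intro prod.cong refl) (auto simp: unif01.emeasure_eq_measure unif01.prob_space[simplified])
    also have "\<dots> = ennreal p ^ card S"
      using that by (simp add: prod.If_cases Int_absorb1)
    finally show ?thesis by (simp add: ennreal_power p)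
  qed
  have "(\<integral>\<^sup>+y. of_nat (card {S. S \<subseteq> {i. i < n \<and> y i \<in> J} \<and> card S \<le> d}) \<partial>?Q)
      = (\<integral>\<^sup>+y. (\<Sum>S\<in>?F. indicator (B S) y) \<partial>?Q)"
  proof (rule nn_integral_cong)
    fix y assume "y \<in> space ?Q"
    then have y: "y \<in> extensional {..<n}" by (simp add: space_PiM PiE_def)
    have "(\<Sum>S\<in>?F. indicator (B S) y) = (\<Sum>S\<in>?F. if y \<in> B S then 1 else 0 :: ennreal)"
      by (intro sum.cong refl) (auto simp: indicator_def)
    also have "\<dots> = (\<Sum>S\<in>{S\<in>?F. y \<in> B S}. 1)" by (rule sum.inter_filter[symmetric]) simp
    also have "\<dots> = of_nat (card {S\<in>?F. y \<in> B S})" by simp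
    also have "{S\<in>?F. y \<in> B S} = {S. S \<subseteq> {i. i < n \<and> y i \<in> J} \<and> card S \<le> d}"
    proof -
      have "y \<in> B S \<longleftrightarrow> (\<forall>i\<in>S. y i \<in> J)" if "S \<subseteq> {..<n}" for S
      proof -
        have "(y i \<in> (if i \<in> S then J else UNIV)) \<longleftrightarrow> (i \<in> S \<longrightarrow> y i \<in> J)" for i by simp
        then show ?thesis using y that unfolding B_def PiE_iff by blast
      qed
      then show ?thesis by blast
    qed
    finally show "of_nat (card {S. S \<subseteq> {i. i < n \<and> y i \<in> J} \<and> card S \<le> d}) = (\<Sum>S\<in>?F. indicator (B S) y :: ennreal)"
      by simp
  qed
  also have "\<dots> = (\<Sum>S\<in>?F. emeasure ?Q (B S))"
    using B by (subst nn_integral_sum) auto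
  also have "\<dots> = (\<Sum>S\<in>?F. ennreal (p ^ card S))" by (intro sum.cong refl em) auto
  also have "\<dots> = ennreal (\<Sum>S\<in>?F. p ^ card S)" using p by (intro sum_ennreal) auto
  also have "(\<Sum>S\<in>?F. p ^ card S) = (\<Sum>i\<le>d. \<Sum>S\<in>{S\<in>?F. card S = i}. p ^ card S)"
    by (rule sum.group[symmetric]) auto
  also have "\<dots> = (\<Sum>i\<le>d. real (n choose i) * p ^ i)"
  proof (rule sum.cong[OF refl])
    fix i assume "i \<in> {..d}"
    then have "{S\<in>?F. card S = i} = {S. S \<subseteq> {..<n} \<and> card S = i}" by auto
    then show "(\<Sum>S\<in>{S\<in>?F. card S = i}. p ^ card S) = real (n choose i) * p ^ i"
      using n_subsets[of "{..<n}" i] by simp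
  qed
  finally show ?thesis .
qed

text \<open>Markov's inequality for 2 to the power minus the count: each factor has expectation 1 -
  p/2 <= exp(-p/2), where p is the measure of \<open>A\<close>.\<close>

lemma binomial_lower_tail:
  assumes I: "finite I" and A: "A \<in> sets borel" and \<rho>: "\<rho> \<le> measure unif01 A"
    and b: "2 ^ b * exp (- \<rho> * real (card I) / 2) \<le> 1 / 2"
  shows "1 / 2 \<le> measure (Pi\<^sub>M I (\<lambda>_::nat. unif01)) {x \<in> space (Pi\<^sub>M I (\<lambda>_. unif01)). b \<le> card {i\<in>I. x i \<in> A}}"
proof -
  let ?Q = "Pi\<^sub>M I (\<lambda>_::nat. unif01)"
  interpret Q: prob_space ?Q by (rule prob_space_PiM_unif01)
  define p where "p = measure unif01 A"
  have p1: "0 \<le> 1 - p / 2" using unif01.prob_le_1[of A] unfolding p_def by linarith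
  define \<phi> :: "real \<Rightarrow> real" where "\<phi> x = 1 - indicator A x / 2" for x
  have \<phi>: "\<phi> \<in> borel_measurable borel" "\<And>x. 0 \<le> \<phi> x" "\<And>x. \<phi> x \<le> 1"
    unfolding \<phi>_def using A by (auto simp: indicator_def)
  note \<phi>(1)[measurable]
  have card: "card {i\<in>I. x i \<in> A} = (\<Sum>i\<in>I. if x i \<in> A then 1 else 0)" for x
    using I by (simp add: sum.If_cases Int_def)
  have m: "Measurable.pred ?Q (\<lambda>x. b \<le> card {i\<in>I. x i \<in> A})"
    unfolding card using A by measurable
  let ?E = "{x \<in> space ?Q. b \<le> card {i\<in>I. x i \<in> A}}"
  have E: "?E \<in> sets ?Q" using m by simp
  have "(\<integral>\<^sup>+x. ennreal (\<phi> x) \<partial>unif01) = ennreal (\<integral>x. \<phi> x \<partial>unif01)"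
    using \<phi> by (intro nn_integral_eq_integral unif01.integrable_const_bound[where B = 1]) auto
  also have "(\<integral>x. \<phi> x \<partial>unif01) = 1 - p / 2"
    using A by (simp add: \<phi>_def p_def unif01.prob_space[simplified] unif01.emeasure_eq_measure)
  finally have int: "(\<integral>\<^sup>+x. ennreal (\<phi> x) \<partial>unif01) = ennreal (1 - p / 2)" .
  have "emeasure ?Q (space ?Q - ?E) = (\<integral>\<^sup>+x. indicator (space ?Q - ?E) x \<partial>?Q)"
    using E by simp
  also have "\<dots> \<le> (\<integral>\<^sup>+x. ennreal (2 ^ b) * (\<Prod>i\<in>I. ennreal (\<phi> (x i))) \<partial>?Q)"
  proof (rule nn_integral_mono)
    fix x assume x: "x \<in> space ?Q"
    show "indicator (space ?Q - ?E) x \<le> ennreal (2 ^ b) * (\<Prod>i\<in>I. ennreal (\<phi> (x i)))"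
    proof (cases "x \<in> ?E")
      case False
      then have lt: "card {i\<in>I. x i \<in> A} < b" using x by auto
      have "(\<Prod>i\<in>I. \<phi> (x i)) = (\<Prod>i\<in>I. if x i \<in> A then 1 / 2 else 1)"
        by (intro prod.cong refl) (auto simp: \<phi>_def)
      also have "\<dots> = (1 / 2) ^ card {i\<in>I. x i \<in> A}"
        using I by (simp add: prod.If_cases Int_def)
      also have "\<dots> \<ge> (1 / 2) ^ b" using lt by (intro power_decreasing) auto
      finally have "2 ^ b * (1 / 2) ^ b \<le> 2 ^ b * (\<Prod>i\<in>I. \<phi> (x i))" by (intro mult_left_mono) auto
      then have "1 \<le> 2 ^ b * (\<Prod>i\<in>I. \<phi> (x i))" by (simp add: power_mult_distrib[symmetric])
      then have "ennreal 1 \<le> ennreal (2 ^ b * (\<Prod>i\<in>I. \<phi> (x i)))" by (rule ennreal_leI)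
      also have "\<dots> = ennreal (2 ^ b) * (\<Prod>i\<in>I. ennreal (\<phi> (x i)))"
        using \<phi> by (simp add: ennreal_mult prod_nonneg prod_ennreal)
      finally show ?thesis using False x by simp
    qed simp
  qed
  also have "\<dots> = ennreal (2 ^ b) * (\<integral>\<^sup>+x. (\<Prod>i\<in>I. ennreal (\<phi> (x i))) \<partial>?Q)"
    by (intro nn_integral_cmult) measurable
  also have "(\<integral>\<^sup>+x. (\<Prod>i\<in>I. ennreal (\<phi> (x i))) \<partial>?Q) = (\<Prod>i\<in>I. \<integral>\<^sup>+x. ennreal (\<phi> x) \<partial>unif01)"
    using I \<phi>(1) by (intro unif01P.product_nn_integral_prod) auto
  also have "\<dots> = ennreal ((1 - p / 2) ^ card I)"
    unfolding int using p1 by (simp add: ennreal_power)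
  also have "ennreal (2 ^ b) * \<dots> = ennreal (2 ^ b * (1 - p / 2) ^ card I)"
    using p1 by (simp add: ennreal_mult)
  also have "2 ^ b * (1 - p / 2) ^ card I \<le> 1 / 2"
  proof -
    have "(1 - p / 2) ^ card I \<le> exp (- p / 2) ^ card I"
      using p1 exp_ge_add_one_self[of "- p / 2"] by (intro power_mono) auto
    also have "\<dots> = exp (- p * real (card I) / 2)" by (simp add: exp_of_nat_mult[symmetric] mult.commute)
    also have "\<dots> \<le> exp (- \<rho> * real (card I) / 2)" using \<rho> by (simp add: p_def mult_right_mono)
    finally have "2 ^ b * (1 - p / 2) ^ card I \<le> 2 ^ b * exp (- \<rho> * real (card I) / 2)"
      by (intro mult_left_mono) auto
    then show ?thesis using b by linarith
  qed
  finally have "emeasure ?Q (space ?Q - ?E) \<le> ennreal (1 / 2)" by (simp add: ennreal_leI)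
  then have "measure ?Q (space ?Q - ?E) \<le> 1 / 2"
    unfolding Q.emeasure_eq_measure by (subst (asm) ennreal_le_iff) auto
  then show ?thesis using Q.prob_compl[OF E] by simp
qed

section \<open>Exchanging sample and ghost sample\<close>

lemma sum_indicator_vimage_eq_card:
  assumes "finite F"
  shows "(\<Sum>s\<in>F. indicator E (r s) :: ennreal) = of_nat (card {s\<in>F. r s \<in> E})"
proof -
  have "(\<Sum>s\<in>F. indicator E (r s)) = (\<Sum>s\<in>F. if r s \<in> E then 1 else 0 :: ennreal)"
    by (intro sum.cong refl) (auto simp: indicator_def)
  also have "\<dots> = (\<Sum>s\<in>{s\<in>F. r s \<in> E}. 1)" by (rule sum.inter_filter[OF assms, symmetric])
  finally show ?thesis by simp
qed

text \<open>Indices from \<open>M\<close> on form the ghost sample. Since \<open>Z\<close> covers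
  the first half inside \<open>J\<close>, all \<open>b\<close> misses are ghost points. Traces enter
  through \<open>T\<close>, which keeps the event measurable in the uncompleted product.\<close>

definition ghost_event :: "nat \<Rightarrow> nat \<Rightarrow> real set \<Rightarrow> (nat set \<Rightarrow> (nat \<Rightarrow> real) set) \<Rightarrow> (nat \<Rightarrow> real) set" where
  "ghost_event M b J T = {y \<in> space (Pi\<^sub>M {..<2*M} (\<lambda>_. unif01)). \<exists>Z\<in>Pow {..<2*M}. y \<in> T Z \<and>
     {i. i < 2*M \<and> y i \<in> J} \<inter> {..<M} \<subseteq> Z \<and> b \<le> card ({i. i < 2*M \<and> y i \<in> J} - Z)}"

lemma sets_ghost_event:
  assumes J: "J \<in> sets borel" and T: "\<And>Z. T Z \<in> sets (Pi\<^sub>M {..<2*M} (\<lambda>_. unif01))"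
  shows "ghost_event M b J T \<in> sets (Pi\<^sub>M {..<2*M} (\<lambda>_. unif01))"
proof -
  have "Measurable.pred (Pi\<^sub>M {..<2*M} (\<lambda>_. unif01)) (\<lambda>y. \<exists>Z\<in>Pow {..<2*M}. y \<in> T Z \<and>
     ({i. i < 2*M \<and> y i \<in> J} \<inter> {..<M} \<subseteq> Z \<and> b \<le> card ({i. i < 2*M \<and> y i \<in> J} - Z)))"
  proof (rule measurable_trace_event[where \<Phi> = "\<lambda>Z W. W \<inter> {..<M} \<subseteq> Z \<and> b \<le> card (W - Z)"])
    fix i assume "i < 2 * M"
    then show "Measurable.pred (Pi\<^sub>M {..<2*M} (\<lambda>_. unif01)) (\<lambda>y. i \<in> {i. i < 2*M \<and> y i \<in> J})"
      using J by simp
  qed (use T in auto)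
  then show ?thesis by (simp add: ghost_event_def pred_def)
qed

text \<open>
  Exchanging the \<open>i\<close>-th point of the sample with the \<open>i\<close>-th point of the ghost sample preserves the
  law, and a fixed pattern of at least \<open>b\<close> disagreements leaves the first half free of
  disagreements for at most a fraction \<open>2^-b\<close> of all exchanges.
\<close>

lemma measure_ghost_event_le:
  assumes gd: "graph_dim H = enat d" and J: "J \<in> sets borel" and p: "p = measure unif01 J"
    and T: "\<And>Z. T Z \<in> sets (Pi\<^sub>M {..<2*M} (\<lambda>_. unif01))"
    and AE_T: "AE x in Pi\<^sub>M {..<2*M} (\<lambda>_. unif01). \<forall>Z\<in>Pow {..<2*M}. x \<in> T Z \<longleftrightarrow> Z \<in> trace_sets H f (2*M) x"
  shows "measure (Pi\<^sub>M {..<2*M} (\<lambda>_. unif01)) (ghost_event M b J T)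
    \<le> (\<Sum>i\<le>d. real (2*M choose i) * p ^ i) / 2 ^ b"
proof -
  let ?Q = "Pi\<^sub>M {..<2*M} (\<lambda>_. unif01)" and ?E = "ghost_event M b J T"
  interpret Q: prob_space ?Q by (rule prob_space_PiM_unif01)
  note E = sets_ghost_event[OF J T, where b = b]
  define R where "R \<sigma> y = (\<lambda>i\<in>{..<2*M}. y (swap_halves M \<sigma> i))" for \<sigma> and y :: "nat \<Rightarrow> real"
  define W where "W y = {i. i < 2*M \<and> y i \<in> J}" for y :: "nat \<Rightarrow> real"
  have dR: "distr ?Q ?Q (R \<sigma>) = ?Q" for \<sigma>
    unfolding R_def
    by (rule distr_PiM_reindex) (auto simp: inj_swap_halves swap_halves_less unif01.prob_space_axioms)
  have R: "R \<sigma> \<in> ?Q \<rightarrow>\<^sub>M ?Q" for \<sigma>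
    unfolding R_def using swap_halves_less by (intro measurable_restrict) auto
  \<comment> \<open>There are finitely many exchanges and each preserves the law, so
    \<open>T\<close> is correct for all exchanged samples at once outside a null set.\<close>
  have "AE y in ?Q. \<forall>\<sigma>\<in>Pow {..<M}. \<forall>Z\<in>Pow {..<2*M}. R \<sigma> y \<in> T Z \<longleftrightarrow> Z \<in> trace_sets H f (2*M) (R \<sigma> y)"
  proof (rule AE_finite_allI)
    fix \<sigma>
    have "AE y in distr ?Q ?Q (R \<sigma>). \<forall>Z\<in>Pow {..<2*M}. y \<in> T Z \<longleftrightarrow> Z \<in> trace_sets H f (2*M) y"
      unfolding dR by (rule AE_T)
    then show "AE y in ?Q. \<forall>Z\<in>Pow {..<2*M}. R \<sigma> y \<in> T Z \<longleftrightarrow> Z \<in> trace_sets H f (2*M) (R \<sigma> y)"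
      by (rule AE_distrD[OF R])
  qed simp
  \<comment> \<open>The bound is pointwise in \<open>y\<close>, for the sum over all exchanges. By
    invariance of the law, integration turns the left side into 2^b 2^M times the probability
    sought.\<close>
  then have "AE y in ?Q. ennreal (2 ^ b) * (\<Sum>\<sigma>\<in>Pow {..<M}. indicator ?E (R \<sigma> y))
      \<le> ennreal (2 ^ M) * of_nat (card {S. S \<subseteq> W y \<and> card S \<le> d})"
  proof eventually_elim
    case (elim y)
    define \<D> where "\<D> = (\<lambda>Z. W y - Z) ` trace_sets H f (2*M) y"
    have fin: "finite \<D>" by (rule finite_subset[of _ "Pow (W y)"]) (auto simp: \<D>_def W_def)
    let ?C = "\<lambda>D. {\<sigma>. \<sigma> \<subseteq> {..<M} \<and> (\<forall>i<M. swap_halves M \<sigma> i \<notin> D)}"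
    \<comment> \<open>Each exchange that produces the event is charged to a disagreement pattern of
      the unexchanged sample, and there are few such patterns.\<close>
    have sub: "{\<sigma>\<in>Pow {..<M}. R \<sigma> y \<in> ?E} \<subseteq> (\<Union>D\<in>{D\<in>\<D>. b \<le> card D}. ?C D)"
    proof
      fix \<sigma> assume \<sigma>: "\<sigma> \<in> {\<sigma>\<in>Pow {..<M}. R \<sigma> y \<in> ?E}"
      then obtain Z where Z: "Z \<subseteq> {..<2*M}" "R \<sigma> y \<in> T Z" "W (R \<sigma> y) \<inter> {..<M} \<subseteq> Z" "b \<le> card (W (R \<sigma> y) - Z)"
        unfolding ghost_event_def W_def by blast
      have "Z \<in> trace_sets H f (2*M) (R \<sigma> y)" using elim \<sigma> Z(1,2) by blast
      then obtain h where h: "h \<in> H" "Z = {i. i < 2*M \<and> h (R \<sigma> y i) = f (R \<sigma> y i)}"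
        by (auto simp: trace_sets_iff)
      \<comment> \<open>The disagreements of \<open>h\<close> inside \<open>J\<close> before the
        exchange; the exchange merely permutes their positions.\<close>
      define D where "D = W y - {i. i < 2*M \<and> h (y i) = f (y i)}"
      have D\<D>: "D \<in> \<D>" using h(1) by (auto simp: D_def \<D>_def trace_sets_def)
      have iff: "i \<in> W (R \<sigma> y) - Z \<longleftrightarrow> i < 2*M \<and> swap_halves M \<sigma> i \<in> D" for i
        using swap_halves_less[of i M \<sigma>] by (auto simp: W_def h(2) R_def D_def)
      have "swap_halves M \<sigma> ` D = W (R \<sigma> y) - Z"
      proof (intro set_eqI iffI)
        fix i assume "i \<in> swap_halves M \<sigma> ` D"
        then obtain j where j: "j \<in> D" "i = swap_halves M \<sigma> j" by blast
        moreover have "j < 2 * M" using j by (auto simp: D_def W_def)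
        ultimately show "i \<in> W (R \<sigma> y) - Z"
          unfolding iff using swap_halves_less[of j M \<sigma>] by (simp add: swap_halves_involution)
      next
        fix i assume "i \<in> W (R \<sigma> y) - Z"
        then have "swap_halves M \<sigma> i \<in> D" unfolding iff by blast
        then show "i \<in> swap_halves M \<sigma> ` D"
          using swap_halves_involution[of M \<sigma> i] by (metis image_eqI)
      qed
      then have "card D = card (W (R \<sigma> y) - Z)" using card_image[OF inj_swap_halves] by metis
      moreover have "swap_halves M \<sigma> i \<notin> D" if "i < M" for i
      proof
        assume "swap_halves M \<sigma> i \<in> D"
        then have "i \<in> W (R \<sigma> y) - Z" unfolding iff using that by simp
        then show False using Z(3) that by auto
      qed
      ultimately show "\<sigma> \<in> (\<Union>D\<in>{D\<in>\<D>. b \<le> card D}. ?C D)" using Z(4) D\<D> \<sigma> by auto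
    qed
    have finC: "finite (?C D)" for D by (rule finite_subset[of _ "Pow {..<M}"]) auto
    have "card {\<sigma>\<in>Pow {..<M}. R \<sigma> y \<in> ?E} \<le> card (\<Union>D\<in>{D\<in>\<D>. b \<le> card D}. ?C D)"
      using fin finC by (intro card_mono sub finite_UN_I) auto
    also have "\<dots> \<le> (\<Sum>D\<in>{D\<in>\<D>. b \<le> card D}. card (?C D))"
      using fin by (intro card_UN_le) auto
    finally have "card {\<sigma>\<in>Pow {..<M}. R \<sigma> y \<in> ?E} * 2 ^ b \<le> (\<Sum>D\<in>{D\<in>\<D>. b \<le> card D}. card (?C D)) * 2 ^ b"
      by (rule mult_right_mono) simp
    also have "\<dots> = (\<Sum>D\<in>{D\<in>\<D>. b \<le> card D}. card (?C D) * 2 ^ b)" by (rule sum_distrib_right)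
    also have "\<dots> \<le> (\<Sum>D\<in>{D\<in>\<D>. b \<le> card D}. 2 ^ M)"
      by (intro sum_mono card_swaps_clearing_first_half) (auto simp: \<D>_def W_def)
    also have "\<dots> \<le> card \<D> * 2 ^ M" using fin by (auto intro!: card_mono)
    also have "card \<D> \<le> card {S. S \<subseteq> W y \<and> card S \<le> d}"
      unfolding \<D>_def by (rule card_trace_diffs_le[OF gd]) (auto simp: W_def)
    finally have "card {\<sigma>\<in>Pow {..<M}. R \<sigma> y \<in> ?E} * 2 ^ b \<le> card {S. S \<subseteq> W y \<and> card S \<le> d} * 2 ^ M"
      by simp
    then have "(of_nat (card {\<sigma>\<in>Pow {..<M}. R \<sigma> y \<in> ?E} * 2 ^ b) :: ennreal)
        \<le> of_nat (card {S. S \<subseteq> W y \<and> card S \<le> d} * 2 ^ M)" by (simp only: of_nat_le_iff)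
    then show ?case
      unfolding sum_indicator_vimage_eq_card[OF finite_Pow_iff[THEN iffD2, OF finite_lessThan]]
      by (simp add: mult.commute ennreal_power[symmetric])
  qed
  then have "(\<integral>\<^sup>+y. ennreal (2 ^ b) * (\<Sum>\<sigma>\<in>Pow {..<M}. indicator ?E (R \<sigma> y)) \<partial>?Q)
      \<le> (\<integral>\<^sup>+y. ennreal (2 ^ M) * of_nat (card {S. S \<subseteq> W y \<and> card S \<le> d}) \<partial>?Q)"
    by (rule nn_integral_mono_AE)
  also have "\<dots> \<le> ennreal (2 ^ M) * ennreal (\<Sum>i\<le>d. real (2*M choose i) * p ^ i)"
  proof -
    have "(\<integral>\<^sup>+y. ennreal (2 ^ M) * of_nat (card {S. S \<subseteq> W y \<and> card S \<le> d}) \<partial>?Q)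
        = ennreal (2 ^ M) * (\<integral>\<^sup>+y. of_nat (card {S. S \<subseteq> W y \<and> card S \<le> d}) \<partial>?Q)"
    proof (rule nn_integral_cmult)
      have eq: "of_nat (card {S. S \<subseteq> W y \<and> card S \<le> d})
          = (\<Sum>S\<in>{S. S \<subseteq> {..<2*M} \<and> card S \<le> d}. if \<forall>i\<in>S. y i \<in> J then 1 else 0 :: ennreal)" for y
      proof -
        have "{S. S \<subseteq> W y \<and> card S \<le> d} = {S\<in>{S. S \<subseteq> {..<2*M} \<and> card S \<le> d}. \<forall>i\<in>S. y i \<in> J}"
          by (auto simp: W_def)
        then have "of_nat (card {S. S \<subseteq> W y \<and> card S \<le> d})
            = (\<Sum>S\<in>{S\<in>{S. S \<subseteq> {..<2*M} \<and> card S \<le> d}. \<forall>i\<in>S. y i \<in> J}. 1)" by simp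
        also have "\<dots> = (\<Sum>S\<in>{S. S \<subseteq> {..<2*M} \<and> card S \<le> d}. if \<forall>i\<in>S. y i \<in> J then 1 else 0)"
          by (rule sum.inter_filter) simp
        finally show ?thesis .
      qed
      have pr: "Measurable.pred ?Q (\<lambda>y. \<forall>i\<in>S. y i \<in> J)" if "S \<subseteq> {..<2*M}" for S
      proof (rule pred_intros_finite(3))
        show "finite S" using that finite_subset by blast
        fix i assume "i \<in> S"
        then have "i \<in> {..<2*M}" using that by blast
        then show "Measurable.pred ?Q (\<lambda>y. y i \<in> J)" using J by measurable
      qed
      show "(\<lambda>y. of_nat (card {S. S \<subseteq> W y \<and> card S \<le> d}) :: ennreal) \<in> borel_measurable ?Q"
        unfolding eq by (intro borel_measurable_sum measurable_If pr[unfolded pred_def]) auto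
    qed
    then show ?thesis unfolding W_def nn_integral_card_subsets[OF J p] by simp
  qed
  also have "(\<integral>\<^sup>+y. ennreal (2 ^ b) * (\<Sum>\<sigma>\<in>Pow {..<M}. indicator ?E (R \<sigma> y)) \<partial>?Q)
      = ennreal (2 ^ b) * (\<Sum>\<sigma>\<in>Pow {..<M}. \<integral>\<^sup>+y. indicator ?E (R \<sigma> y) \<partial>?Q)"
    using E R by (subst nn_integral_cmult) (auto simp: nn_integral_sum)
  also have "(\<Sum>\<sigma>\<in>Pow {..<M}. \<integral>\<^sup>+y. indicator ?E (R \<sigma> y) \<partial>?Q) = (\<Sum>\<sigma>\<in>Pow {..<M}. emeasure ?Q ?E)"
  proof (rule sum.cong[OF refl])
    fix \<sigma>
    have "(\<integral>\<^sup>+y. indicator ?E (R \<sigma> y) \<partial>?Q) = (\<integral>\<^sup>+y. indicator ?E y \<partial>distr ?Q ?Q (R \<sigma>))"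
      using E R by (subst nn_integral_distr) auto
    then show "(\<integral>\<^sup>+y. indicator ?E (R \<sigma> y) \<partial>?Q) = emeasure ?Q ?E"
      unfolding dR using E by simp
  qed
  also have "\<dots> = ennreal (2 ^ M) * emeasure ?Q ?E" by (simp add: card_Pow ennreal_power[symmetric])
  finally have "ennreal (2 ^ b * (2 ^ M * measure ?Q ?E)) \<le> ennreal (2 ^ M * (\<Sum>i\<le>d. real (2*M choose i) * p ^ i))"
    using p by (simp add: Q.emeasure_eq_measure ennreal_mult sum_nonneg)
  then have "2 ^ b * (2 ^ M * measure ?Q ?E) \<le> 2 ^ M * (\<Sum>i\<le>d. real (2*M choose i) * p ^ i)"
    using p by (subst (asm) ennreal_le_iff) (auto intro!: mult_nonneg_nonneg sum_nonneg)
  then have "2 ^ M * (measure ?Q ?E * 2 ^ b) \<le> 2 ^ M * (\<Sum>i\<le>d. real (2*M choose i) * p ^ i)"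
    by (simp add: ac_simps)
  then have "measure ?Q ?E * 2 ^ b \<le> (\<Sum>i\<le>d. real (2*M choose i) * p ^ i)" by simp
  then show ?thesis by (simp add: field_simps)
qed

text \<open>
  The double sample argument behind the VC theorem. A sample point outside \<open>J\<close> is ignored, so the
  number of traces is governed by the expected number \<open>M * p\<close> of sample points in \<open>J\<close>, not by \<open>M\<close>.
\<close>

lemma all_agree_on_window_prob_le:
  assumes tm: "trace_measurable Y H" and f: "f \<in> borel \<rightarrow>\<^sub>M Y"
    and gd: "graph_dim H = enat d" and J: "J \<in> sets borel" and p: "p = measure unif01 J"
    and far: "\<And>h. h \<in> H \<Longrightarrow> \<exists>A\<in>sets borel. A \<subseteq> J \<inter> {x. f x \<noteq> h x} \<and> \<rho> \<le> measure unif01 A"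
    and b: "2 ^ b * exp (- \<rho> * real M / 2) \<le> 1 / 2"
    and T: "\<And>Z. T Z \<in> sets (Pi\<^sub>M {..<M} (\<lambda>_. unif01))"
    and AE_T: "AE x in Pi\<^sub>M {..<M} (\<lambda>_. unif01). \<forall>Z\<in>Pow {..<M}. x \<in> T Z \<longleftrightarrow> Z \<in> trace_sets H f M x"
  shows "measure (Pi\<^sub>M {..<M} (\<lambda>_. unif01))
      {x \<in> space (Pi\<^sub>M {..<M} (\<lambda>_. unif01)). \<exists>Z\<in>Pow {..<M}. x \<in> T Z \<and> {i. i < M \<and> x i \<in> J} \<subseteq> Z}
    \<le> 2 * ((\<Sum>i\<le>d. real (2*M choose i) * p ^ i) / 2 ^ b)"
proof -
  let ?P1 = "Pi\<^sub>M {..<M} (\<lambda>_::nat. unif01)" and ?P2 = "Pi\<^sub>M {M..<2*M} (\<lambda>_::nat. unif01)"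
  let ?Q = "Pi\<^sub>M {..<2*M} (\<lambda>_::nat. unif01)"
  interpret Q1: prob_space ?P1 by (rule prob_space_PiM_unif01)
  interpret Q2: prob_space ?P2 by (rule prob_space_PiM_unif01)
  interpret Q: prob_space ?Q by (rule prob_space_PiM_unif01)
  interpret Q12: pair_sigma_finite ?P1 ?P2 ..
  obtain T2 where T2: "\<And>Z. T2 Z \<in> sets ?Q"
    "AE x in ?Q. \<forall>Z\<in>Pow {..<2*M}. x \<in> T2 Z \<longleftrightarrow> Z \<in> trace_sets H f (2*M) x"
    by (rule ex_measurable_trace[OF tm f, where n = "2 * M"]) (rule that)
  let ?E = "ghost_event M b J T2"
  note E = sets_ghost_event[OF J T2(1), where b = b]
  let ?A = "{x \<in> space ?P1. \<exists>Z\<in>Pow {..<M}. x \<in> T Z \<and> {i. i < M \<and> x i \<in> J} \<subseteq> Z}"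
  have "Measurable.pred ?P1 (\<lambda>x. \<exists>Z\<in>Pow {..<M}. x \<in> T Z \<and> {i. i < M \<and> x i \<in> J} \<subseteq> Z)"
  proof (rule measurable_trace_event[where \<Phi> = "\<lambda>Z W. W \<subseteq> Z"])
    fix i assume "i < M"
    then show "Measurable.pred ?P1 (\<lambda>y. i \<in> {i. i < M \<and> y i \<in> J})" using J by simp
  qed (use T in auto)
  then have A: "?A \<in> sets ?P1" by (simp add: pred_def)
  have un: "{..<M} \<union> {M..<2*M} = {..<2*M}" by auto
  have dis: "{..<M} \<inter> {M..<2*M} = {}" by auto
  have dm: "distr (?P1 \<Otimes>\<^sub>M ?P2) ?Q (merge {..<M} {M..<2*M}) = ?Q"
    using unif01P.distr_merge[OF dis] unfolding un by simp
  have mm: "merge {..<M} {M..<2*M} \<in> ?P1 \<Otimes>\<^sub>M ?P2 \<rightarrow>\<^sub>M ?Q"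
    using measurable_merge[of "{..<M}" "{M..<2*M}" "\<lambda>_. unif01"] unfolding un .
  have "AE z in ?P1 \<Otimes>\<^sub>M ?P2. \<forall>Z\<in>Pow {..<2*M}. merge {..<M} {M..<2*M} z \<in> T2 Z \<longleftrightarrow>
      Z \<in> trace_sets H f (2*M) (merge {..<M} {M..<2*M} z)"
    by (rule AE_distrD[OF mm]) (unfold dm, rule T2(2))
  then have "AE x in ?P1. AE x' in ?P2. \<forall>Z\<in>Pow {..<2*M}. merge {..<M} {M..<2*M} (x, x') \<in> T2 Z \<longleftrightarrow>
      Z \<in> trace_sets H f (2*M) (merge {..<M} {M..<2*M} (x, x'))"
    by (rule Q12.AE_pair)
  \<comment> \<open>Given the sample, fix one \<open>h\<close> that passes on it. The ghost sample
    is independent of this choice, so with probability at least 1/2 it shows at least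
    \<open>b\<close> disagreements with \<open>h\<close>.\<close>
  then have "AE x in ?P1. ennreal (1 / 2) * indicator ?A x \<le> (\<integral>\<^sup>+x'. indicator ?E (merge {..<M} {M..<2*M} (x, x')) \<partial>?P2)"
    using AE_T AE_space
  proof eventually_elim
    case (elim x)
    show ?case
    proof (cases "x \<in> ?A")
      case True
      then obtain Z where Z: "Z \<subseteq> {..<M}" "x \<in> T Z" "{i. i < M \<and> x i \<in> J} \<subseteq> Z" by auto
      then obtain h where h: "h \<in> H" "Z = {i. i < M \<and> h (x i) = f (x i)}"
        using elim(2) by (auto simp: trace_sets_iff)
      obtain A where A: "A \<in> sets borel" "A \<subseteq> J \<inter> {x. f x \<noteq> h x}" "\<rho> \<le> measure unif01 A"
        using far[OF h(1)] by blast
      let ?B = "{x' \<in> space ?P2. b \<le> card {i\<in>{M..<2*M}. x' i \<in> A}}"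
      have half: "1 / 2 \<le> measure ?P2 ?B"
        using b by (intro binomial_lower_tail[OF _ A(1,3)]) auto
      \<comment> \<open>A nonmeasurable set would have measure 0, so the lower bound 1/2 already
        yields measurability.\<close>
      have B: "?B \<in> sets ?P2"
      proof (rule ccontr)
        assume "?B \<notin> sets ?P2"
        then have "measure ?P2 ?B = 0" by (rule measure_notin_sets)
        then show False using half by simp
      qed
      have "ennreal (1 / 2) * indicator ?A x = ennreal (1 / 2)" using True by simp
      also have "\<dots> \<le> emeasure ?P2 ?B" unfolding Q2.emeasure_eq_measure by (rule ennreal_leI[OF half])
      also have "\<dots> = (\<integral>\<^sup>+x'. indicator ?B x' \<partial>?P2)" by (rule nn_integral_indicator[OF B, symmetric])
      also have "\<dots> \<le> (\<integral>\<^sup>+x'. indicator ?E (merge {..<M} {M..<2*M} (x, x')) \<partial>?P2)"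
      proof (rule nn_integral_mono_AE)
        show "AE x' in ?P2. indicator ?B x' \<le> (indicator ?E (merge {..<M} {M..<2*M} (x, x')) :: ennreal)"
          using elim(1) AE_space
        proof eventually_elim
          case (elim x')
          define y where "y = merge {..<M} {M..<2*M} (x, x')"
          have y: "i < M \<Longrightarrow> y i = x i" "M \<le> i \<Longrightarrow> i < 2 * M \<Longrightarrow> y i = x' i" for i
            by (auto simp: y_def merge_def)
          have ysp: "y \<in> space ?Q"
            unfolding y_def using elim(2) \<open>x \<in> space ?P1\<close> by (intro measurable_space[OF mm]) (simp add: space_pair_measure)
          show ?case
          proof (cases "x' \<in> ?B")
            case True
            \<comment> \<open>The trace of the same \<open>h\<close> on both halves witnesses the
              ghost event.\<close>
            define V where "V = {i. i < 2*M \<and> h (y i) = f (y i)}"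
            have "V \<in> trace_sets H f (2*M) y" using h(1) by (auto simp: V_def trace_sets_iff)
            moreover have "V \<in> Pow {..<2*M}" by (auto simp: V_def)
            ultimately have "y \<in> T2 V" using elim(1) by (simp add: y_def)
            moreover have "{i. i < 2*M \<and> y i \<in> J} \<inter> {..<M} \<subseteq> V"
            proof
              fix i assume "i \<in> {i. i < 2*M \<and> y i \<in> J} \<inter> {..<M}"
              then have "i \<in> Z" "i < M" using Z(3) y(1) by auto
              then show "i \<in> V" using y(1) unfolding h(2) by (simp add: V_def)
            qed
            moreover have "b \<le> card ({i. i < 2*M \<and> y i \<in> J} - V)"
            proof -
              have "b \<le> card {i\<in>{M..<2*M}. x' i \<in> A}" using True by simp
              also have "\<dots> \<le> card ({i. i < 2*M \<and> y i \<in> J} - V)"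
              proof (rule card_mono)
                show "{i\<in>{M..<2*M}. x' i \<in> A} \<subseteq> {i. i < 2*M \<and> y i \<in> J} - V"
                proof
                  fix i assume i: "i \<in> {i\<in>{M..<2*M}. x' i \<in> A}"
                  then have "y i = x' i" "x' i \<in> J" "f (x' i) \<noteq> h (x' i)" using y(2) A(2) by auto
                  then show "i \<in> {i. i < 2*M \<and> y i \<in> J} - V" using i by (auto simp: V_def)
                qed
              qed simp
              finally show ?thesis .
            qed
            ultimately have "y \<in> ?E" using ysp \<open>V \<in> Pow {..<2*M}\<close> unfolding ghost_event_def by blast
            then show ?thesis by (simp add: y_def[symmetric] indicator_def)
          qed simp
        qed
      qed
      finally show ?thesis .
    qed simp
  qed
  then have "(\<integral>\<^sup>+x. ennreal (1 / 2) * indicator ?A x \<partial>?P1)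
      \<le> (\<integral>\<^sup>+x. \<integral>\<^sup>+x'. indicator ?E (merge {..<M} {M..<2*M} (x, x')) \<partial>?P2 \<partial>?P1)"
    by (rule nn_integral_mono_AE)
  also have "\<dots> = (\<integral>\<^sup>+y. indicator ?E y \<partial>?Q)"
    using unif01P.product_nn_integral_fold[OF dis, of "indicator ?E"] E unfolding un by simp
  also have "\<dots> = emeasure ?Q ?E" using E by simp
  also have "(\<integral>\<^sup>+x. ennreal (1 / 2) * indicator ?A x \<partial>?P1) = ennreal (1 / 2) * emeasure ?P1 ?A"
    using A by (rule nn_integral_cmult_indicator)
  finally have "ennreal (1 / 2 * measure ?P1 ?A) \<le> ennreal (measure ?Q ?E)"
    by (simp only: Q1.emeasure_eq_measure Q.emeasure_eq_measure ennreal_mult[symmetric] measure_nonneg zero_le_divide_1_iff zero_le_numeral)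
  then have "1 / 2 * measure ?P1 ?A \<le> measure ?Q ?E" by (subst (asm) ennreal_le_iff) auto
  also have "\<dots> \<le> (\<Sum>i\<le>d. real (2*M choose i) * p ^ i) / 2 ^ b"
    by (rule measure_ghost_event_le[OF gd J p T2])
  finally show ?thesis by linarith
qed

section \<open>A single window\<close>

text \<open>A block consists of \<open>M\<close> sample points followed by the centre of the window, at index \<open>M\<close>.\<close>

definition block_rejects :: "(real \<Rightarrow> 'y) set \<Rightarrow> real \<Rightarrow> nat \<Rightarrow> (nat \<Rightarrow> real) \<Rightarrow> (nat \<Rightarrow> 'y) \<Rightarrow> bool" where
  "block_rejects H r M y a \<longleftrightarrow> r < y M \<and> y M < 1 - r \<and>
     \<not> (\<exists>h\<in>H. \<forall>i<M. \<bar>y i - y M\<bar> < r \<longrightarrow> h (y i) = a i)"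

text \<open>A Borel stand-in for \<open>block_rejects\<close> with the true labels, almost surely
  equal to it. The restriction drops the centre, since \<open>T\<close> lives on the
  \<open>M\<close> sample points alone.\<close>

definition block_reject_event ::
    "(nat set \<Rightarrow> (nat \<Rightarrow> real) set) \<Rightarrow> real \<Rightarrow> nat \<Rightarrow> (nat \<Rightarrow> real) set" where
  "block_reject_event T r M = {y \<in> space (Pi\<^sub>M {..<Suc M} (\<lambda>_. unif01)). r < y M \<and> y M < 1 - r \<and>
     \<not> (\<exists>Z\<in>Pow {..<M}. restrict y {..<M} \<in> T Z \<and> {i. i < M \<and> y i \<in> {y M - r<..<y M + r}} \<subseteq> Z)}"

lemma measurable_block_accepts:
  assumes T: "\<And>Z. T Z \<in> sets (Pi\<^sub>M {..<M} (\<lambda>_. unif01))"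
  shows "Measurable.pred (Pi\<^sub>M {..<Suc M} (\<lambda>_. unif01)) (\<lambda>y. \<exists>Z\<in>Pow {..<M}.
    restrict y {..<M} \<in> T Z \<and> {i. i < M \<and> y i \<in> {y M - r<..<y M + r}} \<subseteq> Z)"
proof (rule measurable_trace_event[where \<Phi> = "\<lambda>Z W. W \<subseteq> Z"])
  let ?Q = "Pi\<^sub>M {..<Suc M} (\<lambda>_. unif01)"
  have comp[measurable]: "(\<lambda>y. y i) \<in> borel_measurable ?Q" if "i < Suc M" for i
    using measurable_component_singleton[of i "{..<Suc M}" "\<lambda>_. unif01"] that by simp
  show "Measurable.pred ?Q (\<lambda>y. i \<in> {i. i < M \<and> y i \<in> {y M - r<..<y M + r}})" if "i < M" for i
    using that comp[of i] comp[of M] by simp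
  show "Measurable.pred ?Q (\<lambda>y. restrict y {..<M} \<in> T Z)" for Z
  proof -
    have "{y \<in> space ?Q. restrict y {..<M} \<in> T Z} = (\<lambda>y. restrict y {..<M}) -` T Z \<inter> space ?Q" by auto
    also have "\<dots> \<in> sets ?Q" by (rule measurable_sets[OF measurable_restrict_subset T]) auto
    finally show ?thesis by (simp add: pred_def)
  qed
qed auto

lemma sets_block_reject_event:
  assumes T: "\<And>Z. T Z \<in> sets (Pi\<^sub>M {..<M} (\<lambda>_. unif01))"
  shows "block_reject_event T r M \<in> sets (Pi\<^sub>M {..<Suc M} (\<lambda>_. unif01))"
proof -
  have [measurable]: "(\<lambda>y. y M) \<in> borel_measurable (Pi\<^sub>M {..<Suc M} (\<lambda>_. unif01))"
    using measurable_component_singleton[of M "{..<Suc M}" "\<lambda>_. unif01"] by simp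
  note measurable_block_accepts[OF T, measurable]
  show ?thesis unfolding block_reject_event_def by measurable
qed

lemma AE_restrict_PiM_unif01:
  assumes "AE x in Pi\<^sub>M {..<M} (\<lambda>_. unif01). P x"
  shows "AE y in Pi\<^sub>M {..<Suc M} (\<lambda>_. unif01). P (restrict y {..<M})"
proof -
  have m: "(\<lambda>y. restrict y {..<M}) \<in> Pi\<^sub>M {..<Suc M} (\<lambda>_. unif01) \<rightarrow>\<^sub>M Pi\<^sub>M {..<M} (\<lambda>_. unif01)"
    by (rule measurable_restrict_subset) auto
  have d: "distr (Pi\<^sub>M {..<Suc M} (\<lambda>_. unif01)) (Pi\<^sub>M {..<M} (\<lambda>_. unif01)) (\<lambda>y. restrict y {..<M})
      = Pi\<^sub>M {..<M} (\<lambda>_. unif01)"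
    by (rule distr_PiM_reindex[where f = "\<lambda>i. i"]) (auto simp: unif01.prob_space_axioms)
  have "AE x in distr (Pi\<^sub>M {..<Suc M} (\<lambda>_. unif01)) (Pi\<^sub>M {..<M} (\<lambda>_. unif01)) (\<lambda>y. restrict y {..<M}). P x"
    unfolding d by (rule assms)
  from AE_distrD[OF m this] show ?thesis .
qed

lemma AE_block_reject_event:
  assumes AE_T: "AE x in Pi\<^sub>M {..<M} (\<lambda>_. unif01). \<forall>Z\<in>Pow {..<M}. x \<in> T Z \<longleftrightarrow> Z \<in> trace_sets H f M x"
  shows "AE y in Pi\<^sub>M {..<Suc M} (\<lambda>_. unif01).
    y \<in> block_reject_event T r M \<longleftrightarrow> block_rejects H r M y (\<lambda>i. f (y i))"
  using AE_restrict_PiM_unif01[OF AE_T] AE_space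
proof eventually_elim
  case (elim y)
  have "trace_sets H f M (restrict y {..<M}) = trace_sets H f M y"
    unfolding trace_sets_def by (intro image_cong refl Collect_cong) auto
  then have T: "restrict y {..<M} \<in> T Z \<longleftrightarrow> Z \<in> trace_sets H f M y" if "Z \<in> Pow {..<M}" for Z
    using elim(1) that by simp
  have "(\<exists>Z\<in>Pow {..<M}. restrict y {..<M} \<in> T Z \<and> {i. i < M \<and> y i \<in> {y M - r<..<y M + r}} \<subseteq> Z)
      \<longleftrightarrow> (\<exists>h\<in>H. \<forall>i<M. \<bar>y i - y M\<bar> < r \<longrightarrow> h (y i) = f (y i))" (is "?L \<longleftrightarrow> ?R")
  proof
    assume ?L
    then obtain Z where Z: "Z \<in> Pow {..<M}" "restrict y {..<M} \<in> T Z"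
      "{i. i < M \<and> y i \<in> {y M - r<..<y M + r}} \<subseteq> Z" by blast
    then obtain h where h: "h \<in> H" "Z = {i. i < M \<and> h (y i) = f (y i)}"
      using T by (auto simp: trace_sets_iff)
    have "h (y i) = f (y i)" if "i < M" "\<bar>y i - y M\<bar> < r" for i
    proof -
      have "i \<in> Z" using Z(3) that by auto
      then show ?thesis using h(2) by simp
    qed
    then show ?R using h(1) by blast
  next
    assume ?R
    then obtain h where h: "h \<in> H" "\<forall>i<M. \<bar>y i - y M\<bar> < r \<longrightarrow> h (y i) = f (y i)" by blast
    let ?Z = "{i. i < M \<and> h (y i) = f (y i)}"
    have "?Z \<in> Pow {..<M}" "?Z \<in> trace_sets H f M y" using h(1) by (auto simp: trace_sets_iff)
    moreover have "{i. i < M \<and> y i \<in> {y M - r<..<y M + r}} \<subseteq> ?Z" using h(2) by auto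
    ultimately show ?L using T by blast
  qed
  then show ?case using elim(2) by (auto simp: block_reject_event_def block_rejects_def)
qed

lemma measure_component_PiM_unif01:
  assumes "C \<in> sets borel" "i \<in> I"
  shows "measure (Pi\<^sub>M I (\<lambda>_::nat. unif01)) {y \<in> space (Pi\<^sub>M I (\<lambda>_. unif01)). y i \<in> C} = measure unif01 C"
    and "{y \<in> space (Pi\<^sub>M I (\<lambda>_::nat. unif01)). y i \<in> C} \<in> sets (Pi\<^sub>M I (\<lambda>_. unif01))"
proof -
  have m: "(\<lambda>y. y i) \<in> Pi\<^sub>M I (\<lambda>_::nat. unif01) \<rightarrow>\<^sub>M unif01"
    using assms(2) by (rule measurable_component_singleton)
  have d: "distr (Pi\<^sub>M I (\<lambda>_::nat. unif01)) unif01 (\<lambda>y. y i) = unif01"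
    using assms(2) by (intro distr_PiM_component) (auto simp: unif01.prob_space_axioms)
  have eq: "{y \<in> space (Pi\<^sub>M I (\<lambda>_::nat. unif01)). y i \<in> C} = (\<lambda>y. y i) -` C \<inter> space (Pi\<^sub>M I (\<lambda>_. unif01))"
    by auto
  show "{y \<in> space (Pi\<^sub>M I (\<lambda>_::nat. unif01)). y i \<in> C} \<in> sets (Pi\<^sub>M I (\<lambda>_. unif01))"
    unfolding eq using m assms by (intro measurable_sets) auto
  show "measure (Pi\<^sub>M I (\<lambda>_::nat. unif01)) {y \<in> space (Pi\<^sub>M I (\<lambda>_. unif01)). y i \<in> C} = measure unif01 C"
    unfolding eq using m assms by (subst measure_distr[symmetric, where N = unif01]) (auto simp: d)
qed

text \<open>If every breakpoint is at distance at least \<open>r\<close> from the centre, the window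
  lies within one piece and the function of that piece passes. Rejection thus needs a centre within
  \<open>r\<close> of one of the k - 1 breakpoints.\<close>

lemma block_reject_prob_le:
  assumes T: "\<And>Z. T Z \<in> sets (Pi\<^sub>M {..<M} (\<lambda>_. unif01))"
    and AE_T: "AE x in Pi\<^sub>M {..<M} (\<lambda>_. unif01). \<forall>Z\<in>Pow {..<M}. x \<in> T Z \<longleftrightarrow> Z \<in> trace_sets H f M x"
    and f: "f \<in> piecewise k H" and r: "0 < r" and k: "0 < k"
  shows "measure (Pi\<^sub>M {..<Suc M} (\<lambda>_. unif01)) (block_reject_event T r M) \<le> 2 * r * (real k - 1)"
proof -
  let ?Q = "Pi\<^sub>M {..<Suc M} (\<lambda>_. unif01)"
  interpret Q: prob_space ?Q by (rule prob_space_PiM_unif01)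
  from f obtain h t where h: "\<forall>i\<in>{1..k}. h i \<in> H"
    and t: "t 0 = -\<infinity>" "t k = \<infinity>" "\<forall>i\<in>{1..<k}. \<bar>t i\<bar> \<noteq> \<infinity>"
    and eq: "\<forall>x. \<forall>i\<in>{1..k}. t (i - 1) < ereal x \<and> ereal x \<le> t i \<longrightarrow> f x = h i x"
    unfolding piecewise_def by blast
  define s where "s i = real_of_ereal (t i)" for i
  have ts: "t i = ereal (s i)" if "i \<in> {1..<k}" for i
    using t(3) that by (simp add: s_def ereal_real')
  define C where "C = (\<Union>i\<in>{1..<k}. {s i - r<..<s i + r})"
  have C: "C \<in> sets borel" by (auto simp: C_def)
  have inC: "c \<in> C" if c: "block_rejects H r M y (\<lambda>i. f (y i))" "c = y M" for y c
  proof (rule ccontr)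
    assume nC: "c \<notin> C"
    \<comment> \<open>The least \<open>i\<close> with \<open>P i\<close> is the piece that contains
      the window: its right end is beyond the window, and the preceding breakpoint, being less than
      \<open>c + r\<close> but not in \<open>C\<close>, is at most \<open>c - r\<close>.\<close>
    define P where "P i \<longleftrightarrow> i \<le> k \<and> ereal (c + r) \<le> t i" for i
    have "P k" using t(2) by (simp add: P_def)
    define i where "i = (LEAST i. P i)"
    have Pi: "P i" unfolding i_def using \<open>P k\<close> by (rule LeastI)
    have i0: "i \<noteq> 0"
    proof
      assume "i = 0"
      then show False using Pi t(1) by (simp add: P_def)
    qed
    have ik: "i \<le> k" using Pi by (simp add: P_def)
    have nP: "\<not> P (i - 1)" using not_less_Least[of "i - 1" P] i0 by (simp add: i_def)
    have lo: "t (i - 1) \<le> ereal (c - r)"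
    proof (cases "i - 1 = 0")
      case False
      then have i1: "i - 1 \<in> {1..<k}" using ik i0 by auto
      have "\<not> ereal (c + r) \<le> t (i - 1)" using nP ik by (simp add: P_def)
      then have "s (i - 1) < c + r" unfolding ts[OF i1] by simp
      moreover have "c \<notin> {s (i - 1) - r<..<s (i - 1) + r}" using nC i1 by (auto simp: C_def)
      ultimately have "s (i - 1) \<le> c - r" using r by auto
      then show ?thesis unfolding ts[OF i1] by simp
    qed (simp add: t(1))
    have "f x = h i x" if "\<bar>x - c\<bar> < r" for x
    proof -
      have "ereal (c - r) < ereal x" "ereal x \<le> ereal (c + r)" using that by auto
      moreover have "ereal (c + r) \<le> t i" using Pi by (simp add: P_def)
      ultimately have "t (i - 1) < ereal x" "ereal x \<le> t i"
        using lo order_le_less_trans order_trans by blast+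
      then show ?thesis using eq i0 ik by auto
    qed
    moreover have "h i \<in> H" using h i0 ik by auto
    ultimately show False using c unfolding block_rejects_def by metis
  qed
  have "measure ?Q (block_reject_event T r M) \<le> measure ?Q {y \<in> space ?Q. y M \<in> C}"
  proof (rule Q.finite_measure_mono_AE)
    show "AE y in ?Q. y \<in> block_reject_event T r M \<longrightarrow> y \<in> {y \<in> space ?Q. y M \<in> C}"
      using AE_block_reject_event[OF AE_T, of r] AE_space by eventually_elim (use inC in auto)
    show "{y \<in> space ?Q. y M \<in> C} \<in> sets ?Q" by (rule measure_component_PiM_unif01(2)[OF C]) simp
  qed
  also have "\<dots> = measure unif01 C" by (rule measure_component_PiM_unif01(1)[OF C]) simp
  also have "\<dots> \<le> (\<Sum>i\<in>{1..<k}. measure unif01 {s i - r<..<s i + r})"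
    unfolding C_def by (rule measure_UNION_le) auto
  also have "\<dots> \<le> (\<Sum>i\<in>{1..<k}. 2 * r)"
  proof (rule sum_mono)
    fix i
    have "measure unif01 {s i - r<..<s i + r} \<le> (s i + r) - (s i - r)"
      using r by (intro measure_unif01_le) auto
    then show "measure unif01 {s i - r<..<s i + r} \<le> 2 * r" by simp
  qed
  also have "\<dots> = 2 * r * (real k - 1)" using k by (simp add: of_nat_diff algebra_simps)
  finally show ?thesis .
qed

text \<open>A block with a bad centre is rejected or lies in \<open>Acc\<close>, the wrong
  acceptances. The centre is independent of the sample points, so by Fubini's theorem it may be held
  fixed, and the double sample argument bounds the probability uniformly over bad centres.\<close>

lemma block_reject_prob_ge:
  assumes tm: "trace_measurable Y H" and f: "f \<in> borel \<rightarrow>\<^sub>M Y"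
    and gd: "graph_dim H = enat d" and r: "0 < r"
    and b: "2 ^ b * exp (- \<rho> * real M / 2) \<le> 1 / 2"
    and T: "\<And>Z. T Z \<in> sets (Pi\<^sub>M {..<M} (\<lambda>_. unif01))"
    and AE_T: "AE x in Pi\<^sub>M {..<M} (\<lambda>_. unif01). \<forall>Z\<in>Pow {..<M}. x \<in> T Z \<longleftrightarrow> Z \<in> trace_sets H f M x"
    and dis: "\<And>h. h \<in> H \<Longrightarrow> {x. f x \<noteq> h x} \<in> sets (completion unif01)"
  shows "measure unif01 (bad_centres H f r \<rho>) - 2 * ((\<Sum>i\<le>d. real (2*M choose i) * (2 * r) ^ i) / 2 ^ b)
    \<le> measure (Pi\<^sub>M {..<Suc M} (\<lambda>_. unif01)) (block_reject_event T r M)"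
proof -
  let ?Q = "Pi\<^sub>M {..<Suc M} (\<lambda>_. unif01)" and ?P = "Pi\<^sub>M {..<M} (\<lambda>_. unif01)"
  let ?\<tau> = "2 * ((\<Sum>i\<le>d. real (2*M choose i) * (2 * r) ^ i) / 2 ^ b)"
  interpret Q: prob_space ?Q by (rule prob_space_PiM_unif01)
  interpret Q0: prob_space ?P by (rule prob_space_PiM_unif01)
  let ?bad = "bad_centres H f r \<rho>"
  have bad: "?bad \<in> sets borel" using dis by (rule sets_bad_centres)
  define Acc where "Acc = {y \<in> space ?Q. y M \<in> ?bad \<and>
     (\<exists>Z\<in>Pow {..<M}. restrict y {..<M} \<in> T Z \<and> {i. i < M \<and> y i \<in> {y M - r<..<y M + r}} \<subseteq> Z)}"
  have badm: "{y \<in> space ?Q. y M \<in> ?bad} \<in> sets ?Q" by (rule measure_component_PiM_unif01(2)[OF bad]) simp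
  have "Acc = {y \<in> space ?Q. y M \<in> ?bad} \<inter> {y \<in> space ?Q. \<exists>Z\<in>Pow {..<M}. restrict y {..<M} \<in> T Z \<and>
      {i. i < M \<and> y i \<in> {y M - r<..<y M + r}} \<subseteq> Z}" unfolding Acc_def by blast
  then have Acc: "Acc \<in> sets ?Q"
    using badm measurable_block_accepts[OF T, where r = r] by (simp add: pred_def)
  have window: "measure ?P {x \<in> space ?P. \<exists>Z\<in>Pow {..<M}. x \<in> T Z \<and> {i. i < M \<and> x i \<in> {c - r<..<c + r}} \<subseteq> Z} \<le> ?\<tau>"
    if c: "c \<in> ?bad" for c
  proof (rule all_agree_on_window_prob_le[OF tm f gd _ _ _ b T AE_T])
    show "2 * r = measure unif01 {c - r<..<c + r}"
      using c r by (subst measure_unif01_eq) (auto simp: bad_centres_def)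
    show "\<exists>A\<in>sets borel. A \<subseteq> {c - r<..<c + r} \<inter> {x. f x \<noteq> h x} \<and> \<rho> \<le> measure unif01 A" if h: "h \<in> H" for h
    proof -
      \<comment> \<open>The disagreement is measurable only in the completion; its main part is a
        subset in the Borel sigma-algebra with the same measure.\<close>
      let ?S = "{x. f x \<noteq> h x} \<inter> {c - r<..<c + r}"
      have S: "?S \<in> sets (completion unif01)"
        by (intro sets.Int dis h sets_completionI_sets) auto
      have "\<rho> \<le> measure (completion unif01) ?S" using c h by (auto simp: bad_centres_def)
      also have "\<dots> = measure unif01 (main_part unif01 ?S)" unfolding measure_def using S by simp
      finally have "\<rho> \<le> measure unif01 (main_part unif01 ?S)" .
      moreover have "main_part unif01 ?S \<subseteq> ?S" using main_part_null_part_Un[OF S] by blast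
      moreover have "main_part unif01 ?S \<in> sets borel" using main_part_sets[OF S] by simp
      ultimately show ?thesis by blast
    qed
  qed auto
  have "emeasure ?Q Acc = (\<integral>\<^sup>+y. indicator Acc y \<partial>?Q)" using Acc by simp
  also have "\<dots> = (\<integral>\<^sup>+c. (\<integral>\<^sup>+x. indicator Acc (x(M := c)) \<partial>?P) \<partial>unif01)"
    unfolding lessThan_Suc using Acc
    by (intro unif01P.product_nn_integral_insert_rev) (auto simp: lessThan_Suc)
  also have "\<dots> \<le> (\<integral>\<^sup>+c. ennreal ?\<tau> \<partial>unif01)"
  proof (rule nn_integral_mono)
    fix c
    show "(\<integral>\<^sup>+x. indicator Acc (x(M := c)) \<partial>?P) \<le> ennreal ?\<tau>"
    proof (cases "c \<in> ?bad")
      case True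
      let ?A = "{x \<in> space ?P. \<exists>Z\<in>Pow {..<M}. x \<in> T Z \<and> {i. i < M \<and> x i \<in> {c - r<..<c + r}} \<subseteq> Z}"
      have "Measurable.pred ?P (\<lambda>x. \<exists>Z\<in>Pow {..<M}. x \<in> T Z \<and> {i. i < M \<and> x i \<in> {c - r<..<c + r}} \<subseteq> Z)"
      proof (rule measurable_trace_event[where \<Phi> = "\<lambda>Z W. W \<subseteq> Z"])
        fix i assume "i < M"
        then show "Measurable.pred ?P (\<lambda>y. i \<in> {i. i < M \<and> y i \<in> {c - r<..<c + r}})"
          using measurable_component_singleton[of i "{..<M}" "\<lambda>_. unif01"] by simp
      qed (use T in auto)
      then have A: "?A \<in> sets ?P" by (simp add: pred_def)
      have "(\<integral>\<^sup>+x. indicator Acc (x(M := c)) \<partial>?P) \<le> (\<integral>\<^sup>+x. indicator ?A x \<partial>?P)"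
      proof (rule nn_integral_mono)
        fix x assume x: "x \<in> space ?P"
        have "x \<in> extensional {..<M}" using x by (simp add: space_PiM PiE_def)
        then have rx: "restrict (x(M := c)) {..<M} = x"
          by (intro extensionalityI[OF restrict_extensional]) auto
        have "x \<in> ?A" if acc: "x(M := c) \<in> Acc"
        proof -
          obtain Z where Z: "Z \<in> Pow {..<M}" "restrict (x(M := c)) {..<M} \<in> T Z"
            "{i. i < M \<and> (x(M := c)) i \<in> {(x(M := c)) M - r<..<(x(M := c)) M + r}} \<subseteq> Z"
            using acc unfolding Acc_def by blast
          have "{i. i < M \<and> x i \<in> {c - r<..<c + r}}
              = {i. i < M \<and> (x(M := c)) i \<in> {(x(M := c)) M - r<..<(x(M := c)) M + r}}" by auto
          then have "{i. i < M \<and> x i \<in> {c - r<..<c + r}} \<subseteq> Z" using Z(3) by simp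
          then show ?thesis using x Z(2) unfolding rx mem_Collect_eq by (intro conjI bexI[OF _ Z(1)])
        qed
        then show "indicator Acc (x(M := c)) \<le> (indicator ?A x :: ennreal)"
          by (simp add: indicator_def split: if_split)
      qed
      also have "\<dots> = emeasure ?P ?A" by (rule nn_integral_indicator[OF A])
      also have "\<dots> \<le> ennreal ?\<tau>"
        unfolding Q0.emeasure_eq_measure by (rule ennreal_leI[OF window[OF True]])
      finally show ?thesis .
    next
      case False
      then have "indicator Acc (x(M := c)) = (0::ennreal)" for x
        by (simp add: Acc_def indicator_def)
      then show ?thesis by simp
    qed
  qed
  also have "\<dots> = ennreal ?\<tau>" by (simp add: unif01.emeasure_space_1[simplified])
  finally have "ennreal (measure ?Q Acc) \<le> ennreal ?\<tau>" by (simp only: Q.emeasure_eq_measure)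
  moreover have "0 \<le> ?\<tau>" using r by (intro mult_nonneg_nonneg divide_nonneg_nonneg sum_nonneg) auto
  ultimately have Acc\<tau>: "measure ?Q Acc \<le> ?\<tau>" by (subst (asm) ennreal_le_iff) auto
  have "measure unif01 ?bad = measure ?Q {y \<in> space ?Q. y M \<in> ?bad}"
    by (rule measure_component_PiM_unif01(1)[OF bad, symmetric]) simp
  also have "\<dots> \<le> measure ?Q (block_reject_event T r M \<union> Acc)"
    using Acc sets_block_reject_event[OF T]
    by (intro Q.finite_measure_mono sets.Un)
       (auto simp: block_reject_event_def Acc_def bad_centres_def)
  also have "\<dots> \<le> measure ?Q (block_reject_event T r M) + measure ?Q Acc"
    using Acc sets_block_reject_event[OF T] by (intro measure_Un_le) auto
  finally show ?thesis using Acc\<tau> by linarith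
qed

text \<open>\<open>l\<close> bounds the binary logarithm of \<open>e\<close>. As \<open>M\<close> is
  proportional to \<open>K\<close>, the expected number z = 128be of points of the double sample in
  a window is free of \<open>k\<close>. Although \<open>z\<close> grows with \<open>b\<close>, it
  enters only through a power with exponent \<open>d\<close>, at most 2^(17dl), and 2^b with b =
  64dl exceeds this by the required factor 512e^2.\<close>

lemma growth_bound:
  fixes d e l k b K M :: nat
  assumes d: "0 < d" and k: "0 < k" and e: "0 < e" and l: "0 < l" "e \<le> 2 ^ l"
    and b: "b = 64 * d * l" and K: "K = 32 * k * e" and M: "M = 32 * b * e * K"
  shows "2 * ((\<Sum>i\<le>d. real (2*M choose i) * (2 * (1 / real K)) ^ i) / 2 ^ b) \<le> 1 / (256 * real e ^ 2)"
proof -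
  define z where "z = 128 * real b * real e"
  have K0: "0 < K" using K k e by simp
  have dz: "real d \<le> z"
  proof -
    have "d * 1 \<le> d * (128 * 64 * l * e)" using l e by (intro mult_le_mono2) simp
    then have "d \<le> 128 * b * e" by (simp add: b ac_simps)
    then have "real d \<le> real (128 * b * e)" by (simp only: of_nat_le_iff)
    then show ?thesis by (simp add: z_def)
  qed
  have "(\<Sum>i\<le>d. real (2*M choose i) * (2 * (1 / real K)) ^ i) \<le> (\<Sum>i\<le>d. z ^ i / fact i)"
  proof (rule sum_mono)
    fix i
    have "real (fact i * (2*M choose i)) \<le> real ((2*M) ^ i)"
      using binomial_fact_pow[of "2*M" i] by (simp only: of_nat_le_iff mult.commute)
    then have "real (2*M choose i) \<le> real (2*M) ^ i / fact i" by (simp add: field_simps)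
    then have "real (2*M choose i) * (2 * (1 / real K)) ^ i \<le> real (2*M) ^ i / fact i * (2 * (1 / real K)) ^ i"
      by (rule mult_right_mono) simp
    also have "\<dots> = (real (2*M) * (2 * (1 / real K))) ^ i / fact i" by (simp only: power_mult_distrib times_divide_eq_left)
    also have "real (2*M) * (2 * (1 / real K)) = z" using K0 by (simp add: M z_def)
    finally show "real (2*M choose i) * (2 * (1 / real K)) ^ i \<le> z ^ i / fact i" .
  qed
  also have "\<dots> \<le> (exp 1 * z / real d) ^ d" by (rule sum_power_div_fact_le[OF dz d])
  also have "\<dots> \<le> (2 ^ (17 * l)) ^ d"
  proof (rule power_mono)
    have "z / real d = 2 ^ 13 * (real l * real e)" using d by (simp add: z_def b)
    also have "\<dots> \<le> 2 ^ 13 * (2 ^ l * 2 ^ l)"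
    proof (intro mult_left_mono mult_mono)
      show "real l \<le> 2 ^ l" using less_exp[of l] by (metis less_imp_le of_nat_le_iff of_nat_numeral of_nat_power)
      show "real e \<le> 2 ^ l" using l(2) by (metis of_nat_le_iff of_nat_numeral of_nat_power)
    qed auto
    \<comment> \<open>The factor 2^2 bounds \<open>exp 1\<close>.\<close>
    finally have "exp 1 * (z / real d) \<le> 2 ^ 2 * (2 ^ 13 * (2 ^ l * 2 ^ l))"
      using exp_le by (intro mult_mono) (auto simp: z_def)
    also have "\<dots> = 2 ^ (15 + 2 * l)" unfolding mult_2 power_add by simp
    also have "\<dots> \<le> 2 ^ (17 * l)" using l by (intro power_increasing) auto
    finally show "exp 1 * z / real d \<le> 2 ^ (17 * l)" by simp
  qed (simp add: z_def)
  also have "\<dots> = 2 ^ (17 * d * l)" by (simp add: power_mult[symmetric] ac_simps)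
  finally have le: "(\<Sum>i\<le>d. real (2*M choose i) * (2 * (1 / real K)) ^ i) \<le> 2 ^ (17 * d * l)" .
  have el: "(256 * real e ^ 2 * 2) * 2 ^ (17 * d * l) \<le> 2 ^ b"
  proof -
    have "real e ^ 2 \<le> (2 ^ l) ^ 2"
      using l(2) by (intro power_mono) (metis of_nat_le_iff of_nat_numeral of_nat_power, simp)
    then have "(256 * real e ^ 2 * 2) * 2 ^ (17 * d * l) \<le> (256 * (2 ^ l) ^ 2 * 2) * 2 ^ (17 * d * l)"
      by (intro mult_right_mono) auto
    also have "\<dots> = 2 ^ (9 + 2 * l + 17 * d * l)"
      by (simp add: power_add power_mult[symmetric] ac_simps)
    also have "\<dots> \<le> 2 ^ b"
    proof (rule power_increasing)
      have "1 \<le> d * l" "l \<le> d * l" using d l by (auto simp: Suc_le_eq)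
      then have "9 + 2 * l + 17 * (d * l) \<le> 64 * (d * l)" by linarith
      then show "9 + 2 * l + 17 * d * l \<le> b" by (simp add: b mult.assoc)
    qed simp
    finally show ?thesis .
  qed
  have "2 * ((\<Sum>i\<le>d. real (2*M choose i) * (2 * (1 / real K)) ^ i) / 2 ^ b) \<le> 2 * (2 ^ (17 * d * l) / 2 ^ b)"
    using le by (intro mult_left_mono divide_right_mono) auto
  also have "\<dots> \<le> 1 / (256 * real e ^ 2)" using el e by (simp add: field_simps)
  finally show ?thesis .
qed

section \<open>The tester\<close>

definition block :: "nat \<Rightarrow> nat \<Rightarrow> (nat \<Rightarrow> real) \<Rightarrow> nat \<Rightarrow> real" where
  "block n j x = (\<lambda>i\<in>{..<n}. x (j * n + i))"

lemma block_index_less: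
  fixes i j n N :: nat
  assumes "i < n" "j < N"
  shows "j * n + i < N * n"
proof -
  have "j * n + i < Suc j * n" using assms(1) by simp
  also have "\<dots> \<le> N * n" using assms(2) by (intro mult_le_mono1) simp
  finally show ?thesis .
qed

lemma distr_block:
  assumes "j < N"
  shows "distr (Pi\<^sub>M {..<N*n} (\<lambda>_. unif01)) (Pi\<^sub>M {..<n} (\<lambda>_. unif01)) (block n j) = Pi\<^sub>M {..<n} (\<lambda>_. unif01)"
  unfolding block_def
  by (rule distr_PiM_reindex) (use assms block_index_less in \<open>auto simp: inj_on_def unif01.prob_space_axioms\<close>)

lemma measurable_block:
  assumes "j < N"
  shows "block n j \<in> Pi\<^sub>M {..<N*n} (\<lambda>_. unif01) \<rightarrow>\<^sub>M Pi\<^sub>M {..<n} (\<lambda>_. unif01)"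
  unfolding block_def
proof (rule measurable_restrict)
  fix i assume "i \<in> {..<n}"
  then show "(\<lambda>x. x (j * n + i)) \<in> Pi\<^sub>M {..<N*n} (\<lambda>_. unif01) \<rightarrow>\<^sub>M unif01"
    using assms block_index_less by (intro measurable_component_singleton) simp
qed

lemma card_eq_sum_indicator:
  fixes N :: nat
  shows "real (card {j. j < N \<and> P j \<in> E}) = (\<Sum>j<N. indicator E (P j))"
proof -
  have "(\<Sum>j<N. indicator E (P j)) = (\<Sum>j<N. if P j \<in> E then 1 else (0::real))"
    by (intro sum.cong refl) (auto simp: indicator_def)
  also have "\<dots> = (\<Sum>j\<in>{j\<in>{..<N}. P j \<in> E}. 1)" by (rule sum.inter_filter[symmetric]) simp
  finally show ?thesis by simp
qed

lemma indep_coordinates_PiM_unif01: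
  assumes "I \<noteq> {}"
  shows "prob_space.indep_vars (Pi\<^sub>M I (\<lambda>_::nat. unif01)) (\<lambda>_. unif01) (\<lambda>i x. x i) I"
proof -
  let ?Q = "Pi\<^sub>M I (\<lambda>_::nat. unif01)"
  interpret Q: prob_space ?Q by (rule prob_space_PiM_unif01)
  have "distr ?Q ?Q (\<lambda>x. \<lambda>i\<in>I. x i) = ?Q"
    by (rule distr_PiM_reindex[where f = "\<lambda>i. i"]) (auto simp: unif01.prob_space_axioms)
  moreover have "?Q = Pi\<^sub>M I (\<lambda>i. distr ?Q unif01 (\<lambda>x. x i))"
    by (intro PiM_cong refl distr_PiM_component[symmetric]) (auto simp: unif01.prob_space_axioms)
  ultimately show ?thesis
    using assms by (subst Q.indep_vars_iff_distr_eq_PiM') (auto intro: measurable_component_singleton)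
qed

text \<open>Blocks use disjoint sets of coordinates, so the indicators of \<open>E\<close> on them
  are independent with mean \<open>p\<close> and values in [0,1].\<close>

lemma hoeffding_blocks:
  assumes E: "E \<in> sets (Pi\<^sub>M {..<n} (\<lambda>_. unif01))" and n: "0 < n" and N: "0 < N" and \<delta>: "0 \<le> \<delta>"
    and p: "p = measure (Pi\<^sub>M {..<n} (\<lambda>_. unif01)) E"
  shows "measure (Pi\<^sub>M {..<N*n} (\<lambda>_. unif01)) {x \<in> space (Pi\<^sub>M {..<N*n} (\<lambda>_. unif01)).
      real N * (p + \<delta>) \<le> real (card {j. j < N \<and> block n j x \<in> E})} \<le> exp (- 2 * real N * \<delta>\<^sup>2)"
    and "measure (Pi\<^sub>M {..<N*n} (\<lambda>_. unif01)) {x \<in> space (Pi\<^sub>M {..<N*n} (\<lambda>_. unif01)).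
      real (card {j. j < N \<and> block n j x \<in> E}) \<le> real N * (p - \<delta>)} \<le> exp (- 2 * real N * \<delta>\<^sup>2)"
proof -
  let ?Q = "Pi\<^sub>M {..<N*n} (\<lambda>_. unif01)" and ?P = "Pi\<^sub>M {..<n} (\<lambda>_. unif01)"
  interpret Q: prob_space ?Q by (rule prob_space_PiM_unif01)
  define X where "X j x = (indicator E (block n j x) :: real)" for j x
  have "0 \<in> {..<N*n}" using n N by simp
  then have ne: "{..<N*n} \<noteq> {}" by blast
  let ?K = "\<lambda>j. {j * n..<j * n + n}"
  have "Q.indep_vars (\<lambda>j. Pi\<^sub>M (?K j) (\<lambda>_. unif01)) (\<lambda>j x. restrict (\<lambda>i. x i) (?K j)) {..<N}"
  proof (rule Q.indep_vars_restrict[OF indep_coordinates_PiM_unif01[OF ne]])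
    fix j assume "j \<in> {..<N}"
    then have "j < N" by simp
    show "?K j \<subseteq> {..<N*n}"
    proof
      fix m assume "m \<in> ?K j"
      then have "m = j * n + (m - j * n)" "m - j * n < n" by auto
      then show "m \<in> {..<N*n}" using block_index_less[of "m - j * n" n j N] \<open>j < N\<close> by simp
    qed
  next
    have "?K i \<inter> ?K j = {}" if "i < j" for i j
    proof -
      have "Suc i * n \<le> j * n" using that by (intro mult_le_mono1) simp
      then show ?thesis by auto
    qed
    then show "disjoint_family_on ?K {..<N}"
      unfolding disjoint_family_on_def by (metis Int_commute nat_neq_iff)
  qed
  then have "Q.indep_vars (\<lambda>_. borel) (\<lambda>j x. (\<lambda>z. indicator E (\<lambda>i\<in>{..<n}. z (j * n + i)) :: real) (restrict (\<lambda>i. x i) (?K j))) {..<N}"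
  proof (rule Q.indep_vars_compose2)
    fix j assume "j \<in> {..<N}"
    have "(\<lambda>z. \<lambda>i\<in>{..<n}. z (j * n + i)) \<in> Pi\<^sub>M (?K j) (\<lambda>_. unif01) \<rightarrow>\<^sub>M ?P"
      by (intro measurable_restrict measurable_component_singleton) auto
    then show "(\<lambda>z. indicator E (\<lambda>i\<in>{..<n}. z (j * n + i)) :: real) \<in> borel_measurable (Pi\<^sub>M (?K j) (\<lambda>_. unif01))"
      by (rule measurable_compose) (rule borel_measurable_indicator[OF E])
  qed
  moreover have "(\<lambda>i\<in>{..<n}. (restrict (\<lambda>i. x i) (?K j)) (j * n + i)) = block n j x" for j and x :: "nat \<Rightarrow> real"
    by (auto simp: block_def fun_eq_iff)
  ultimately have ind: "Q.indep_vars (\<lambda>_. borel) X {..<N}" by (simp add: X_def[abs_def])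
  have exp: "Q.expectation (X j) = p" if j: "j < N" for j
  proof -
    have "Q.expectation (X j) = (\<integral>y. indicator E y \<partial>distr ?Q ?P (block n j))"
      unfolding X_def using E by (intro integral_distr[symmetric] measurable_block[OF j]) auto
    also have "\<dots> = p" unfolding distr_block[OF j] using E p by (simp add: sets.Int_space_eq2)
    finally show ?thesis .
  qed
  interpret Hoeffding_ineq ?Q "{..<N}" X "\<lambda>_. 0" "\<lambda>_. 1" "\<Sum>j<N. Q.expectation (X j)"
    by unfold_locales (use ind in \<open>auto simp: X_def indicator_def\<close>)
  have mu: "(\<Sum>j<N. Q.expectation (X j)) = real N * p" using exp by simp
  have N1: "0 < (\<Sum>i<N. (1 - 0 :: real)\<^sup>2)" using N by simp
  have e0: "0 \<le> real N * \<delta>" using \<delta> by simp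
  have eq: "- 2 * (real N * \<delta>)\<^sup>2 / (\<Sum>i<N. (1 - 0)\<^sup>2) = - 2 * real N * \<delta>\<^sup>2"
    using N by (simp add: power2_eq_square)
  show "measure ?Q {x \<in> space ?Q. real N * (p + \<delta>) \<le> real (card {j. j < N \<and> block n j x \<in> E})} \<le> exp (- 2 * real N * \<delta>\<^sup>2)"
    using Hoeffding_ineq_ge[OF e0 N1] unfolding mu eq card_eq_sum_indicator X_def by (simp add: distrib_left)
  show "measure ?Q {x \<in> space ?Q. real (card {j. j < N \<and> block n j x \<in> E}) \<le> real N * (p - \<delta>)} \<le> exp (- 2 * real N * \<delta>\<^sup>2)"
    using Hoeffding_ineq_le[OF e0 N1] unfolding mu eq card_eq_sum_indicator X_def by (simp add: right_diff_distrib)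
qed

section \<open>Query lists and their length\<close>

lemma close_pair_prob_le:
  assumes I: "finite I" "i \<in> I" "j \<in> I" "i \<noteq> j" and r: "0 \<le> r"
  shows "{x \<in> space (Pi\<^sub>M I (\<lambda>_::nat. unif01)). \<bar>x i - x j\<bar> < r} \<in> sets (Pi\<^sub>M I (\<lambda>_. unif01))"
    and "emeasure (Pi\<^sub>M I (\<lambda>_::nat. unif01)) {x \<in> space (Pi\<^sub>M I (\<lambda>_. unif01)). \<bar>x i - x j\<bar> < r} \<le> ennreal (2 * r)"
proof -
  let ?Q = "Pi\<^sub>M I (\<lambda>_::nat. unif01)"
  let ?S = "{x \<in> space ?Q. \<bar>x i - x j\<bar> < r}"
  have [measurable]: "(\<lambda>x. x i) \<in> borel_measurable ?Q" "(\<lambda>x. x j) \<in> borel_measurable ?Q"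
    using measurable_component_singleton[of i I "\<lambda>_. unif01"] measurable_component_singleton[of j I "\<lambda>_. unif01"] I
    by simp_all
  show S: "?S \<in> sets ?Q" by measurable
  define I' where "I' = I - {i}"
  interpret P: prob_space "Pi\<^sub>M I' (\<lambda>_::nat. unif01)" by (rule prob_space_PiM_unif01)
  have I': "insert i I' = I" "finite I'" "i \<notin> I'" using I by (auto simp: I'_def)
  have "emeasure ?Q ?S = (\<integral>\<^sup>+x. indicator ?S x \<partial>?Q)" using S by simp
  also have "\<dots> = (\<integral>\<^sup>+x. \<integral>\<^sup>+y. indicator ?S (x(i := y)) \<partial>unif01 \<partial>Pi\<^sub>M I' (\<lambda>_. unif01))"
    using unif01P.product_nn_integral_insert[OF I'(2,3), of "indicator ?S"] S unfolding I'(1) by simp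
  also have "\<dots> \<le> (\<integral>\<^sup>+x. ennreal (2 * r) \<partial>Pi\<^sub>M I' (\<lambda>_. unif01))"
  proof (rule nn_integral_mono)
    fix x
    have "(\<integral>\<^sup>+y. indicator ?S (x(i := y)) \<partial>unif01) \<le> (\<integral>\<^sup>+y. indicator {x j - r..x j + r} y \<partial>unif01)"
      using I(4) by (intro nn_integral_mono) (auto simp: indicator_def)
    also have "\<dots> = emeasure unif01 {x j - r..x j + r}" by (rule nn_integral_indicator) simp
    also have "\<dots> \<le> ennreal (2 * r)"
      using measure_unif01_le[of "{x j - r..x j + r}" "x j - r" "x j + r"] r
      by (simp add: unif01.emeasure_eq_measure ennreal_leI)
    finally show "(\<integral>\<^sup>+y. indicator ?S (x(i := y)) \<partial>unif01) \<le> ennreal (2 * r)" .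
  qed
  also have "\<dots> = ennreal (2 * r)" by (simp add: P.emeasure_space_1)
  finally show "emeasure ?Q ?S \<le> ennreal (2 * r)" .
qed

definition centre :: "nat \<Rightarrow> nat \<Rightarrow> nat" where
  "centre M m = (m div Suc M) * Suc M + M"

text \<open>The list is determined by the sample points, not by the labels, so all queries are fixed
  before the first answer. Centres, which have remainder \<open>M\<close>, are never
  queried.\<close>

definition windows :: "nat \<Rightarrow> nat \<Rightarrow> real \<Rightarrow> (nat \<Rightarrow> real) \<Rightarrow> nat list" where
  "windows N M r x = filter (\<lambda>m. m mod Suc M < M \<and> \<bar>x m - x (centre M m)\<bar> < r) [0..<N * Suc M]"

text \<open>Markov's inequality: each of at most N(M+1) points lies within \<open>r\<close> of its
  centre with probability at most 2r, so the expected length is at most q/10.\<close>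

lemma windows_prob:
  fixes q :: nat
  assumes r: "0 \<le> r" and q: "0 < q" "20 * real N * real (Suc M) * r \<le> real q"
  shows "{x \<in> space (Pi\<^sub>M {..<N * Suc M} (\<lambda>_. unif01)). q < length (windows N M r x)} \<in> sets (Pi\<^sub>M {..<N * Suc M} (\<lambda>_. unif01))"
    and "measure (Pi\<^sub>M {..<N * Suc M} (\<lambda>_. unif01))
      {x \<in> space (Pi\<^sub>M {..<N * Suc M} (\<lambda>_. unif01)). q < length (windows N M r x)} \<le> 1 / 10"
proof -
  let ?I = "{..<N * Suc M}"
  let ?Q = "Pi\<^sub>M ?I (\<lambda>_. unif01)"
  interpret Q: prob_space ?Q by (rule prob_space_PiM_unif01)
  define F where "F = {m\<in>?I. m mod Suc M < M}"
  define G where "G m = {x \<in> space ?Q. \<bar>x m - x (centre M m)\<bar> < r}" for m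
  have F: "finite F" "card F \<le> N * Suc M"
    using card_mono[of ?I F] by (auto simp: F_def)
  have cm: "centre M m \<in> ?I" "m \<noteq> centre M m" if "m \<in> F" for m
  proof -
    have "m div Suc M < N" using that by (simp add: F_def less_mult_imp_div_less)
    then show "centre M m \<in> ?I" using block_index_less[of M "Suc M" "m div Suc M" N] by (simp add: centre_def)
    have "centre M m mod Suc M = M" by (simp only: centre_def mod_mult_self3) simp
    then show "m \<noteq> centre M m" using that by (auto simp: F_def)
  qed
  have G: "G m \<in> sets ?Q" "emeasure ?Q (G m) \<le> ennreal (2 * r)" if "m \<in> F" for m
    using close_pair_prob_le[of ?I m "centre M m" r] cm[OF that] that r by (auto simp: G_def F_def)
  have len: "of_nat (length (windows N M r x)) = (\<Sum>m\<in>F. indicator (G m) x :: ennreal)" if x: "x \<in> space ?Q" for x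
  proof -
    have "length (windows N M r x) = card {m\<in>F. x \<in> G m}"
    proof -
      have "distinct (windows N M r x)" by (simp add: windows_def)
      then have "length (windows N M r x) = card (set (windows N M r x))" by (rule distinct_card[symmetric])
      also have "set (windows N M r x) = {m\<in>F. x \<in> G m}"
        using x by (auto simp: windows_def F_def G_def)
      finally show ?thesis .
    qed
    also have "of_nat \<dots> = (\<Sum>m\<in>F. if x \<in> G m then 1 else 0 :: ennreal)"
      using sum.inter_filter[OF F(1), of "\<lambda>_. 1::ennreal" "\<lambda>m. x \<in> G m"] by simp
    also have "\<dots> = (\<Sum>m\<in>F. indicator (G m) x)" by (intro sum.cong refl) (auto simp: indicator_def)
    finally show ?thesis .
  qed
  let ?S = "{x \<in> space ?Q. q < length (windows N M r x)}"
  have "?S = {x \<in> space ?Q. of_nat q < (\<Sum>m\<in>F. indicator (G m) x :: ennreal)}"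
    using len by (auto simp flip: len)
  also have "\<dots> \<in> sets ?Q" using G(1) by measurable
  finally show S: "?S \<in> sets ?Q" .
  have "ennreal (real q) * emeasure ?Q ?S = (\<integral>\<^sup>+x. ennreal (real q) * indicator ?S x \<partial>?Q)"
    using S by (rule nn_integral_cmult_indicator[symmetric])
  also have "\<dots> \<le> (\<integral>\<^sup>+x. (\<Sum>m\<in>F. indicator (G m) x) \<partial>?Q)"
  proof (rule nn_integral_mono)
    fix x assume x: "x \<in> space ?Q"
    show "ennreal (real q) * indicator ?S x \<le> (\<Sum>m\<in>F. indicator (G m) x)"
    proof (cases "x \<in> ?S")
      case True
      then have "ennreal (real q) * indicator ?S x = of_nat q"
        by (simp add: ennreal_of_nat_eq_real_of_nat)
      also have "\<dots> \<le> of_nat (length (windows N M r x))" using True by simp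
      also have "\<dots> = (\<Sum>m\<in>F. indicator (G m) x)" by (rule len[OF x])
      finally show ?thesis .
    qed simp
  qed
  also have "\<dots> = (\<Sum>m\<in>F. emeasure ?Q (G m))" using G(1) by (subst nn_integral_sum) auto
  also have "\<dots> \<le> (\<Sum>m\<in>F. ennreal (2 * r))" by (intro sum_mono G(2))
  also have "\<dots> = ennreal (real (card F) * (2 * r))"
    using r by (simp add: ennreal_mult ennreal_of_nat_eq_real_of_nat)
  finally have "ennreal (real q * measure ?Q ?S) \<le> ennreal (real (card F) * (2 * r))"
    by (simp only: Q.emeasure_eq_measure ennreal_mult[symmetric] measure_nonneg of_nat_0_le_iff)
  then have "real q * measure ?Q ?S \<le> real (card F) * (2 * r)"
    using r by (subst (asm) ennreal_le_iff) auto
  also have "\<dots> \<le> real (N * Suc M) * (2 * r)" using F(2) r by (intro mult_right_mono of_nat_mono) auto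
  also have "\<dots> \<le> real q * (1 / 10)" using q(2) by (simp add: algebra_simps)
  finally show "measure ?Q ?S \<le> 1 / 10" using q(1) by simp
qed

primrec ask :: "nat list \<Rightarrow> ((nat \<Rightarrow> 'y) \<Rightarrow> bool) \<Rightarrow> (nat \<Rightarrow> 'y) \<Rightarrow> 'y strategy" where
  "ask [] D a = (if D a then Accept else Reject)"
| "ask (i # is) D a = Query i (\<lambda>y. ask is D (a(i := y)))"

lemma queries_ask: "queries (ask is D a0) a = is"
  by (induction "is" arbitrary: a0) auto

lemma accepts_ask: "accepts (ask is D a0) a = D (\<lambda>i. if i \<in> set is then a i else a0 i)"
proof (induction "is" arbitrary: a0)
  case (Cons i "is")
  have "(\<lambda>j. if j \<in> set is then a j else (a0(i := a i)) j) = (\<lambda>j. if j \<in> set (i # is) then a j else a0 j)"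
    by auto
  then show ?case using Cons.IH by simp
qed simp

text \<open>
  The budget \<open>q\<close> is ten times a bound on the expected number of points in all windows, so the first
  branch is taken with probability at most 1/10.
\<close>

definition block_tester ::
    "(real \<Rightarrow> 'y) set \<Rightarrow> nat \<Rightarrow> nat \<Rightarrow> real \<Rightarrow> real \<Rightarrow> nat \<Rightarrow> (nat \<Rightarrow> real) \<Rightarrow> 'y strategy" where
  "block_tester H N M r \<theta> q x =
    (if q < length (windows N M r x) then Accept
     else ask (windows N M r x)
       (\<lambda>a. real (card {j. j < N \<and> block_rejects H r M (\<lambda>i. x (j * Suc M + i)) (\<lambda>i. a (j * Suc M + i))}) \<le> \<theta>)
       (\<lambda>_. undefined))"

text \<open>Labels outside the window do not influence the verdict, so the tester may put
  \<open>undefined\<close> at the indices that it does not query.\<close>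

lemma block_rejects_cong:
  assumes "\<And>i. i \<le> M \<Longrightarrow> y i = y' i" "\<And>i. i < M \<Longrightarrow> \<bar>y i - y M\<bar> < r \<Longrightarrow> a i = a' i"
  shows "block_rejects H r M y a = block_rejects H r M y' a'"
proof -
  have "(\<forall>i<M. \<bar>y i - y M\<bar> < r \<longrightarrow> h (y i) = a i) \<longleftrightarrow> (\<forall>i<M. \<bar>y' i - y' M\<bar> < r \<longrightarrow> h (y' i) = a' i)" for h
    using assms by (auto simp: less_imp_le)
  then show ?thesis using assms(1)[of M] by (simp add: block_rejects_def)
qed

lemma queries_block_tester:
  "set (queries (block_tester H N M r \<theta> q x) a) \<subseteq> {..<N * Suc M}"
  "length (queries (block_tester H N M r \<theta> q x) a) \<le> q"
  by (auto simp: block_tester_def queries_ask windows_def)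

lemma accepts_block_tester:
  "accepts (block_tester H N M r \<theta> q x) (\<lambda>i. f (x i)) \<longleftrightarrow> q < length (windows N M r x) \<or>
    real (card {j. j < N \<and> block_rejects H r M (block (Suc M) j x) (\<lambda>i. f (block (Suc M) j x i))}) \<le> \<theta>"
proof -
  have "block_rejects H r M (\<lambda>i. x (j * Suc M + i))
      (\<lambda>i. if j * Suc M + i \<in> set (windows N M r x) then f (x (j * Suc M + i)) else undefined)
      = block_rejects H r M (block (Suc M) j x) (\<lambda>i. f (block (Suc M) j x i))" if j: "j < N" for j
  proof (rule block_rejects_cong)
    fix i assume i: "i < M" "\<bar>x (j * Suc M + i) - x (j * Suc M + M)\<bar> < r"
    have "(j * Suc M + i) mod Suc M = i" "centre M (j * Suc M + i) = j * Suc M + M"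
      using i(1) by (simp_all only: centre_def mod_mult_self3 div_mult_self3 mod_less div_less less_Suc_eq) simp_all
    moreover have "j * Suc M + i < N * Suc M" using i(1) j by (intro block_index_less) auto
    ultimately have "j * Suc M + i \<in> set (windows N M r x)" using i by (simp add: windows_def)
    then show "(if j * Suc M + i \<in> set (windows N M r x) then f (x (j * Suc M + i)) else undefined)
        = f (block (Suc M) j x i)" using i(1) by (simp add: block_def)
  qed (simp add: block_def)
  then have eq: "{j. j < N \<and> block_rejects H r M (\<lambda>i. x (j * Suc M + i))
      (\<lambda>i. if j * Suc M + i \<in> set (windows N M r x) then f (x (j * Suc M + i)) else undefined)}
    = {j. j < N \<and> block_rejects H r M (block (Suc M) j x) (\<lambda>i. f (block (Suc M) j x i))}" by blast
  show ?thesis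
  proof (cases "q < length (windows N M r x)")
    case False
    then show ?thesis by (simp only: block_tester_def if_False accepts_ask eq simp_thms)
  qed (simp add: block_tester_def)
qed

text \<open>The event depends on the second coordinate alone, so up to a null set it is a cylinder
  over \<open>S\<close>, and the completion makes it measurable.\<close>

lemma measure_completion_cylinder:
  assumes "prob_space R" "prob_space Q" and S: "S \<in> sets Q" and AE: "AE x in Q. P x \<longleftrightarrow> x \<in> S"
  shows "measure (completion (R \<Otimes>\<^sub>M Q)) {(\<omega>, x) \<in> space (R \<Otimes>\<^sub>M Q). P x} = measure Q S"
proof -
  interpret R: prob_space R by fact
  interpret Q: prob_space Q by fact
  interpret RQ: pair_prob_space R Q ..
  let ?C = "completion (R \<Otimes>\<^sub>M Q)"
  let ?E = "{(\<omega>, x) \<in> space (R \<Otimes>\<^sub>M Q). P x}"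
  obtain N where N: "N \<in> null_sets Q" "{x \<in> space Q. \<not> (P x \<longleftrightarrow> x \<in> S)} \<subseteq> N"
    using AE by (auto elim!: AE_E simp: null_sets_def)
  have "emeasure (R \<Otimes>\<^sub>M Q) (space R \<times> N) = emeasure R (space R) * emeasure Q N"
    using N by (intro Q.emeasure_pair_measure_Times) auto
  then have null: "space R \<times> N \<in> null_sets (R \<Otimes>\<^sub>M Q)" using N by (auto simp: null_sets_def)
  have S': "space R \<times> S \<in> sets (R \<Otimes>\<^sub>M Q)" using S by auto
  have "AE z in R \<Otimes>\<^sub>M Q. z \<in> space R \<times> S \<longleftrightarrow> z \<in> ?E"
    using AE_not_in[OF null] AE_space
    by eventually_elim (use N(2) in \<open>auto simp: space_pair_measure\<close>)
  then have ae: "AE z in ?C. z \<in> space R \<times> S \<longleftrightarrow> z \<in> ?E" by (rule AE_completion)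
  have E: "?E \<in> sets ?C"
    by (rule completion.in_sets_AE[OF ae]) (use S' in \<open>auto intro: sets_completionI_sets\<close>)
  have "measure ?C ?E = measure ?C (space R \<times> S)"
    using ae E S' by (intro measure_eq_AE) (auto intro: sets_completionI_sets)
  also have "\<dots> = measure (R \<Otimes>\<^sub>M Q) (space R \<times> S)" using S' by simp
  also have "\<dots> = measure Q S"
    using S by (simp add: measure_def Q.emeasure_pair_measure_Times R.emeasure_space_1)
  finally show ?thesis .
qed

text \<open>Origin of the constants: \<open>M\<close> makes \<rho>M/2 = 2b, so the lower tail bound
  holds because (2 exp(-2))^b <= 1/2; \<open>N\<close> makes 2N\<delta>^2 = 4 for \<delta> =
  1/(256e^2); \<open>q\<close> equals 20N(2M)r, which covers \<open>windows_prob\<close> because M +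
  1 <= 2M.\<close>

lemma ex_tester:
  fixes H :: "(real \<Rightarrow> 'y) set" and d k e l b K M N q :: nat
  assumes H: "H \<noteq> {}" and tm: "trace_measurable Y H" and zc: "zero_measure_crossings H"
    and gd: "graph_dim H = enat d" and d: "0 < d" and k: "0 < k" and e: "0 < e"
    and l: "0 < l" "e \<le> 2 ^ l"
    and b: "b = 64 * d * l" and K: "K = 32 * k * e" and M: "M = 32 * b * e * K"
    and N: "N = 2 ^ 17 * e ^ 4" and q: "q = 1280 * N * b * e"
  shows "\<exists>A. is_tester Y unif01 (piecewise k H) (1 / real e) (N * Suc M) q unif01 (N * Suc M) A"
proof -
  define r where "r = 1 / real K"
  define \<rho> where "\<rho> = r / (8 * real e)"
  \<comment> \<open>Per block, members of the class are rejected with probability at most 2r(k-1),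
    far functions with probability at least 2r(k-1) + 3/(256e^2). The threshold 2r(k-1) + 2/(256e^2)
    stays at least \<delta> = 1/(256e^2) away from both.\<close>
  define \<theta> where "\<theta> = real N * (2 * r * (real k - 1) + 1 / (128 * real e ^ 2))"
  define A where "A = (\<lambda>\<omega>::real. block_tester H N M r \<theta> q)"
  let ?Q = "Pi\<^sub>M {..<N * Suc M} (\<lambda>_. unif01)"
  interpret Q: prob_space ?Q by (rule prob_space_PiM_unif01)
  have r0: "0 < r" using K k e by (simp add: r_def)
  have req: "r = 1 / (32 * real k * real e)" by (simp add: r_def K)
  have b0: "0 < b" using b d l by simp
  have N0: "0 < N" and q0: "0 < q" using N q b0 e by auto
  have M0: "0 < M" using M b0 e K k by simp
  have bexp: "2 ^ b * exp (- \<rho> * real M / 2) \<le> 1 / 2"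
  proof -
    have K0: "0 < K" using K k e by simp
    have "\<rho> * real M / 2 = 2 * real b" using K0 e by (simp add: \<rho>_def r_def M)
    then have "exp (- \<rho> * real M / 2) = exp (- (2 * real b))" by simp
    also have "\<dots> = exp (- 2) ^ b" by (simp add: exp_of_nat_mult[symmetric] mult.commute)
    finally have "2 ^ b * exp (- \<rho> * real M / 2) = (2 * exp (- 2)) ^ b" by (simp add: power_mult_distrib)
    also have "\<dots> \<le> (1 / 2) ^ b"
    proof (rule power_mono)
      have "4 \<le> exp (2::real)"
      proof -
        have "2 ^ 2 \<le> exp (1::real) ^ 2" using exp_ge_add_one_self[of 1] by (intro power_mono) auto
        then show ?thesis by (simp add: exp_of_nat_mult[symmetric])
      qed
      then show "2 * exp (- 2) \<le> (1 / 2 :: real)" by (simp add: exp_minus field_simps)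
    qed simp
    also have "\<dots> \<le> (1 / 2) ^ 1" using b0 by (intro power_decreasing) auto
    finally show ?thesis by simp
  qed
  have qle: "20 * real N * real (Suc M) * r \<le> real q"
  proof -
    have K0: "0 < K" using K k e by simp
    have "real (Suc M) \<le> 2 * real M" using M0 by simp
    then have "20 * real N * real (Suc M) * r \<le> 20 * real N * (2 * real M) * r"
      using r0 by (intro mult_right_mono mult_left_mono) auto
    also have "\<dots> = real q" using K0 by (simp add: r_def M q)
    finally show ?thesis .
  qed
  note win = windows_prob[OF less_imp_le[OF r0] q0 qle]
  have main: "(f \<in> piecewise k H \<longrightarrow> 2 / 3 \<le> measure (completion (unif01 \<Otimes>\<^sub>M ?Q))
        {(\<omega>, x) \<in> space (unif01 \<Otimes>\<^sub>M ?Q). accepts (A \<omega> x) (\<lambda>i. f (x i))}) \<and>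
      (1 / real e \<le> fdist_class unif01 f (piecewise k H) \<longrightarrow> 2 / 3 \<le> measure (completion (unif01 \<Otimes>\<^sub>M ?Q))
        {(\<omega>, x) \<in> space (unif01 \<Otimes>\<^sub>M ?Q). \<not> accepts (A \<omega> x) (\<lambda>i. f (x i))})"
    if f: "f \<in> borel \<rightarrow>\<^sub>M Y" for f
  proof -
    obtain T where T: "\<And>Z. T Z \<in> sets (Pi\<^sub>M {..<M} (\<lambda>_. unif01))"
      "AE x in Pi\<^sub>M {..<M} (\<lambda>_. unif01). \<forall>Z\<in>Pow {..<M}. x \<in> T Z \<longleftrightarrow> Z \<in> trace_sets H f M x"
      by (rule ex_measurable_trace[OF tm f, where n = M]) (rule that)
    let ?E = "block_reject_event T r M"
    note E = sets_block_reject_event[OF T(1), where r = r]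
    define p where "p = measure (Pi\<^sub>M {..<Suc M} (\<lambda>_. unif01)) ?E"
    let ?cnt = "\<lambda>x. real (card {j. j < N \<and> block (Suc M) j x \<in> ?E})"
    let ?W = "{x \<in> space ?Q. q < length (windows N M r x)}"
    let ?C = "{x \<in> space ?Q. ?cnt x \<le> \<theta>}"
    define S where "S = ?W \<union> ?C"
    have "(\<lambda>x. indicator ?E (block (Suc M) j x) :: real) \<in> borel_measurable ?Q" if "j < N" for j
      using measurable_block[OF that] borel_measurable_indicator[OF E] by (rule measurable_compose)
    then have [measurable]: "?cnt \<in> borel_measurable ?Q"
      unfolding card_eq_sum_indicator by (intro borel_measurable_sum) auto
    have C: "?C \<in> sets ?Q" by measurable
    have S: "S \<in> sets ?Q" unfolding S_def using win(1) C by (rule sets.Un)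
    have "AE x in ?Q. \<forall>j\<in>{..<N}. block (Suc M) j x \<in> ?E \<longleftrightarrow>
        block_rejects H r M (block (Suc M) j x) (\<lambda>i. f (block (Suc M) j x i))"
    proof (rule AE_finite_allI)
      fix j assume "j \<in> {..<N}"
      then have j: "j < N" by simp
      have "AE y in distr ?Q (Pi\<^sub>M {..<Suc M} (\<lambda>_. unif01)) (block (Suc M) j).
          y \<in> ?E \<longleftrightarrow> block_rejects H r M y (\<lambda>i. f (y i))"
        unfolding distr_block[OF j] by (rule AE_block_reject_event[OF T(2)])
      from AE_distrD[OF measurable_block[OF j] this]
      show "AE x in ?Q. block (Suc M) j x \<in> ?E \<longleftrightarrow>
        block_rejects H r M (block (Suc M) j x) (\<lambda>i. f (block (Suc M) j x i))" .
    qed simp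
    then have AES: "AE x in ?Q. accepts (block_tester H N M r \<theta> q x) (\<lambda>i. f (x i)) \<longleftrightarrow> x \<in> S"
      using AE_space
    proof eventually_elim
      case (elim x)
      have "{j. j < N \<and> block_rejects H r M (block (Suc M) j x) (\<lambda>i. f (block (Suc M) j x i))}
          = {j. j < N \<and> block (Suc M) j x \<in> ?E}" using elim(1) by blast
      then show ?case using elim(2) unfolding accepts_block_tester S_def by simp
    qed
    have acc: "measure (completion (unif01 \<Otimes>\<^sub>M ?Q))
        {(\<omega>, x) \<in> space (unif01 \<Otimes>\<^sub>M ?Q). accepts (A \<omega> x) (\<lambda>i. f (x i))} = measure ?Q S"
      unfolding A_def
      by (rule measure_completion_cylinder[OF unif01.prob_space_axioms Q.prob_space_axioms S AES])
    have "AE x in ?Q. \<not> accepts (block_tester H N M r \<theta> q x) (\<lambda>i. f (x i)) \<longleftrightarrow> x \<in> space ?Q - S"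
      using AES AE_space by eventually_elim auto
    then have rej: "measure (completion (unif01 \<Otimes>\<^sub>M ?Q))
        {(\<omega>, x) \<in> space (unif01 \<Otimes>\<^sub>M ?Q). \<not> accepts (A \<omega> x) (\<lambda>i. f (x i))} = measure ?Q (space ?Q - S)"
      unfolding A_def using S
      by (intro measure_completion_cylinder[OF unif01.prob_space_axioms Q.prob_space_axioms]) auto
    define \<delta> where "\<delta> = 1 / (256 * real e ^ 2)"
    have \<delta>0: "0 \<le> \<delta>" by (simp add: \<delta>_def)
    have N\<delta>: "- 2 * real N * \<delta>\<^sup>2 = - 4"
      using e by (simp add: N \<delta>_def power2_eq_square power4_eq_xxxx)
    have exp5: "exp (- 4) \<le> (1 / 5 :: real)"
      using exp_ge_add_one_self[of 4] by (simp add: exp_minus field_simps)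
    note hoeff = hoeffding_blocks[OF E _ N0 \<delta>0 p_def, unfolded N\<delta>]
    have yes: "2 / 3 \<le> measure ?Q S" if fF: "f \<in> piecewise k H"
    proof -
      have pk: "p \<le> 2 * r * (real k - 1)"
        unfolding p_def by (rule block_reject_prob_le[OF T fF r0 k])
      let ?D = "{x \<in> space ?Q. real N * (p + \<delta>) \<le> ?cnt x}"
      have "\<delta> \<le> 1 / (128 * real e ^ 2)" unfolding \<delta>_def using e by (intro divide_left_mono) auto
      then have "real N * (p + \<delta>) \<le> \<theta>"
        unfolding \<theta>_def using pk by (intro mult_left_mono add_mono) auto
      \<comment> \<open>Exceeding the query budget leads to acceptance, so for members of the class
        only a deviation of the count does harm.\<close>
      then have "space ?Q - S \<subseteq> ?D" by (auto simp: S_def)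
      moreover have "?D \<in> sets ?Q" by measurable
      ultimately have "measure ?Q (space ?Q - S) \<le> measure ?Q ?D" by (rule Q.finite_measure_mono)
      also have "\<dots> \<le> 1 / 5" using hoeff(1) exp5 by simp
      finally show ?thesis using Q.prob_compl[OF S] by simp
    qed
    have no: "2 / 3 \<le> measure ?Q (space ?Q - S)"
      if far: "1 / real e \<le> fdist_class unif01 f (piecewise k H)"
    proof -
      have far': "1 / real e \<le> fdist unif01 f g" if "g \<in> piecewise k H" for g
      proof -
        have "fdist_class unif01 f (piecewise k H) \<le> fdist unif01 f g"
          unfolding fdist_class_def using that
          by (intro cINF_lower bdd_belowI2[where m = 0]) (auto simp: fdist_def)
        then show ?thesis using far by simp
      qed
      have dis: "{x. f x \<noteq> h x} \<in> sets (completion unif01)" if "h \<in> H" for h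
        using sets_disagreement_of_far[OF k _ far' that] e by simp
      have mb: "2 * r * (real k - 1) + 1 / (64 * real e ^ 2) \<le> measure unif01 (bad_centres H f r \<rho>)"
        by (rule measure_bad_centres_of_far[OF H zc k e far' req \<rho>_def])
      have gb: "2 * ((\<Sum>i\<le>d. real (2*M choose i) * (2 * r) ^ i) / 2 ^ b) \<le> 1 / (256 * real e ^ 2)"
        unfolding r_def by (rule growth_bound[OF d k e l b K M])
      have "measure unif01 (bad_centres H f r \<rho>) - 2 * ((\<Sum>i\<le>d. real (2*M choose i) * (2 * r) ^ i) / 2 ^ b) \<le> p"
        unfolding p_def by (rule block_reject_prob_ge[OF tm f gd r0 bexp T dis])
      then have pl: "2 * r * (real k - 1) + 1 / (64 * real e ^ 2) - 1 / (256 * real e ^ 2) \<le> p"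
        using mb gb by linarith
      let ?D = "{x \<in> space ?Q. ?cnt x \<le> real N * (p - \<delta>)}"
      have "1 / (64 * real e ^ 2) - 1 / (256 * real e ^ 2) - \<delta> = 1 / (128 * real e ^ 2)"
        using e by (simp add: \<delta>_def field_simps)
      then have "\<theta> \<le> real N * (p - \<delta>)"
        unfolding \<theta>_def using pl by (intro mult_left_mono) auto
      then have "?C \<subseteq> ?D" by auto
      moreover have "?D \<in> sets ?Q" by measurable
      ultimately have "measure ?Q ?C \<le> measure ?Q ?D" by (rule Q.finite_measure_mono)
      also have "\<dots> \<le> 1 / 5" using hoeff(2) exp5 by simp
      finally have "measure ?Q ?C \<le> 1 / 5" .
      moreover have "measure ?Q S \<le> measure ?Q ?W + measure ?Q ?C"
        unfolding S_def using win(1) C by (rule measure_Un_le)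
      \<comment> \<open>A far function is accepted with probability at most 1/10 for an exceeded
        budget plus 1/5 for a deviation, below 1/3.\<close>
      ultimately have "measure ?Q S \<le> 1 / 3" using win(2) by linarith
      then show ?thesis using Q.prob_compl[OF S] by simp
    qed
    show ?thesis unfolding acc rej using yes no by blast
  qed
  have "is_tester Y unif01 (piecewise k H) (1 / real e) (N * Suc M) q unif01 (N * Suc M) A"
    unfolding is_tester_def Let_def
  proof (intro conjI allI ballI)
    show "prob_space unif01" by (rule unif01.prob_space_axioms)
    fix \<omega> x a
    show "set (queries (A \<omega> x) a) \<subseteq> {..<N * Suc M}" "length (queries (A \<omega> x) a) \<le> q"
      unfolding A_def by (rule queries_block_tester)+
  next
    fix f :: "real \<Rightarrow> 'y" assume "f \<in> borel \<rightarrow>\<^sub>M Y"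
    from main[OF this]
    show "f \<in> piecewise k H \<longrightarrow> 2 / 3 \<le> measure (completion (unif01 \<Otimes>\<^sub>M ?Q))
          {(\<omega>, x) \<in> space (unif01 \<Otimes>\<^sub>M ?Q). accepts (A \<omega> x) (\<lambda>i. f (x i))}"
      and "1 / real e \<le> fdist_class unif01 f (piecewise k H) \<longrightarrow> 2 / 3 \<le> measure (completion (unif01 \<Otimes>\<^sub>M ?Q))
          {(\<omega>, x) \<in> space (unif01 \<Otimes>\<^sub>M ?Q). \<not> accepts (A \<omega> x) (\<lambda>i. f (x i))}"
      by blast+
  qed simp
  then show ?thesis by blast
qed

text \<open>\<open>ex_tester\<close> handles distances 1/e with integer \<open>e\<close>. Rounding
  1/\<epsilon> up yields a tester for \<epsilon>, since distance at least \<epsilon> implies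
  distance at least 1/e, and e <= 2/\<epsilon> costs only constant factors.\<close>

theorem theorem1:
  "\<exists>C > (0::real). \<forall>(Y :: 'y measure) (H :: (real \<Rightarrow> 'y) set) (d::nat) (k::nat) (\<epsilon>::real).
     space Y \<noteq> {} \<longrightarrow> H \<noteq> {} \<longrightarrow> H \<subseteq> borel \<rightarrow>\<^sub>M Y \<longrightarrow> trace_measurable Y H \<longrightarrow>
     zero_measure_crossings H \<longrightarrow> graph_dim H = enat d \<longrightarrow> 0 < d \<longrightarrow> 0 < k \<longrightarrow>
     0 < \<epsilon> \<longrightarrow> \<epsilon> < 1/2 \<longrightarrow>
     (\<exists>s q. real s \<le> C * (real d * real k / \<epsilon>^6 * ln (1/\<epsilon>)) \<and>
            real q \<le> C * (real d / \<epsilon>^8 * ln (1/\<epsilon>)) \<and>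
            (\<exists>R m A. is_tester Y unif01 (piecewise k H) \<epsilon> s q R m A))"
proof -
  have "\<exists>s q. real s \<le> 6 * 2 ^ 40 * (real d * real k / \<epsilon>^6 * ln (1/\<epsilon>)) \<and>
            real q \<le> 6 * 2 ^ 40 * (real d / \<epsilon>^8 * ln (1/\<epsilon>)) \<and>
            (\<exists>R m A. is_tester Y unif01 (piecewise k H) \<epsilon> s q R m A)"
    if H: "H \<noteq> {}" and tm: "trace_measurable Y H" and zc: "zero_measure_crossings H"
      and gd: "graph_dim H = enat d" and d: "0 < d" and k: "0 < k" and \<epsilon>: "0 < \<epsilon>" "\<epsilon> < 1/2"
    for Y :: "'y measure" and H :: "(real \<Rightarrow> 'y) set" and d k :: nat and \<epsilon> :: real
  proof -
    define e where "e = nat \<lceil>1 / \<epsilon>\<rceil>"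
    define l where "l = nat \<lceil>log 2 (real e)\<rceil>"
    have i2: "2 < 1 / \<epsilon>" using \<epsilon> by (simp add: field_simps)
    have e: "1 / \<epsilon> \<le> real e" "real e \<le> 2 / \<epsilon>"
    proof -
      have ceil: "real e = of_int \<lceil>1 / \<epsilon>\<rceil>" using i2 by (simp add: e_def)
      show "1 / \<epsilon> \<le> real e" unfolding ceil by linarith
      have "real e \<le> 1 / \<epsilon> + 1" unfolding ceil by linarith
      also have "\<dots> \<le> 1 / \<epsilon> + 1 / \<epsilon>" using i2 by linarith
      finally show "real e \<le> 2 / \<epsilon>" by simp
    qed
    have e2: "2 < real e" using e(1) i2 by linarith
    then have e0: "0 < e" by simp
    have log1: "1 < log 2 (real e)" using e2 by (simp add: less_log_iff)
    have lceil: "real l = of_int \<lceil>log 2 (real e)\<rceil>" using log1 by (simp add: l_def)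
    have l0: "0 < l" using log1 by (simp add: l_def)
    have el: "e \<le> 2 ^ l"
    proof -
      have "real e = 2 powr (log 2 (real e))" using e2 by simp
      also have "\<dots> \<le> 2 powr (real l)" unfolding lceil by (intro powr_mono) auto
      also have "\<dots> = real (2 ^ l)" by (simp add: powr_realpow)
      finally show ?thesis by (simp only: of_nat_le_iff)
    qed
    define \<Lambda> where "\<Lambda> = ln (1 / \<epsilon>)"
    have ln2: "1 / 2 \<le> ln (2::real)" using ln_le_minus_one[of "1 / 2 :: real"] by (simp add: ln_div)
    have \<Lambda>: "ln 2 \<le> \<Lambda>" unfolding \<Lambda>_def by (rule ln_mono) (use i2 in linarith)+
    then have \<Lambda>0: "0 < \<Lambda>" using ln2 by linarith
    have lle: "real l \<le> 6 * \<Lambda>"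
    proof -
      have "real l \<le> log 2 (real e) + 1" unfolding lceil by linarith
      also have "log 2 (real e) \<le> log 2 (2 * (1 / \<epsilon>))" using e e2 \<epsilon> by simp
      also have "log 2 (2 * (1 / \<epsilon>)) = 1 + \<Lambda> / ln 2" using \<epsilon> by (subst log_mult) (auto simp: log_def \<Lambda>_def)
      finally have "real l \<le> 2 + \<Lambda> / ln 2" by simp
      \<comment> \<open>Since \<epsilon> < 1/2, ln(1/\<epsilon>) is at least ln 2 and absorbs the
        additive constants from rounding.\<close>
      moreover have "2 \<le> 2 * (\<Lambda> / ln 2)" using \<Lambda> ln2 by (simp add: field_simps)
      ultimately have "real l \<le> 3 * (\<Lambda> / ln 2)" by linarith
      also have "\<Lambda> / ln 2 \<le> \<Lambda> / (1 / 2)" using \<Lambda>0 ln2 by (intro divide_left_mono) auto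
      finally show ?thesis by simp
    qed
    define b where "b = 64 * d * l"
    define K where "K = 32 * k * e"
    define M where "M = 32 * b * e * K"
    define N where "N = 2 ^ 17 * e ^ 4"
    define q where "q = 1280 * N * b * e"
    obtain A where A: "is_tester Y unif01 (piecewise k H) (1 / real e) (N * Suc M) q unif01 (N * Suc M) A"
      using ex_tester[OF H tm zc gd d k e0 l0 el b_def K_def M_def N_def q_def] by blast
    have "1 / real e \<le> \<epsilon>" using e(1) e2 \<epsilon> by (simp add: field_simps)
    then have tester: "is_tester Y unif01 (piecewise k H) \<epsilon> (N * Suc M) q unif01 (N * Suc M) A"
      using A unfolding is_tester_def Let_def by (auto intro: order_trans)
    have pow: "real e ^ j \<le> 2 ^ j / \<epsilon> ^ j" for j
    proof -
      have "real e ^ j \<le> (2 / \<epsilon>) ^ j" using e(2) by (intro power_mono) auto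
      then show ?thesis by (simp add: power_divide)
    qed
    have e5: "e ^ 5 = e ^ 4 * e" and e6: "e ^ 6 = e ^ 4 * (e * e)"
      by (simp_all add: eval_nat_numeral)
    have s: "real (N * Suc M) \<le> 6 * 2 ^ 40 * (real d * real k / \<epsilon>^6 * \<Lambda>)"
    proof -
      have "0 < M" using d l0 e0 k by (simp add: M_def b_def K_def)
      then have "N * Suc M \<le> N * (2 * M)" by (intro mult_le_mono2) simp
      also have "\<dots> = 2 ^ 34 * (d * k * l * e ^ 6)"
        by (simp add: N_def M_def b_def K_def e6 ac_simps)
      finally have "real (N * Suc M) \<le> real (2 ^ 34 * (d * k * l * e ^ 6))" by (simp only: of_nat_le_iff)
      also have "\<dots> = 2 ^ 34 * (real d * real k * (real l * real e ^ 6))" by simp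
      also have "\<dots> \<le> 2 ^ 34 * (real d * real k * ((6 * \<Lambda>) * (2 ^ 6 / \<epsilon> ^ 6)))"
        using \<Lambda>0 by (intro mult_left_mono mult_mono lle pow) auto
      \<comment> \<open>The factor 2^6 stems from e <= 2/\<epsilon>, the factor 6 from l <= 6
        ln(1/\<epsilon>).\<close>
      also have "\<dots> = 6 * 2 ^ 40 * (real d * real k / \<epsilon>^6 * \<Lambda>)" by simp
      finally show ?thesis .
    qed
    have q: "real q \<le> 6 * 2 ^ 40 * (real d / \<epsilon>^8 * \<Lambda>)"
    proof -
      have "q = 1280 * 2 ^ 23 * (d * l * e ^ 5)"
        by (simp add: q_def N_def b_def e5 ac_simps)
      then have "real q = 1280 * 2 ^ 23 * (real d * (real l * real e ^ 5))" by simp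
      also have "\<dots> \<le> 1280 * 2 ^ 23 * (real d * ((6 * \<Lambda>) * (2 ^ 5 / \<epsilon> ^ 8)))"
      proof (intro mult_left_mono mult_mono lle)
        \<comment> \<open>Apart from the logarithm, the query count grows like d/\<epsilon>^5; as
          \<epsilon> < 1, this is below the stated power.\<close>
        have "2 ^ 5 / \<epsilon> ^ 5 \<le> 2 ^ 5 / \<epsilon> ^ 8"
          using \<epsilon> by (intro divide_left_mono power_decreasing) auto
        then show "real e ^ 5 \<le> 2 ^ 5 / \<epsilon> ^ 8" using pow[of 5] by linarith
      qed (use \<Lambda>0 in auto)
      also have "\<dots> = 6 * (1280 * 2 ^ 28) * (real d / \<epsilon>^8 * \<Lambda>)" by simp
      also have "\<dots> \<le> 6 * 2 ^ 40 * (real d / \<epsilon>^8 * \<Lambda>)"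
        using \<Lambda>0 \<epsilon> by (intro mult_right_mono) auto
      finally show ?thesis .
    qed
    show ?thesis using s q tester unfolding \<Lambda>_def by blast
  qed
  then show ?thesis by (intro exI[of _ "6 * 2 ^ 40"]) simp
qed

end
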